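(* Let $E$ be a Lie conformal algebroid over the differential algebra $A$ and let $M$ be a module over $E$. For $k\ge0$ and $\varphi\in C^k(E,M)$ the formula $$(d\varphi)_{\lambda_1,\dots,\lambda_{k+1}}(u_1,\dots,u_{k+1})=\sum_{i=1}^{k+1}(-1)^{i+1}{u_i}_{\lambda_i}\Big(\varphi_{\lambda_1,\overset{i}{\check\dots},\lambda_{k+1}}(u_1,\overset{i}{\check\dots},u_{k+1})\Big)+\sum_{1\le i<j\le k+1}(-1)^{i+j}\varphi_{\lambda_i+\lambda_j,\lambda_1,\overset{i}{\check\dots}\overset{j}{\check\dots},\lambda_{k+1}}\big([{u_i}_{\lambda_i}u_j],u_1,\overset{i}{\check\dots}\overset{j}{\check\dots},u_{k+1}\big)$$ provides a well defined linear map $d:C^k(E,M)\to C^{k+1}(E,M)$, and $d\circ d=0$.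
   Context: Everything is over a field $\mathbb F$ of characteristic $0$. A differential algebra $A$ is a commutative associative unital algebra with a derivation $\partial$; $A[\partial]$ is the associative algebra of differential operators $a(\partial)=\sum_i a_i\partial^i$ (product = composition), with symbol $a(x)=\sum_ia_ix^i$ and adjoint symbol $a^*(\lambda)=\sum_i(-\lambda-\partial)^i(a_i)\in A[\lambda]$. Substitution convention: in an expression containing a factor $\big(\big|_{x=\partial}f\big)$, expand the whole expression in powers of the commuting indeterminate $x$ and replace each $x^n$ by $\partial^n$ acting only on what is inside that parenthesis (on coefficients, if $f$ is a polynomial). E.g. $a(\lambda+x)\big(\big|_{x=\partial}b\big)c=c\sum_ia_i(\lambda+\partial)^i(b)$. For $\theta_\lambda$ linear, $\theta_\lambda(a(x))=\sum_i\theta_\lambda(a_i)x^i$. $\mathrm{CDer}(A)$ is the space of linear maps $\phi_\lambda:A\to A[\lambda]$ with $\phi_\lambda(\partial a)=(\partial+\lambda)\phi_\lambda(a)$ and $\phi_\lambda(ab)=\phi_\lambda(a)b+a\phi_\lambda(b)$; it is a left $A[\partial]$-module by $(a(\partial)\phi)_\lambda=\big(\big|_{x=\partial}a^*(\lambda)\big)\phi_{\lambda+x}$. A Lie conformal algebra (LCA) is an $\mathbb F[\partial]$-module $E$ with a bilinear $\lambda$-bracket $[\cdot_\lambda\cdot]:E\otimes E\to E[\lambda]$ with: $[\partial u_\lambda v]=-\lambda[u_\lambda v]$, $[u_\lambda\partial v]=(\partial+\lambda)[u_\lambda v]$; $[v_\lambda u]=-\big(\big|_{x=\partial}[u_{-\lambda-x}v]\big)$;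 $[u_\lambda[v_\mu w]]-[v_\mu[u_\lambda w]]=[[u_\lambda v]_{\lambda+\mu}w]$. A Lie conformal algebroid (LCAd) over $A$ is a left $A[\partial]$-module $E$ with a left $A[\partial]$-module homomorphism $\theta:E\to\mathrm{CDer}(A)$ (anchor) and an LCA $\lambda$-bracket such that (i) $[u_\lambda a(\partial)v]=a(\lambda+x)\big(\big|_{x=\partial}[u_\lambda v]\big)+\theta(u)_\lambda(a(x))\big(\big|_{x=\partial}v\big)$, and (ii) $\theta([u_\lambda v])_\mu(a)=\theta(u)_\lambda(\theta(v)_{\mu-\lambda}(a))-\theta(v)_{\mu-\lambda}(\theta(u)_\lambda(a))$. A module over the LCAd $E$ is a left $A[\partial]$-module $M$ with a bilinear $\lambda$-action $E\times M\to M[\lambda]$, $(u,m)\mapsto u_\lambda m$, such that (i) $u_\lambda(a(\partial)m)=a(\lambda+x)\big(\big|_{x=\partial}u_\lambda m\big)+\theta(u)_\lambda(a(x))\big(\big|_{x=\partial}m\big)$; (ii) $(a(\partial)u)_\lambda m=\big(\big|_{x=\partial}a^*(\lambda)\big)(u_{\lambda+x}m)$; (iii) $[u_\lambda v]_\mu m=u_\lambda(v_{\mu-\lambda}m)-v_{\mu-\lambda}(u_\lambda m)$. $C^k(E,M)$, $k\ge0$, is the space of linear maps $\varphi_{\lambda_1,\dots,\lambda_k}:E^{\otimes k}\to M[\lambda_1,\dots,\lambda_k]/\langle\partial+\lambda_1+\dots+\lambda_k\rangle$ (quotient by the image of the operator $\partial+\lambda_1+\dots+\lambda_k$; in particular $C^0(E,M)=M/\partial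 M$) such that $\varphi_{\lambda_1,\dots,\lambda_k}(a_1(\partial)u_1,\dots,a_k(\partial)u_k)=\big(\big|_{x_1=\partial}a_1^*(\lambda_1)\big)\cdots\big(\big|_{x_k=\partial}a_k^*(\lambda_k)\big)\varphi_{\lambda_1+x_1,\dots,\lambda_k+x_k}(u_1,\dots,u_k)$ for $a_i(\partial)\in A[\partial]$, and $\varphi_{\lambda_1,\dots,\lambda_k}(u_1,\dots,u_k)=\mathrm{sign}(\pi)\,\varphi_{\lambda_{\pi(1)},\dots,\lambda_{\pi(k)}}(u_{\pi(1)},\dots,u_{\pi(k)})$ for all $\pi\in S_k$. $\overset{i}{\check\dots}$ means that the $i$-th entry is omitted. In the formula for $d$ the expression is computed on polynomial representatives, with ${u_i}_{\lambda_i}$ and $\varphi$ extended linearly over polynomials in the $\lambda$'s. *)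

theory Defs
  imports
    Complex_Main
    "HOL-Computational_Algebra.Polynomial"
    "HOL-Combinatorics.Permutations"
    "HOL-Library.Poly_Mapping"
    "HOL-Library.FuncSet"
begin

section \<open>Polynomials with coefficients in a module, and substitution of operators\<close>

text \<open>
  Polynomials in one variable with coefficients in an abelian group are elements of the library
  type \<^typ>\<open>'x poly\<close>. Polynomials in several variables \<open>\<lambda>\<^sub>0, \<lambda>\<^sub>1, \<dots>\<close> with coefficients in an
  abelian group (which need not be a ring) are finitely supported families indexed by monomials.
  Variables are numbered from 0.
\<close>

type_synonym 'x mpoly = "(nat \<Rightarrow>\<^sub>0 nat) \<Rightarrow>\<^sub>0 'x"

definition mconst :: "'x::zero \<Rightarrow> 'x mpoly" where
  "mconst c = Poly_Mapping.single 0 c"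

text \<open>Multiplication by the variable \<open>\<lambda>\<^sub>i\<close>, as an operator.\<close>

definition mvar :: "nat \<Rightarrow> 'x::comm_monoid_add mpoly \<Rightarrow> 'x mpoly" where
  "mvar i p = (\<Sum>\<alpha>\<in>Poly_Mapping.keys p.
     Poly_Mapping.single (Poly_Mapping.single i 1 + \<alpha>) (Poly_Mapping.lookup p \<alpha>))"

text \<open>The polynomials that only involve \<open>\<lambda>\<^sub>0, \<dots>, \<lambda>\<^sub>k\<^sub>-\<^sub>1\<close>.\<close>

definition mpolys :: "nat \<Rightarrow> 'x::zero mpoly set" where
  "mpolys k = {p. \<forall>\<alpha>\<in>Poly_Mapping.keys p. Poly_Mapping.keys \<alpha> \<subseteq> {..<k}}"

text \<open>
  Substitution is written with operators: \<open>psubst T g p\<close> is \<open>\<Sum>\<^sub>n T\<^sup>n (g p\<^sub>n)\<close>, i.e. \<open>g\<close> is extended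
  linearly over polynomials and the variable is replaced by the operator \<open>T\<close>. In \<open>msubst Ts g p\<close>
  the variable \<open>\<lambda>\<^sub>l\<close> is replaced by the operator \<open>Ts ! l\<close>; the operators are always commuting.
\<close>

definition psubst :: "('p \<Rightarrow> 'p) \<Rightarrow> ('x::zero \<Rightarrow> 'p::comm_monoid_add) \<Rightarrow> 'x poly \<Rightarrow> 'p" where
  "psubst T g p = (\<Sum>n\<le>degree p. (T ^^ n) (g (coeff p n)))"

definition msubst ::
    "('p \<Rightarrow> 'p) list \<Rightarrow> ('x::zero \<Rightarrow> 'p::comm_monoid_add) \<Rightarrow> 'x mpoly \<Rightarrow> 'p" where
  "msubst Ts g p = (\<Sum>\<alpha>\<in>Poly_Mapping.keys p.
     foldr (\<lambda>l. (Ts ! l) ^^ Poly_Mapping.lookup \<alpha> l) [0..<length Ts] (g (Poly_Mapping.lookup p \<alpha>)))"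

text \<open>The operator \<open>\<lambda> + \<partial>\<close>, where \<open>\<partial>\<close> is \<open>d\<close> acting on coefficients.\<close>

definition var_plus :: "('x::ab_group_add \<Rightarrow> 'x) \<Rightarrow> 'x poly \<Rightarrow> 'x poly" where
  "var_plus d p = pCons 0 p + map_poly d p"

section \<open>Differential algebras and differential operators\<close>

locale differential_algebra = vector_space scA
  for scA :: "'f::field_char_0 \<Rightarrow> 'a::comm_ring_1 \<Rightarrow> 'a" +
  fixes D :: "'a \<Rightarrow> 'a"
  assumes scale_mult: "scA c (a * b) = scA c a * b"
    and D_linear: "Vector_Spaces.linear scA scA D"
    and D_mult: "D (a * b) = D a * b + a * D b"

text \<open>
  A differential operator \<open>\<Sum>\<^sub>i a\<^sub>i \<partial>\<^sup>i\<close> is represented by its symbol \<open>\<Sum>\<^sub>i a\<^sub>i x\<^sup>i\<close>.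
  \<open>symbol_shift mul d a w\<close> is \<open>a(\<lambda> + x)(|\<^sub>x\<^sub>=\<^sub>\<partial> w) = \<Sum>\<^sub>i a\<^sub>i (\<lambda> + \<partial>)\<^sup>i w\<close>, for a polynomial \<open>w\<close> in
  \<open>\<lambda>\<close> whose coefficients are multiplied by elements of \<open>A\<close> via \<open>mul\<close> and differentiated by \<open>d\<close>.
  Applied to symbols it gives the composition of operators, because \<open>\<partial> \<circ> b = b \<partial> + \<partial>(b)\<close>.
\<close>

definition symbol_shift ::
    "('a::zero \<Rightarrow> 'x \<Rightarrow> 'x) \<Rightarrow> ('x::ab_group_add \<Rightarrow> 'x) \<Rightarrow> 'a poly \<Rightarrow> 'x poly \<Rightarrow> 'x poly" where
  "symbol_shift mul d a w = (\<Sum>i\<le>degree a. map_poly (mul (coeff a i)) ((var_plus d ^^ i) w))"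

definition dop_mult :: "('a::comm_ring_1 \<Rightarrow> 'a) \<Rightarrow> 'a poly \<Rightarrow> 'a poly \<Rightarrow> 'a poly" where
  "dop_mult D a b = symbol_shift (*) D a b"

definition adj_symbol :: "('a::comm_ring_1 \<Rightarrow> 'a) \<Rightarrow> 'a poly \<Rightarrow> 'a poly" where
  "adj_symbol D a = psubst (\<lambda>p. - var_plus D p) (\<lambda>c. [:c:]) a"

text \<open>
  \<open>twist D mul q w\<close> is \<open>(|\<^sub>x\<^sub>=\<^sub>\<partial> q(\<lambda>)) w(\<lambda> + x) = \<Sum>\<^sub>n ((\<lambda> + \<partial>)\<^sup>n q(\<lambda>)) w\<^sub>n\<close> for a polynomial \<open>q\<close> over \<open>A\<close>.
\<close>

definition twist ::
    "('a::comm_ring_1 \<Rightarrow> 'a) \<Rightarrow> ('a \<Rightarrow> 'x \<Rightarrow> 'x) \<Rightarrow> 'a poly \<Rightarrow> 'x::comm_monoid_add poly \<Rightarrow> 'x poly" where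
  "twist D mul q w =
     (\<Sum>n\<le>degree w. map_poly (\<lambda>b. mul b (coeff w n)) ((var_plus D ^^ n) q))"

text \<open>Left modules over the algebra of differential operators.\<close>

locale dop_module = differential_algebra scA D
  for scA :: "'f::field_char_0 \<Rightarrow> 'a::comm_ring_1 \<Rightarrow> 'a" and D :: "'a \<Rightarrow> 'a" +
  fixes act :: "'a poly \<Rightarrow> 'u::ab_group_add \<Rightarrow> 'u"
  assumes act_add_left: "act (P + Q) u = act P u + act Q u"
    and act_add_right: "act P (u + v) = act P u + act P v"
    and act_one: "act 1 u = u"
    and act_mult: "act (dop_mult D P Q) u = act P (act Q u)"

definition mod_mul :: "('a::zero poly \<Rightarrow> 'u \<Rightarrow> 'u) \<Rightarrow> 'a \<Rightarrow> 'u \<Rightarrow> 'u" where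
  "mod_mul act a u = act [:a:] u"

definition mod_D :: "('a::comm_ring_1 poly \<Rightarrow> 'u \<Rightarrow> 'u) \<Rightarrow> 'u \<Rightarrow> 'u" where
  "mod_D act u = act [:0, 1:] u"

definition mod_scale ::
    "('f \<Rightarrow> 'a::comm_ring_1 \<Rightarrow> 'a) \<Rightarrow> ('a poly \<Rightarrow> 'u \<Rightarrow> 'u) \<Rightarrow> 'f \<Rightarrow> 'u \<Rightarrow> 'u" where
  "mod_scale scA act c u = act [:scA c 1:] u"

section \<open>Conformal derivations\<close>

definition CDer ::
    "('f::field_char_0 \<Rightarrow> 'a::comm_ring_1 \<Rightarrow> 'a) \<Rightarrow> ('a \<Rightarrow> 'a) \<Rightarrow> ('a \<Rightarrow> 'a poly) set" where
  "CDer scA D = {\<phi>. Vector_Spaces.linear scA (\<lambda>c. map_poly (scA c)) \<phi> \<and>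
     (\<forall>a. \<phi> (D a) = var_plus D (\<phi> a)) \<and>
     (\<forall>a b. \<phi> (a * b) = smult b (\<phi> a) + smult a (\<phi> b))}"

definition cder_act ::
    "('a::comm_ring_1 \<Rightarrow> 'a) \<Rightarrow> 'a poly \<Rightarrow> ('a \<Rightarrow> 'a poly) \<Rightarrow> 'a \<Rightarrow> 'a poly" where
  "cder_act D a \<phi> = (\<lambda>b. twist D (*) (adj_symbol D a) (\<phi> b))"

section \<open>Lie conformal algebras, algebroids and their modules\<close>

text \<open>
  The \<open>\<lambda>\<close>-bracket \<open>[u\<^sub>\<lambda> v]\<close> is \<open>br u v\<close>, a polynomial in \<open>\<lambda>\<close>. In identities with two variables,
  \<open>mvar 0\<close> is \<open>\<lambda>\<close> and \<open>mvar 1\<close> is \<open>\<mu>\<close>.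
\<close>

locale lie_conformal_algebra = vector_space sc
  for sc :: "'f::field_char_0 \<Rightarrow> 'e::ab_group_add \<Rightarrow> 'e" +
  fixes dE :: "'e \<Rightarrow> 'e" and br :: "'e \<Rightarrow> 'e \<Rightarrow> 'e poly"
  assumes dE_linear: "Vector_Spaces.linear sc sc dE"
    and br_linear_left: "Vector_Spaces.linear sc (\<lambda>c. map_poly (sc c)) (\<lambda>u. br u v)"
    and br_linear_right: "Vector_Spaces.linear sc (\<lambda>c. map_poly (sc c)) (\<lambda>v. br u v)"
    and br_dE_left: "br (dE u) v = - pCons 0 (br u v)"
    and br_dE_right: "br u (dE v) = var_plus dE (br u v)"
    and br_skew: "br v u = - psubst (\<lambda>p. - var_plus dE p) (\<lambda>e. [:e:]) (br u v)"
    and br_jacobi: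
      "psubst (mvar 1) (\<lambda>e. psubst (mvar 0) mconst (br u e)) (br v w)
       - psubst (mvar 0) (\<lambda>e. psubst (mvar 1) mconst (br v e)) (br u w)
       = psubst (mvar 0) (\<lambda>e. psubst (\<lambda>p. mvar 0 p + mvar 1 p) mconst (br e w)) (br u v)"

text \<open>
  \<open>anchor_term mul d \<theta>\<^sub>u a v\<close> is \<open>\<theta>(u)\<^sub>\<lambda>(a(x))(|\<^sub>x\<^sub>=\<^sub>\<partial> v) = \<Sum>\<^sub>i \<theta>(u)\<^sub>\<lambda>(a\<^sub>i) \<partial>\<^sup>i(v)\<close>.
\<close>

definition anchor_term ::
    "('a::zero \<Rightarrow> 'x \<Rightarrow> 'x) \<Rightarrow> ('x::comm_monoid_add \<Rightarrow> 'x) \<Rightarrow> ('a \<Rightarrow> 'a poly) \<Rightarrow> 'a poly \<Rightarrow> 'x \<Rightarrow> 'x poly" where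
  "anchor_term mul d \<theta>u a v =
     (\<Sum>i\<le>degree a. map_poly (\<lambda>b. mul b ((d ^^ i) v)) (\<theta>u (coeff a i)))"

locale lie_conformal_algebroid =
  A: dop_module scA D actE +
  L: lie_conformal_algebra "mod_scale scA actE" "mod_D actE" br
  for scA :: "'f::field_char_0 \<Rightarrow> 'a::comm_ring_1 \<Rightarrow> 'a" and D :: "'a \<Rightarrow> 'a"
    and actE :: "'a poly \<Rightarrow> 'e::ab_group_add \<Rightarrow> 'e"
    and br :: "'e \<Rightarrow> 'e \<Rightarrow> 'e poly" +
  fixes \<theta> :: "'e \<Rightarrow> 'a \<Rightarrow> 'a poly"
  assumes anchor_CDer: "\<theta> u \<in> CDer scA D"
    and anchor_add: "\<theta> (u + v) = (\<lambda>b. \<theta> u b + \<theta> v b)"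
    and anchor_act: "\<theta> (actE P u) = cder_act D P (\<theta> u)"
    and br_act: "br u (actE P v) =
      symbol_shift (mod_mul actE) (mod_D actE) P (br u v)
      + anchor_term (mod_mul actE) (mod_D actE) (\<theta> u) P v"
    and anchor_br:
      "psubst (mvar 0) (\<lambda>e. psubst (mvar 1) mconst (\<theta> e a)) (br u v) =
       psubst (\<lambda>p. mvar 1 p - mvar 0 p) (\<lambda>b. psubst (mvar 0) mconst (\<theta> u b)) (\<theta> v a)
       - psubst (mvar 0) (\<lambda>b. psubst (\<lambda>p. mvar 1 p - mvar 0 p) mconst (\<theta> v b)) (\<theta> u a)"

locale lie_conformal_algebroid_module =
  E: lie_conformal_algebroid scA D actE br \<theta> +
  M: dop_module scA D actM
  for scA :: "'f::field_char_0 \<Rightarrow> 'a::comm_ring_1 \<Rightarrow> 'a" and D :: "'a \<Rightarrow> 'a"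
    and actE :: "'a poly \<Rightarrow> 'e::ab_group_add \<Rightarrow> 'e"
    and br :: "'e \<Rightarrow> 'e \<Rightarrow> 'e poly" and \<theta> :: "'e \<Rightarrow> 'a \<Rightarrow> 'a poly"
    and actM :: "'a poly \<Rightarrow> 'm::ab_group_add \<Rightarrow> 'm" +
  fixes lact :: "'e \<Rightarrow> 'm \<Rightarrow> 'm poly"
  assumes lact_linear_left: "Vector_Spaces.linear (mod_scale scA actE)
      (\<lambda>c. map_poly (mod_scale scA actM c)) (\<lambda>u. lact u m)"
    and lact_linear_right: "Vector_Spaces.linear (mod_scale scA actM)
      (\<lambda>c. map_poly (mod_scale scA actM c)) (\<lambda>m. lact u m)"
    and lact_act_right: "lact u (actM P m) =
      symbol_shift (mod_mul actM) (mod_D actM) P (lact u m)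
      + anchor_term (mod_mul actM) (mod_D actM) (\<theta> u) P m"
    and lact_act_left: "lact (actE P u) m = twist D (mod_mul actM) (adj_symbol D P) (lact u m)"
    and lact_br:
      "psubst (mvar 0) (\<lambda>e. psubst (mvar 1) mconst (lact e m)) (br u v) =
       psubst (\<lambda>p. mvar 1 p - mvar 0 p) (\<lambda>n. psubst (mvar 0) mconst (lact u n)) (lact v m)
       - psubst (mvar 0) (\<lambda>n. psubst (\<lambda>p. mvar 1 p - mvar 0 p) mconst (lact v n)) (lact u m)"

section \<open>Cochains\<close>

text \<open>
  The quotient of \<open>M[\<lambda>\<^sub>0, \<dots>, \<lambda>\<^sub>k\<^sub>-\<^sub>1]\<close> by the image of \<open>\<partial> + \<lambda>\<^sub>0 + \<dots> + \<lambda>\<^sub>k\<^sub>-\<^sub>1\<close> is \<open>mpolys k // qrel dM k\<close>.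
  Operations on it are lifted from representatives in the style of \<^theory>\<open>HOL.Equiv_Relations\<close>.
\<close>

definition total_D :: "('m::ab_group_add \<Rightarrow> 'm) \<Rightarrow> nat \<Rightarrow> 'm mpoly \<Rightarrow> 'm mpoly" where
  "total_D dM k p = Poly_Mapping.map dM p + (\<Sum>i<k. mvar i p)"

definition qrel :: "('m::ab_group_add \<Rightarrow> 'm) \<Rightarrow> nat \<Rightarrow> ('m mpoly \<times> 'm mpoly) set" where
  "qrel dM k = {(p, q). p \<in> mpolys k \<and> q \<in> mpolys k \<and> p - q \<in> total_D dM k ` mpolys k}"

definition qclass :: "('m::ab_group_add \<Rightarrow> 'm) \<Rightarrow> nat \<Rightarrow> 'm mpoly \<Rightarrow> 'm mpoly set" where
  "qclass dM k p = qrel dM k `` {p}"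

definition qadd ::
    "('m::ab_group_add \<Rightarrow> 'm) \<Rightarrow> nat \<Rightarrow> 'm mpoly set \<Rightarrow> 'm mpoly set \<Rightarrow> 'm mpoly set" where
  "qadd dM k X Y = (\<Union>p\<in>X. \<Union>q\<in>Y. qclass dM k (p + q))"

definition qscale ::
    "('f \<Rightarrow> 'm \<Rightarrow> 'm) \<Rightarrow> ('m::ab_group_add \<Rightarrow> 'm) \<Rightarrow> nat \<Rightarrow> 'f \<Rightarrow> 'm mpoly set \<Rightarrow> 'm mpoly set" where
  "qscale scM dM k c X = (\<Union>p\<in>X. qclass dM k (Poly_Mapping.map (scM c) p))"

text \<open>
  \<open>multi_twist D mul as p\<close> is
  \<open>(|\<^bsub>x\<^sub>0=\<partial>\<^esub> a\<^sub>0\<^sup>*(\<lambda>\<^sub>0)) \<cdots> (|\<^bsub>x\<^sub>k\<^sub>-\<^sub>1=\<partial>\<^esub> a\<^sub>k\<^sub>-\<^sub>1\<^sup>*(\<lambda>\<^sub>k\<^sub>-\<^sub>1)) p(\<lambda>\<^sub>0 + x\<^sub>0, \<dots>, \<lambda>\<^sub>k\<^sub>-\<^sub>1 + x\<^sub>k\<^sub>-\<^sub>1)\<close>: the coefficient of the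
  monomial \<open>\<alpha>\<close> of \<open>p\<close> is multiplied by \<open>(\<lambda>\<^sub>i + \<partial>)\<^bsup>\<alpha>\<^sub>i\<^esup> a\<^sub>i\<^sup>*(\<lambda>\<^sub>i)\<close> for every \<open>i < k\<close>.
\<close>

definition mpoly_mul ::
    "('a::zero \<Rightarrow> 'm \<Rightarrow> 'm) \<Rightarrow> nat \<Rightarrow> 'a poly \<Rightarrow> 'm::comm_monoid_add mpoly \<Rightarrow> 'm mpoly" where
  "mpoly_mul mul i q p = psubst (mvar i) (\<lambda>b. Poly_Mapping.map (mul b) p) q"

definition multi_twist ::
    "('a::comm_ring_1 \<Rightarrow> 'a) \<Rightarrow> ('a \<Rightarrow> 'm \<Rightarrow> 'm) \<Rightarrow> 'a poly list \<Rightarrow> 'm::comm_monoid_add mpoly \<Rightarrow> 'm mpoly" where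
  "multi_twist D mul as p = (\<Sum>\<alpha>\<in>Poly_Mapping.keys p.
     foldr (\<lambda>i. mpoly_mul mul i ((var_plus D ^^ Poly_Mapping.lookup \<alpha> i) (adj_symbol D (as ! i))))
       [0..<length as] (mconst (Poly_Mapping.lookup p \<alpha>)))"

text \<open>
  A \<open>k\<close>-cochain is a function on lists of length \<open>k\<close>, extended by \<^const>\<open>undefined\<close> to other lists,
  so that equality of cochains is equality of functions.
\<close>

definition cochains ::
    "('f::field_char_0 \<Rightarrow> 'a::comm_ring_1 \<Rightarrow> 'a) \<Rightarrow> ('a \<Rightarrow> 'a) \<Rightarrow> ('a poly \<Rightarrow> 'e::ab_group_add \<Rightarrow> 'e)
      \<Rightarrow> ('a poly \<Rightarrow> 'm::ab_group_add \<Rightarrow> 'm) \<Rightarrow> nat \<Rightarrow> ('e list \<Rightarrow> 'm mpoly set) set" where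
  "cochains scA D actE actM k =
    {\<phi> \<in> {us. length us = k} \<rightarrow>\<^sub>E (mpolys k // qrel (mod_D actM) k).
      (\<forall>us i v w. length us = k \<longrightarrow> i < k \<longrightarrow>
        \<phi> (us[i := v + w]) = qadd (mod_D actM) k (\<phi> (us[i := v])) (\<phi> (us[i := w]))) \<and>
      (\<forall>us i c v. length us = k \<longrightarrow> i < k \<longrightarrow>
        \<phi> (us[i := mod_scale scA actE c v]) =
          qscale (mod_scale scA actM) (mod_D actM) k c (\<phi> (us[i := v]))) \<and>
      (\<forall>as us. length as = k \<longrightarrow> length us = k \<longrightarrow>
        \<phi> (map2 actE as us) =
          (\<Union>p\<in>\<phi> us. qclass (mod_D actM) k (multi_twist D (mod_mul actM) as p))) \<and>
      (\<forall>us \<pi>. length us = k \<longrightarrow> \<pi> permutes {..<k} \<longrightarrow>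
        \<phi> us = qscale (mod_scale scA actM) (mod_D actM) k (of_int (sign \<pi>))
          (\<Union>p\<in>\<phi> (permute_list \<pi> us).
            qclass (mod_D actM) k (msubst (map mvar (map \<pi> [0..<k])) mconst p)))}"

definition cochain_add ::
    "('a::comm_ring_1 poly \<Rightarrow> 'm::ab_group_add \<Rightarrow> 'm) \<Rightarrow> nat \<Rightarrow>
      ('e list \<Rightarrow> 'm mpoly set) \<Rightarrow> ('e list \<Rightarrow> 'm mpoly set) \<Rightarrow> 'e list \<Rightarrow> 'm mpoly set" where
  "cochain_add actM k \<phi> \<psi> = (\<lambda>us\<in>{us. length us = k}. qadd (mod_D actM) k (\<phi> us) (\<psi> us))"

definition cochain_scale ::
    "('f \<Rightarrow> 'a::comm_ring_1 \<Rightarrow> 'a) \<Rightarrow> ('a poly \<Rightarrow> 'm::ab_group_add \<Rightarrow> 'm) \<Rightarrow> nat \<Rightarrow> 'f \<Rightarrow>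
      ('e list \<Rightarrow> 'm mpoly set) \<Rightarrow> 'e list \<Rightarrow> 'm mpoly set" where
  "cochain_scale scA actM k c \<phi> =
     (\<lambda>us\<in>{us. length us = k}. qscale (mod_scale scA actM) (mod_D actM) k c (\<phi> us))"

definition cochain_zero ::
    "('a::comm_ring_1 poly \<Rightarrow> 'm::ab_group_add \<Rightarrow> 'm) \<Rightarrow> nat \<Rightarrow> 'e list \<Rightarrow> 'm mpoly set" where
  "cochain_zero actM k = (\<lambda>us\<in>{us. length us = k}. qclass (mod_D actM) k 0)"

section \<open>The differential\<close>

text \<open>
  \<open>reps k \<phi>\<close> consists of the choices of polynomial representatives of all values of \<open>\<phi>\<close>.
  In \<open>diff_formula\<close> the indices run from 0 to \<open>k\<close>, which does not change the parity of \<open>i + j\<close> and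
  turns \<open>(-1)\<^bsup>i+1\<^esup>\<close> into \<open>(-1)\<^sup>i\<close>. Entries are omitted, both from the list of arguments and from the
  list of variables, by \<^const>\<open>nths\<close>.
\<close>

definition reps :: "nat \<Rightarrow> ('e list \<Rightarrow> 'm mpoly set) \<Rightarrow> ('e list \<Rightarrow> 'm::zero mpoly) set" where
  "reps k \<phi> = {f. \<forall>us. length us = k \<longrightarrow> f us \<in> \<phi> us}"

definition diff_formula ::
    "('f::field_char_0 \<Rightarrow> 'a::comm_ring_1 \<Rightarrow> 'a) \<Rightarrow> ('e::ab_group_add \<Rightarrow> 'e \<Rightarrow> 'e poly)
      \<Rightarrow> ('a poly \<Rightarrow> 'm::ab_group_add \<Rightarrow> 'm) \<Rightarrow> ('e \<Rightarrow> 'm \<Rightarrow> 'm poly)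
      \<Rightarrow> nat \<Rightarrow> ('e list \<Rightarrow> 'm mpoly) \<Rightarrow> 'e list \<Rightarrow> 'm mpoly" where
  "diff_formula scA br actM lact k f us =
     (\<Sum>i\<le>k. Poly_Mapping.map (mod_scale scA actM ((-1) ^ i))
        (msubst (map mvar (nths [0..<Suc k] (- {i})))
          (\<lambda>m. psubst (mvar i) mconst (lact (us ! i) m))
          (f (nths us (- {i})))))
     + (\<Sum>j\<le>k. \<Sum>i<j. Poly_Mapping.map (mod_scale scA actM ((-1) ^ (i + j)))
        (psubst (mvar i)
          (\<lambda>e. msubst ((\<lambda>p. mvar i p + mvar j p) # map mvar (nths [0..<Suc k] (- {i, j})))
             mconst (f (e # nths us (- {i, j}))))
          (br (us ! i) (us ! j))))"

text \<open>
  The union over all choices of representatives is a single class if and only if the class does not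
  depend on the choice.
\<close>

definition differential ::
    "('f::field_char_0 \<Rightarrow> 'a::comm_ring_1 \<Rightarrow> 'a) \<Rightarrow> ('e::ab_group_add \<Rightarrow> 'e \<Rightarrow> 'e poly)
      \<Rightarrow> ('a poly \<Rightarrow> 'm::ab_group_add \<Rightarrow> 'm) \<Rightarrow> ('e \<Rightarrow> 'm \<Rightarrow> 'm poly)
      \<Rightarrow> nat \<Rightarrow> ('e list \<Rightarrow> 'm mpoly set) \<Rightarrow> 'e list \<Rightarrow> 'm mpoly set" where
  "differential scA br actM lact k \<phi> = (\<lambda>us\<in>{us. length us = Suc k}.
     \<Union>f\<in>reps k \<phi>. qclass (mod_D actM) (Suc k) (diff_formula scA br actM lact k f us))"

end

theory Submission
  imports Defs "HOL-Library.Function_Algebras"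
begin

text \<open>
  In an alternating cochain the entry \<open>[u\<^sub>i u\<^sub>j]\<close> can be moved from the first slot to slot \<open>j\<close>. So modulo
  \<open>\<partial> + \<Sum> \<lambda>\<^sub>i\<close> the differential agrees with the one of Loday for left Leibniz algebras, which is determined
  by Cartan's formula \<open>\<iota>\<^sub>u d = L\<^sub>u - d \<iota>\<^sub>u\<close>. From it, \<open>[L\<^sub>u, L\<^sub>v] = L\<^bsub>[u,v]\<^esub>\<close>, \<open>L\<^sub>u d = d L\<^sub>u\<close> and \<open>d d = 0\<close>
  follow by induction on the number of arguments, using only the Jacobi identity; they hold exactly on
  polynomials as soon as the representatives are additive, which is achieved by eliminating the last
  variable. The same induction shows that \<open>d\<close> preserves skew-symmetry and sesquilinearity. Linearity over
  \<open>A\<close> need only be checked in the last slot, where the anchor terms of \<open>u \<cdot> \<phi>(\<dots>, a v)\<close> and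
  \<open>\<phi>(\<dots>, [u, a v])\<close> cancel. For each \<open>i\<close> the polynomials form an \<open>A[\<partial>]\<close>-module in which \<open>\<partial>\<close> acts by
  \<open>-\<lambda>\<^sub>i\<close>, and sesquilinearity of a cochain in slot \<open>i\<close> is linearity for this structure.
\<close>

section \<open>Substitution of operators\<close>

text \<open>The Cartan operators change the number of arguments and turn a slot with variable \<mu>
  into one with \<lambda> + \<mu>. To avoid renumbering, a cochain is evaluated on slots that carry
  a linear form, the label, and labels are only ever added. The congruence modulo \<partial> plus
  the sum of the variables becomes \<open>eqv w\<close>, where \<open>w\<close> is the sum of the
  labels; a contraction merely moves a label into the parameter. Exact identities require additivity
  because the coefficients of nested brackets are regrouped before the Jacobi identity applies, and
  arbitrary representatives are additive only up to congruence. The last slot is singled out because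
  the recursion removes slots at the front: a claim about the last slot survives to the one-slot
  case, where the anchor terms are computed, and alternation carries it to the other slots. The
  differential can be iterated because it commutes with substitutions of linear forms: its values on
  all labels are determined by those on the variables, so the result is again a labelled
  cochain.\<close>

lemma additive_funpow: "additive T \<Longrightarrow> additive (T ^^ n)"
  for T :: "'p::ab_group_add \<Rightarrow> 'p"
  by (induction n) (auto simp: additive_def)

lemma additive_comp: "additive S \<Longrightarrow> additive T \<Longrightarrow> additive (\<lambda>x. S (T x))"
  by (auto simp: additive_def)

text \<open>The bound in \<open>psubst\<close> is the degree, which drops under cancellation. A
  bound that only has to be large enough serves several polynomials at once.\<close>

lemma psubst_eq_sum:
  fixes T :: "'p::ab_group_add \<Rightarrow> 'p"
  assumes T: "additive T" and g: "g 0 = 0" and n: "degree p \<le> n"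
  shows "psubst T g p = (\<Sum>i\<le>n. (T ^^ i) (g (coeff p i)))"
  unfolding psubst_def
proof (rule sum.mono_neutral_left)
  show "\<forall>i\<in>{..n} - {..degree p}. (T ^^ i) (g (coeff p i)) = 0"
    using g additive.zero[OF additive_funpow[OF T]] by (auto simp: coeff_eq_0)
qed (use n in auto)

lemma psubst_0 [simp]: "g 0 = 0 \<Longrightarrow> psubst T g 0 = 0"
  by (simp add: psubst_def)

lemma psubst_const [simp]: "psubst T g [:c:] = g c"
  by (simp add: psubst_def)

lemma psubst_pCons:
  fixes T :: "'p::ab_group_add \<Rightarrow> 'p"
  assumes T: "additive T" and g: "g 0 = 0"
  shows "psubst T g (pCons c p) = g c + T (psubst T g p)"
proof -
  have "psubst T g (pCons c p) = (\<Sum>i\<le>Suc (degree p). (T ^^ i) (g (coeff (pCons c p) i)))"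
    by (rule psubst_eq_sum[where g=g and T=T, OF T g]) (auto simp: degree_pCons_le)
  also have "\<dots> = g c + (\<Sum>i\<le>degree p. T ((T ^^ i) (g (coeff p i))))"
    by (subst sum.atMost_Suc_shift) simp
  finally show ?thesis
    by (simp add: psubst_def additive.sum[OF T])
qed

lemma psubst_add: fixes T :: "'p::ab_group_add \<Rightarrow> 'p"
  assumes T: "additive T" and g: "additive g"
  shows "psubst T g (p + q) = psubst T g p + psubst T g q"
proof -
  let ?n = "max (degree p) (degree q)"
  have "psubst T g r = (\<Sum>i\<le>?n. (T ^^ i) (g (coeff r i)))" if "degree r \<le> ?n" for r
    using that by (rule psubst_eq_sum[where g=g and T=T, OF T additive.zero[OF g]])
  then show ?thesis
    by (simp add: degree_add_le additive.add[OF g] additive.add[OF additive_funpow[OF T]]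
        sum.distrib)
qed

lemma additive_psubst:
  fixes T :: "'p::ab_group_add \<Rightarrow> 'p"
  shows "additive T \<Longrightarrow> additive g \<Longrightarrow> additive (psubst T g)"
  by (simp add: additive_def psubst_add)

lemma psubst_zero_fun:
  fixes T :: "'p::ab_group_add \<Rightarrow> 'p"
  assumes "additive T"
  shows "psubst T (\<lambda>_. 0) p = 0"
  by (simp add: psubst_def additive.zero[OF additive_funpow[OF assms]])

lemma psubst_add_fun:
  fixes T :: "'p::ab_group_add \<Rightarrow> 'p"
  assumes T: "additive T"
  shows "psubst T (\<lambda>c. g c + h c) p = psubst T g p + psubst T h p"
  by (simp add: psubst_def additive.add[OF additive_funpow[OF T]] sum.distrib)

lemma psubst_diff_fun:
  fixes T :: "'p::ab_group_add \<Rightarrow> 'p"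
  assumes T: "additive T"
  shows "psubst T (\<lambda>c. g c - h c) p = psubst T g p - psubst T h p"
  by (simp add: psubst_def additive.diff[OF additive_funpow[OF T]] sum_subtractf)

lemma psubst_minus_fun:
  fixes T :: "'p::ab_group_add \<Rightarrow> 'p"
  assumes T: "additive T"
  shows "psubst T (\<lambda>c. - g c) p = - psubst T g p"
  by (simp add: psubst_def additive.minus[OF additive_funpow[OF T]] sum_negf)

text \<open>Most later exchanges of substitutions are instances of this, with \<open>S\<close>
  itself a substitution, an action, a twist or a multiplication by a variable.\<close>

lemma psubst_hom:
  fixes T :: "'p::ab_group_add \<Rightarrow> 'p" and T' :: "'q::ab_group_add \<Rightarrow> 'q"
  assumes S: "additive S" and comm: "\<And>x. S (T x) = T' (S x)"
  shows "S (psubst T g p) = psubst T' (\<lambda>c. S (g c)) p"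
proof -
  have "S ((T ^^ n) x) = (T' ^^ n) (S x)" for n x
    by (induction n) (simp_all add: comm)
  then show ?thesis
    by (simp add: psubst_def additive.sum[OF S])
qed

lemma psubst_map_poly:
  fixes T :: "'p::ab_group_add \<Rightarrow> 'p"
  assumes T: "additive T" and g: "g 0 = 0" and h: "h 0 = 0"
  shows "psubst T g (map_poly h p) = psubst T (\<lambda>c. g (h c)) p"
  by (subst psubst_eq_sum[where g=g, OF T g map_poly_degree_leq]) (simp add: coeff_map_poly h psubst_def)

lemma additive_map_poly: "additive d \<Longrightarrow> additive (map_poly d)"
  by (auto simp: additive_def poly_eq_iff coeff_map_poly additive.zero[unfolded additive_def])

lemma additive_var_plus: "additive d \<Longrightarrow> additive (var_plus d)"
  using additive_map_poly[of d] by (auto simp: additive_def var_plus_def)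

lemma psubst_var_plus:
  fixes T :: "'p::ab_group_add \<Rightarrow> 'p"
  assumes T: "additive T" and g: "additive g" and d: "additive d"
  shows "psubst T g (var_plus d p) = T (psubst T g p) + psubst T (\<lambda>c. g (d c)) p"
  by (simp add: var_plus_def psubst_add[OF T g] psubst_pCons[where g=g, OF T additive.zero[OF g]]
      psubst_map_poly[where g=g and h=d, OF T additive.zero[OF g] additive.zero[OF d]] additive.zero[OF g])

lemma additive_pCons_0: "additive (pCons 0)"
  by (simp add: additive_def)

lemma additive_const_poly: "additive (\<lambda>c. [:c:])"
  by (simp add: additive_def)

section \<open>Polynomials in several variables\<close>

text \<open>The pattern behind \<open>mvar\<close>, simultaneous substitution and
  \<open>multi_twist\<close>; its additivity is proved once, over a common set of monomials.\<close>

definition msum ::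
    "((nat \<Rightarrow>\<^sub>0 nat) \<Rightarrow> 'x::zero \<Rightarrow> 'p) \<Rightarrow> 'x mpoly \<Rightarrow> 'p::comm_monoid_add" where
  "msum h p = (\<Sum>\<alpha>\<in>Poly_Mapping.keys p. h \<alpha> (Poly_Mapping.lookup p \<alpha>))"

lemma msum_eq_sum:
  assumes "\<And>\<alpha>. h \<alpha> 0 = 0" "finite A" "Poly_Mapping.keys p \<subseteq> A"
  shows "msum h p = (\<Sum>\<alpha>\<in>A. h \<alpha> (Poly_Mapping.lookup p \<alpha>))"
  unfolding msum_def
  by (rule sum.mono_neutral_left) (use assms in \<open>auto simp: in_keys_iff\<close>)

lemma additive_msum:
  fixes h :: "(nat \<Rightarrow>\<^sub>0 nat) \<Rightarrow> 'x::ab_group_add \<Rightarrow> 'p::ab_group_add"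
  assumes h: "\<And>\<alpha>. additive (h \<alpha>)"
  shows "additive (msum h)"
proof
  fix p q :: "'x mpoly"
  let ?A = "Poly_Mapping.keys p \<union> Poly_Mapping.keys q"
  have "msum h r = (\<Sum>\<alpha>\<in>?A. h \<alpha> (Poly_Mapping.lookup r \<alpha>))" if "Poly_Mapping.keys r \<subseteq> ?A" for r
    by (rule msum_eq_sum) (use that additive.zero[OF h] in auto)
  then show "msum h (p + q) = msum h p + msum h q"
    using Poly_Mapping.keys_add[of p q]
    by (simp add: lookup_add additive.add[OF h] sum.distrib)
qed

lemma msum_single: "h \<alpha> 0 = 0 \<Longrightarrow> msum h (Poly_Mapping.single \<alpha> c) = h \<alpha> c"
  by (cases "c = 0") (auto simp: msum_def)

lemma mvar_eq_msum: "mvar i = msum (\<lambda>\<alpha>. Poly_Mapping.single (Poly_Mapping.single i 1 + \<alpha>))"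
  by (simp add: mvar_def msum_def fun_eq_iff)

lemma additive_mvar: "additive (mvar i :: 'x::ab_group_add mpoly \<Rightarrow> 'x mpoly)"
  unfolding mvar_eq_msum by (rule additive_msum) (simp add: additive_def single_add)

lemmas mvar_additive [simp] = additive.add[OF additive_mvar] additive.zero[OF additive_mvar]
  additive.minus[OF additive_mvar] additive.diff[OF additive_mvar]

lemma mvar_single: "mvar i (Poly_Mapping.single \<alpha> c) =
    Poly_Mapping.single (Poly_Mapping.single i 1 + \<alpha>) c"
  by (simp add: mvar_eq_msum msum_single)

lemma additive_mconst: "additive mconst"
  by (simp add: additive_def mconst_def single_add)

definition mpolys_on :: "nat set \<Rightarrow> 'x::zero mpoly set" where
  "mpolys_on V = {p. \<forall>\<alpha>\<in>Poly_Mapping.keys p. Poly_Mapping.keys \<alpha> \<subseteq> V}"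

lemma mpolys_eq: "mpolys k = mpolys_on {..<k}"
  by (simp add: mpolys_def mpolys_on_def)

lemma mpolys_on_UNIV: "p \<in> mpolys_on UNIV"
  by (simp add: mpolys_on_def)

lemma mpolys_on_mono: "p \<in> mpolys_on V \<Longrightarrow> V \<subseteq> W \<Longrightarrow> p \<in> mpolys_on W"
  by (auto simp: mpolys_on_def)

lemma mpolys_on_zero: "0 \<in> mpolys_on V"
  by (simp add: mpolys_on_def)

lemma mpolys_on_add: "p \<in> mpolys_on V \<Longrightarrow> q \<in> mpolys_on V \<Longrightarrow> p + q \<in> mpolys_on V"
  using Poly_Mapping.keys_add[of p q] by (auto simp: mpolys_on_def)

lemma mpolys_on_uminus: "p \<in> mpolys_on V \<Longrightarrow> - p \<in> mpolys_on V"
  for p :: "'x::ab_group_add mpoly"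
  by (auto simp: mpolys_on_def)

lemma mpolys_on_diff: "p \<in> mpolys_on V \<Longrightarrow> q \<in> mpolys_on V \<Longrightarrow> p - q \<in> mpolys_on V"
  for p :: "'x::ab_group_add mpoly"
  using mpolys_on_add[of p V "- q"] mpolys_on_uminus[of q V] by simp

lemma mpolys_on_sum: "(\<And>x. x \<in> A \<Longrightarrow> f x \<in> mpolys_on V) \<Longrightarrow> sum f A \<in> mpolys_on V"
  by (induction A rule: infinite_finite_induct) (auto simp: mpolys_on_zero intro: mpolys_on_add)

lemma mpolys_on_single:
  "Poly_Mapping.keys \<alpha> \<subseteq> V \<Longrightarrow> Poly_Mapping.single \<alpha> c \<in> mpolys_on V"
  by (cases "c = 0") (auto simp: mpolys_on_def)

lemma mpolys_on_mconst: "mconst c \<in> mpolys_on V"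
  by (simp add: mconst_def mpolys_on_single)

lemma mpolys_on_mvar: "p \<in> mpolys_on V \<Longrightarrow> i \<in> V \<Longrightarrow> mvar i p \<in> mpolys_on V"
  unfolding mvar_def
  by (rule mpolys_on_sum, rule mpolys_on_single)
    (use Poly_Mapping.keys_add in \<open>fastforce simp: mpolys_on_def\<close>)

lemma mpoly_sum_single:
  "(\<Sum>\<alpha>\<in>Poly_Mapping.keys p. Poly_Mapping.single \<alpha> (Poly_Mapping.lookup p \<alpha>)) = p"
  for p :: "'x::ab_group_add mpoly"
  by (rule poly_mapping_eqI)
    (auto simp: lookup_sum lookup_single when_def in_keys_iff)

text \<open>The coefficients form only a group, so polynomials are generated from constants by sums
  and multiplication by variables. Monomials are reached by induction on the total degree.\<close>

lemma mpoly_induct [consumes 1, case_names add const var]: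
  fixes p :: "'x::ab_group_add mpoly"
  assumes p: "p \<in> mpolys_on V"
    and add: "\<And>p q. p \<in> mpolys_on V \<Longrightarrow> q \<in> mpolys_on V \<Longrightarrow> P p \<Longrightarrow> P q \<Longrightarrow> P (p + q)"
    and const: "\<And>c. P (mconst c)"
    and var: "\<And>i p. i \<in> V \<Longrightarrow> p \<in> mpolys_on V \<Longrightarrow> P p \<Longrightarrow> P (mvar i p)"
  shows "P p"
proof -
  have mon: "P (Poly_Mapping.single \<alpha> c)" if "Poly_Mapping.keys \<alpha> \<subseteq> V" for \<alpha> c
    using that
  proof (induction "sum (Poly_Mapping.lookup \<alpha>) (Poly_Mapping.keys \<alpha>)" arbitrary: \<alpha> rule: less_induct)
    case less
    show ?case
    proof (cases "\<alpha> = 0")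
      case True
      then show ?thesis
        using const[of c] by (simp add: mconst_def)
    next
      case False
      then obtain i where i: "i \<in> Poly_Mapping.keys \<alpha>"
        by (auto simp: poly_mapping_eq_iff fun_eq_iff in_keys_iff)
      define \<beta> where "\<beta> = \<alpha> - Poly_Mapping.single i 1"
      have \<alpha>: "\<alpha> = Poly_Mapping.single i 1 + \<beta>"
        using i by (auto simp: \<beta>_def poly_mapping_eq_iff fun_eq_iff lookup_add lookup_minus
            lookup_single when_def in_keys_iff)
      have keys: "Poly_Mapping.keys \<beta> \<subseteq> Poly_Mapping.keys \<alpha>"
        by (auto simp: \<alpha> in_keys_iff lookup_add)
      have "sum (Poly_Mapping.lookup \<beta>) (Poly_Mapping.keys \<beta>) = sum (Poly_Mapping.lookup \<beta>) (Poly_Mapping.keys \<alpha>)"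
        by (rule sum.mono_neutral_left) (use keys in \<open>auto simp: in_keys_iff\<close>)
      also have "\<dots> < sum (Poly_Mapping.lookup \<alpha>) (Poly_Mapping.keys \<alpha>)"
        using i by (intro sum_strict_mono_ex1 bexI[of _ i]) (auto simp: \<alpha> lookup_add lookup_single)
      finally have "P (Poly_Mapping.single \<beta> c)"
        using less keys by blast
      then have "P (mvar i (Poly_Mapping.single \<beta> c))"
        using less(2) i keys by (intro var mpolys_on_single) auto
      then show ?thesis
        by (simp add: mvar_single \<alpha>)
    qed
  qed
  have P0: "P 0"
    using const[of 0] by (simp add: mconst_def)
  have "\<forall>\<alpha>\<in>A. Poly_Mapping.keys \<alpha> \<subseteq> V \<Longrightarrow>
      P (\<Sum>\<alpha>\<in>A. Poly_Mapping.single \<alpha> (f \<alpha>))" if "finite A" for A and f :: "_ \<Rightarrow> 'x"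
    using that by (induction A) (auto intro!: add mon P0 mpolys_on_sum mpolys_on_single)
  then have "P (\<Sum>\<alpha>\<in>Poly_Mapping.keys p. Poly_Mapping.single \<alpha> (Poly_Mapping.lookup p \<alpha>))"
    using p by (simp add: mpolys_on_def)
  then show ?thesis
    by (simp add: mpoly_sum_single)
qed

lemmas mpoly_induct_all = mpoly_induct[OF mpolys_on_UNIV, case_names add const var]

lemma mpoly_hom_eqI:
  fixes X Y :: "'x::ab_group_add mpoly \<Rightarrow> 'p::ab_group_add"
  assumes "p \<in> mpolys_on V" "additive X" "additive Y"
    and "\<And>c. X (mconst c) = Y (mconst c)"
    and "\<And>i p. i \<in> V \<Longrightarrow> p \<in> mpolys_on V \<Longrightarrow> X p = Y p \<Longrightarrow> X (mvar i p) = Y (mvar i p)"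
  shows "X p = Y p"
  using assms(1) by (induction p rule: mpoly_induct) (simp_all add: assms additive.add)

lemma mvar_commute: "mvar i (mvar j p) = mvar j (mvar i p)" for p :: "'x::ab_group_add mpoly"
  by (subst (1 2) mpoly_sum_single[of p, symmetric])
    (simp add: additive.sum[OF additive_mvar] mvar_single add_ac)

section \<open>Cartan calculus for Leibniz brackets with labels\<close>

text \<open>Meant for the values of \<open>lie_der\<close> and \<open>loday_diff\<close> at a fixed
  list, which are linear in the cochain. A contraction by a bracket is a polynomial family of
  contractions, and this pulls it through such values.\<close>

lemma psubst_pointwise:
  fixes L :: "('y \<Rightarrow> 'v::ab_group_add) \<Rightarrow> 'w::ab_group_add"
  assumes add: "\<And>F G. L (\<lambda>y. F y + G y) = L F + L G"
    and hom: "\<And>F. L (\<lambda>y. R (F y)) = R' (L F)"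
  shows "L (\<lambda>y. psubst R (\<lambda>e. \<Psi> e y) q) = psubst R' (\<lambda>e. L (\<Psi> e)) q"
proof -
  have zero: "L (\<lambda>_. 0) = 0"
    using add[of "\<lambda>_. 0" "\<lambda>_. 0"] by simp
  have sum: "L (\<lambda>y. \<Sum>i\<in>I. F i y) = (\<Sum>i\<in>I. L (F i))" for I :: "nat set" and F
    by (induction I rule: infinite_finite_induct) (simp_all add: zero add)
  have pow: "L (\<lambda>y. (R ^^ n) (F y)) = (R' ^^ n) (L F)" for n F
    by (induction n) (simp_all add: hom)
  show ?thesis
    by (simp add: psubst_def sum pow)
qed

text \<open>The type \<open>'l\<close> stands for linear forms in the variables,
  \<open>lop T\<close> for multiplication by the form \<open>T\<close>, and \<open>act u T\<close>
  for the action of \<open>u\<close> with \<open>T\<close> in place of its variable. In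
  \<open>act_br\<close> the difference \<mu> - \<lambda> of the module axiom has become
  \<open>R\<close>. In \<open>br_leibniz\<close> the Jacobi identity is read through an additive
  \<open>g\<close>, the dependence of a cochain on one slot.\<close>

locale leibniz_rep =
  fixes br :: "'e::ab_group_add \<Rightarrow> 'e \<Rightarrow> 'e poly"
    and lop :: "'l::comm_monoid_add \<Rightarrow> 'v::ab_group_add \<Rightarrow> 'v"
    and act :: "'e \<Rightarrow> 'l \<Rightarrow> 'v \<Rightarrow> 'v"
  assumes br_add_left: "br (u + v) w = br u w + br v w"
    and br_add_right: "br u (v + w) = br u v + br u w"
    and lop_add_left: "lop (T + R) x = lop T x + lop R x"
    and lop_add: "lop T (x + y) = lop T x + lop T y"
    and lop_commute: "lop T (lop R x) = lop R (lop T x)"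
    and act_add_left: "act (u + v) T x = act u T x + act v T x"
    and act_add: "act u T (x + y) = act u T x + act u T y"
    and act_lop: "act u T (lop R x) = lop R (act u T x)"
    and act_br: "psubst (lop T) (\<lambda>e. act e (T + R) x) (br u v) =
      act u T (act v R x) - act v R (act u T x)"
    and br_leibniz: "additive g \<Longrightarrow>
      psubst (lop R) (\<lambda>e. psubst (lop T) g (br u e)) (br v w)
      - psubst (lop T) (\<lambda>e. psubst (lop R) g (br v e)) (br u w)
      = psubst (lop T) (\<lambda>e. psubst (lop (T + R)) g (br e w)) (br u v)"
begin

lemma additive_lop: "additive (lop T)"
  by (simp add: additive_def lop_add)

lemma additive_act: "additive (act e T)"
  by (simp add: additive_def act_add)

lemmas psubst_lop_rules = psubst_add_fun[OF additive_lop] psubst_diff_fun[OF additive_lop]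
  psubst_minus_fun[OF additive_lop] psubst_zero_fun[OF additive_lop]

lemma psubst_lop_hom:
  "additive S \<Longrightarrow> (\<And>x. S (lop R x) = lop R (S x)) \<Longrightarrow>
    S (psubst (lop R) g p) = psubst (lop R) (\<lambda>c. S (g c)) p"
  by (rule psubst_hom)

text \<open>
  A slot \<open>(e, T)\<close> carries an element and the linear form \<open>T\<close> substituted for its variable.
\<close>

primrec lie_der :: "'e \<Rightarrow> 'l \<Rightarrow> (('e \<times> 'l) list \<Rightarrow> 'v) \<Rightarrow> ('e \<times> 'l) list \<Rightarrow> 'v" where
  "lie_der u T F [] = act u T (F [])"
| "lie_der u T F (x # xs) = lie_der u T (\<lambda>ys. F (x # ys)) xs
     - psubst (lop T) (\<lambda>e. F ((e, T + snd x) # xs)) (br u (fst x))"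

text \<open>Contraction by \<open>x\<close> is \<open>\<lambda>ys. F (x # ys)\<close>, so the second
  equation is Cartan's formula used as a recursion. The value 0 on the empty list reflects that a
  differential has at least one argument.\<close>

primrec loday_diff :: "(('e \<times> 'l) list \<Rightarrow> 'v) \<Rightarrow> ('e \<times> 'l) list \<Rightarrow> 'v" where
  "loday_diff F [] = 0"
| "loday_diff F (x # xs) = lie_der (fst x) (snd x) F xs - loday_diff (\<lambda>ys. F (x # ys)) xs"

lemma lie_der_add: "lie_der u T (\<lambda>ys. F ys + \<Psi> ys) xs = lie_der u T F xs + lie_der u T \<Psi> xs"
  by (induction xs arbitrary: F \<Psi>) (simp_all add: act_add psubst_lop_rules)

lemma lie_der_zero: "lie_der u T (\<lambda>ys. 0) xs = 0"
  using lie_der_add[of u T "\<lambda>_. 0" "\<lambda>_. 0" xs] by simp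

lemma lie_der_minus: "lie_der u T (\<lambda>ys. - F ys) xs = - lie_der u T F xs"
  using lie_der_add[of u T F "\<lambda>ys. - F ys" xs] lie_der_zero[of u T xs]
  by (simp add: eq_neg_iff_add_eq_0 add.commute)

lemma lie_der_diff: "lie_der u T (\<lambda>ys. F ys - \<Psi> ys) xs = lie_der u T F xs - lie_der u T \<Psi> xs"
  using lie_der_add[of u T F "\<lambda>ys. - \<Psi> ys" xs] by (simp add: lie_der_minus)

lemma lie_der_lop: "lie_der u T (\<lambda>ys. lop R (F ys)) xs = lop R (lie_der u T F xs)"
proof (induction xs arbitrary: F)
  case (Cons x xs)
  then show ?case
    by (simp add: additive.diff[OF additive_lop] psubst_lop_hom[OF additive_lop lop_commute])
qed (simp add: act_lop)

lemma lie_der_psubst: "lie_der u T (\<lambda>ys. psubst (lop R) (\<lambda>e. \<Psi> e ys) q) xs =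
    psubst (lop R) (\<lambda>e. lie_der u T (\<Psi> e) xs) q"
  by (rule psubst_pointwise[of "\<lambda>F. lie_der u T F xs"]) (rule lie_der_add lie_der_lop)+

lemma loday_diff_add: "loday_diff (\<lambda>ys. F ys + \<Psi> ys) xs = loday_diff F xs + loday_diff \<Psi> xs"
  by (induction xs arbitrary: F \<Psi>) (simp_all add: lie_der_add)

lemma loday_diff_zero: "loday_diff (\<lambda>ys. 0) xs = 0"
  using loday_diff_add[of "\<lambda>_. 0" "\<lambda>_. 0" xs] by simp

lemma loday_diff_minus: "loday_diff (\<lambda>ys. - F ys) xs = - loday_diff F xs"
  using loday_diff_add[of F "\<lambda>ys. - F ys" xs] loday_diff_zero[of xs]
  by (simp add: eq_neg_iff_add_eq_0 add.commute)

lemma loday_diff_diff: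
  "loday_diff (\<lambda>ys. F ys - \<Psi> ys) xs = loday_diff F xs - loday_diff \<Psi> xs"
  using loday_diff_add[of F "\<lambda>ys. - \<Psi> ys" xs] by (simp add: loday_diff_minus)

lemma loday_diff_lop: "loday_diff (\<lambda>ys. lop R (F ys)) xs = lop R (loday_diff F xs)"
  by (induction xs arbitrary: F)
    (simp_all add: additive.zero[OF additive_lop] additive.diff[OF additive_lop] lie_der_lop)

lemma loday_diff_psubst: "loday_diff (\<lambda>ys. psubst (lop R) (\<lambda>e. \<Psi> e ys) q) xs =
    psubst (lop R) (\<lambda>e. loday_diff (\<Psi> e) xs) q"
  by (rule psubst_pointwise[of "\<lambda>F. loday_diff F xs"]) (rule loday_diff_add loday_diff_lop)+

definition multiadditive :: "(('e \<times> 'l) list \<Rightarrow> 'v) \<Rightarrow> bool" where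
  "multiadditive F \<longleftrightarrow> (\<forall>xs T ys. additive (\<lambda>e. F (xs @ (e, T) # ys)))"

lemma multiadditiveD':
  "multiadditive F \<Longrightarrow> additive (\<lambda>e. F (xs @ (e, T) # ys))"
  by (simp add: multiadditive_def)

lemma multiadditiveD: "multiadditive F \<Longrightarrow> additive (\<lambda>e. F ((e, T) # ys))"
  using multiadditiveD'[of F "[]"] by simp

lemma multiadditive_Cons: "multiadditive F \<Longrightarrow> multiadditive (\<lambda>ys. F (x # ys))"
  unfolding multiadditive_def
proof (intro allI)
  fix xs T ys
  assume "\<forall>xs T ys. additive (\<lambda>e. F (xs @ (e, T) # ys))"
  then have "additive (\<lambda>e. F ((x # xs) @ (e, T) # ys))"
    by (elim allE)
  then show "additive (\<lambda>e. F (x # xs @ (e, T) # ys))"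
    by simp
qed

text \<open>After contraction by \<open>x\<close>, the terms in which just one of the two brackets
  meets \<open>x\<close> are symmetric in u and v and cancel. The terms with double brackets combine
  by the Jacobi identity, and the rest is the claim for the contraction of \<open>F\<close>.\<close>

lemma lie_der_commutator:
  "multiadditive F \<Longrightarrow> lie_der u T (lie_der v R F) xs - lie_der v R (lie_der u T F) xs =
    psubst (lop T) (\<lambda>e. lie_der e (T + R) F xs) (br u v)"
proof (induction xs arbitrary: F)
  case (Cons x xs)
  have "additive (\<lambda>e. F ((e, T + (R + snd x)) # xs))"
    using Cons.prems by (rule multiadditiveD)
  from br_leibniz[OF this, of R T u v "fst x"] Cons.IH[OF multiadditive_Cons[OF Cons.prems], of x]
  show ?case
    by (simp add: lie_der_diff lie_der_psubst psubst_lop_rules algebra_simps)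
qed (simp add: act_br)

text \<open>After contraction by \<open>x\<close>, the terms where d is applied to the contraction
  by [u, x] cancel. What remains is the commutator identity for u and x, and the claim for the
  contraction of \<open>F\<close>.\<close>

lemma lie_der_loday_diff:
  "multiadditive F \<Longrightarrow> lie_der u T (loday_diff F) xs = loday_diff (lie_der u T F) xs"
proof (induction xs arbitrary: F)
  case (Cons x xs)
  show ?case
    using lie_der_commutator[OF Cons.prems, of u T "fst x" "snd x" xs]
      Cons.IH[OF multiadditive_Cons[OF Cons.prems], of x]
    by (simp add: lie_der_diff loday_diff_diff loday_diff_psubst psubst_lop_rules algebra_simps)
qed (simp add: additive.zero[OF additive_act])

text \<open>Contraction by \<open>x\<close> leaves L_x d F - d L_x F, which vanishes, and d d of the
  contraction of \<open>F\<close>, which is the induction hypothesis.\<close>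

theorem loday_diff_loday_diff:
  "multiadditive F \<Longrightarrow> loday_diff (loday_diff F) xs = 0"
proof (induction xs arbitrary: F)
  case (Cons x xs)
  show ?case
    using lie_der_loday_diff[OF Cons.prems, of "fst x" "snd x" xs]
      Cons.IH[OF multiadditive_Cons[OF Cons.prems], of x]
    by (simp add: loday_diff_diff)
qed simp

lemma additive_lie_der: "multiadditive F \<Longrightarrow> additive (\<lambda>u. lie_der u T F xs)"
proof (induction xs arbitrary: F)
  case (Cons x xs)
  have "additive (psubst (lop T) (\<lambda>e. F ((e, T + snd x) # xs)))"
    by (rule additive_psubst[OF additive_lop multiadditiveD[OF Cons.prems]])
  with Cons.IH[OF multiadditive_Cons[OF Cons.prems], of x] show ?case
    by (simp add: additive_def br_add_left)
qed (simp add: additive_def act_add_left)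

lemma multiadditive_lie_der:
  assumes "multiadditive F" shows "multiadditive (lie_der u T F)"
proof -
  have "additive (\<lambda>e. lie_der u T F (xs @ (e, R) # ys))" for xs R ys
    using assms
  proof (induction xs arbitrary: F)
    case Nil
    have *: "additive (psubst (lop T) (\<lambda>e. F ((e, T + R) # ys)))"
      by (rule additive_psubst[OF additive_lop multiadditiveD[OF Nil]])
    show ?case
      using * multiadditiveD[OF Nil]
      by (simp add: additive_def br_add_right lie_der_add)
  next
    case (Cons x xs)
    have "additive (\<lambda>e'. F (((e, T + snd x) # xs) @ (e', R) # ys))" for e
      using Cons.prems by (simp only: multiadditive_def)
    with Cons.IH[OF multiadditive_Cons[OF Cons.prems], of x] show ?case
      by (simp add: additive_def psubst_lop_rules)
  qed
  then show ?thesis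
    by (simp add: multiadditive_def)
qed

lemma multiadditive_loday_diff:
  assumes "multiadditive F" shows "multiadditive (loday_diff F)"
proof -
  have "additive (\<lambda>e. loday_diff F (xs @ (e, R) # ys))" for xs R ys
    using assms
  proof (induction xs arbitrary: F)
    case Nil
    show ?case
      using multiadditiveD[OF Nil] additive_lie_der[OF Nil]
      by (simp add: additive_def loday_diff_add)
  next
    case (Cons x xs)
    with Cons.IH[OF multiadditive_Cons[OF Cons.prems], of x]
      multiadditive_lie_der[OF Cons.prems, of "fst x" "snd x"] show ?case
      by (simp add: additive_def multiadditive_def)
  qed
  then show ?thesis
    by (simp add: multiadditive_def)
qed

section \<open>Naturality under a change of labels\<close>

lemma lie_der_natural:
  assumes S: "additive S" and s: "\<And>a b. s (a + b) = s a + s b"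
    and S_lop: "\<And>T v. S (lop T v) = lop (s T) (S v)"
    and S_act: "\<And>u T v. S (act u T v) = act u (s T) (S v)"
    and F: "\<And>ys. F (map (apsnd s) ys) = S (\<Psi> ys)"
  shows "lie_der u (s T) F (map (apsnd s) xs) = S (lie_der u T \<Psi> xs)"
  using F
proof (induction xs arbitrary: F \<Psi>)
  case Nil
  then show ?case
    using Nil[of "[]"] by (simp add: S_act)
next
  case (Cons x xs)
  have "lie_der u (s T) (\<lambda>ys. F (apsnd s x # ys)) (map (apsnd s) xs) =
      S (lie_der u T (\<lambda>ys. \<Psi> (x # ys)) xs)"
  proof (rule Cons.IH)
    show "F (apsnd s x # map (apsnd s) ys) = S (\<Psi> (x # ys))" for ys
      using Cons.prems[of "x # ys"] by simp
  qed
  moreover have "F ((e, s T + s (snd x)) # map (apsnd s) xs) = S (\<Psi> ((e, T + snd x) # xs))" for e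
    using Cons.prems[of "(e, T + snd x) # xs"] by (simp add: s)
  ultimately show ?case
    by (simp add: additive.diff[OF S] psubst_hom[where S=S and T="lop T" and T'="lop (s T)", OF S S_lop])
qed

text \<open>\<open>S\<close> is meant to be a substitution of linear forms for the variables and
  \<open>s\<close> its effect on labels. The recursion uses labels only through sums,
  \<open>lop\<close> and \<open>act\<close>, so compatibility with these three suffices.\<close>

lemma loday_diff_natural:
  assumes S: "additive S" and s: "\<And>a b. s (a + b) = s a + s b"
    and S_lop: "\<And>T v. S (lop T v) = lop (s T) (S v)"
    and S_act: "\<And>u T v. S (act u T v) = act u (s T) (S v)"
    and F: "\<And>ys. F (map (apsnd s) ys) = S (\<Psi> ys)"
  shows "loday_diff F (map (apsnd s) xs) = S (loday_diff \<Psi> xs)"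
  using F
proof (induction xs arbitrary: F \<Psi>)
  case (Cons x xs)
  have "loday_diff (\<lambda>ys. F (apsnd s x # ys)) (map (apsnd s) xs) =
      S (loday_diff (\<lambda>ys. \<Psi> (x # ys)) xs)"
  proof (rule Cons.IH)
    show "F (apsnd s x # map (apsnd s) ys) = S (\<Psi> (x # ys))" for ys
      using Cons.prems[of "x # ys"] by simp
  qed
  moreover have "lie_der (fst x) (s (snd x)) F (map (apsnd s) xs) =
      S (lie_der (fst x) (snd x) \<Psi> xs)"
    by (rule lie_der_natural[where S=S and s=s]) (fact S s S_lop S_act Cons.prems)+
  ultimately show ?case
    by (simp add: additive.diff[OF S])
qed (simp add: additive.zero[OF S])

lemma lie_der_cong_length:
  "(\<And>ys. length ys = length xs \<Longrightarrow> F ys = \<Psi> ys) \<Longrightarrow> lie_der u T F xs = lie_der u T \<Psi> xs"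
proof (induction xs arbitrary: F \<Psi>)
  case (Cons x xs)
  have "lie_der u T (\<lambda>ys. F (x # ys)) xs = lie_der u T (\<lambda>ys. \<Psi> (x # ys)) xs"
    using Cons.prems by (intro Cons.IH) simp
  then show ?case
    using Cons.prems by simp
qed simp

text \<open>Labelled cochains are cut off to 0 at all lengths but one, so two cochains can be
  expected to agree only at the length that the differential actually uses.\<close>

lemma loday_diff_cong_length:
  "(\<And>ys. Suc (length ys) = length xs \<Longrightarrow> F ys = \<Psi> ys) \<Longrightarrow> loday_diff F xs = loday_diff \<Psi> xs"
proof (induction xs arbitrary: F \<Psi>)
  case (Cons x xs)
  have "loday_diff (\<lambda>ys. F (x # ys)) xs = loday_diff (\<lambda>ys. \<Psi> (x # ys)) xs"
    using Cons.prems by (intro Cons.IH) simp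
  moreover have "lie_der (fst x) (snd x) F xs = lie_der (fst x) (snd x) \<Psi> xs"
    using Cons.prems by (intro lie_der_cong_length) simp
  ultimately show ?case
    by simp
qed simp

end

section \<open>Alternating and sesquilinear cochains\<close>

definition signed :: "nat \<Rightarrow> 'v::ab_group_add \<Rightarrow> 'v" where
  "signed n v = (if even n then v else - v)"

lemma signed_0 [simp]: "signed 0 v = v"
  and signed_Suc [simp]: "signed (Suc n) v = - signed n v"
  and signed_add_fun: "signed n (v + w) = signed n v + signed n w"
  and signed_minus: "signed n (- v) = - signed n v"
  and signed_zero [simp]: "signed n 0 = 0"
  by (auto simp: signed_def)

lemma signed_double: "signed n (signed n v) = v"
  by (auto simp: signed_def)

lemma signed_hom: "additive f \<Longrightarrow> f (signed n v) = signed n (f v)"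
  by (auto simp: signed_def additive.minus)

definition wt :: "('e \<times> 'l::comm_monoid_add) list \<Rightarrow> 'l" where
  "wt xs = sum_list (map snd xs)"

lemma wt_Nil [simp]: "wt [] = 0"
  and wt_Cons [simp]: "wt (x # xs) = snd x + wt xs"
  and wt_append [simp]: "wt (xs @ ys) = wt xs + wt ys"
  by (simp_all add: wt_def)

locale leibniz_diff = leibniz_rep br lop act
  for br :: "'e::ab_group_add \<Rightarrow> 'e \<Rightarrow> 'e poly"
    and lop :: "'l::comm_monoid_add \<Rightarrow> 'v::ab_group_add \<Rightarrow> 'v"
    and act :: "'e \<Rightarrow> 'l \<Rightarrow> 'v \<Rightarrow> 'v" +
  fixes dE :: "'e \<Rightarrow> 'e" and dv :: "'v \<Rightarrow> 'v"
  assumes dE_add: "dE (u + v) = dE u + dE v"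
    and dv_add: "dv (x + y) = dv x + dv y"
    and dv_lop: "dv (lop T x) = lop T (dv x)"
    and act_dv: "act u T (dv x) = dv (act u T x) + lop T (act u T x)"
    and act_dE: "act (dE u) T x = - lop T (act u T x)"
    and br_dE_left: "br (dE u) v = - pCons 0 (br u v)"
    and br_dE_right: "br u (dE v) = var_plus dE (br u v)"
    and br_skew: "br v u = - psubst (\<lambda>p. - var_plus dE p) (\<lambda>e. [:e:]) (br u v)"
begin

text \<open>Congruence modulo the image of \<partial> + w. The parameter will be the total label of
  all arguments, which varies with contractions and Lie derivatives. The witness may involve any
  variables; \<open>qrel_iff\<close> relates this to the bounded quotient.\<close>

definition eqv :: "'l \<Rightarrow> 'v \<Rightarrow> 'v \<Rightarrow> bool" where
  "eqv w x y \<longleftrightarrow> (\<exists>p. x - y = dv p + lop w p)"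

lemma additive_dE: "additive dE"
  by (simp add: additive_def dE_add)

lemma additive_dv: "additive dv"
  by (simp add: additive_def dv_add)

lemma eqvI: "x - y = dv p + lop w p \<Longrightarrow> eqv w x y"
  by (auto simp: eqv_def)

lemma eqv_refl [simp]: "eqv w x x"
  using eqvI[of x x 0 w] by (simp add: additive.zero[OF additive_dv] additive.zero[OF additive_lop])

lemma eqv_add: "eqv w x y \<Longrightarrow> eqv w x' y' \<Longrightarrow> eqv w (x + x') (y + y')"
  unfolding eqv_def
proof (elim exE)
  fix p q assume "x - y = dv p + lop w p" "x' - y' = dv q + lop w q"
  then have "x + x' - (y + y') = dv (p + q) + lop w (p + q)"
    by (simp add: dv_add lop_add algebra_simps)
  then show "\<exists>r. x + x' - (y + y') = dv r + lop w r" ..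
qed

lemma eqv_minus: "eqv w x y \<Longrightarrow> eqv w (- x) (- y)"
  unfolding eqv_def
proof (elim exE)
  fix p assume "x - y = dv p + lop w p"
  then have "- x - - y = dv (- p) + lop w (- p)"
    by (simp add: additive.minus[OF additive_dv] additive.minus[OF additive_lop] algebra_simps)
  then show "\<exists>r. - x - - y = dv r + lop w r" ..
qed

lemma eqv_diff: "eqv w x y \<Longrightarrow> eqv w x' y' \<Longrightarrow> eqv w (x - x') (y - y')"
  using eqv_add[of w x y "- x'" "- y'"] eqv_minus[of w x' y'] by simp

lemma eqv_sym: "eqv w x y \<Longrightarrow> eqv w y x"
  using eqv_minus[of w "x - y" 0] eqv_diff[of w x y y y] eqv_add[of w "- (x - y)" 0 x x] by simp

lemma eqv_trans [trans]: "eqv w x y \<Longrightarrow> eqv w y z \<Longrightarrow> eqv w x z"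
  using eqv_add[of w x y "y - z" 0] eqv_diff[of w y z z z] eqv_add[of w "x + (y - z)" y "z - y" "z - y"]
  by (simp add: algebra_simps)

lemma eqv_eq_trans [trans]: "eqv w x y \<Longrightarrow> y = z \<Longrightarrow> eqv w x z"
  and eq_eqv_trans [trans]: "x = y \<Longrightarrow> eqv w y z \<Longrightarrow> eqv w x z"
  by simp_all

lemma eqv_signed: "eqv w x y \<Longrightarrow> eqv w (signed n x) (signed n y)"
  by (simp add: signed_def eqv_minus)

lemma eqv_sum: "(\<And>i. i \<in> I \<Longrightarrow> eqv w (f i) (g i)) \<Longrightarrow> eqv w (\<Sum>i\<in>I. f i) (\<Sum>i\<in>I. g i)"
  by (induction I rule: infinite_finite_induct) (simp_all add: eqv_add)

lemma eqv_lop: "eqv w x y \<Longrightarrow> eqv w (lop T x) (lop T y)"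
  unfolding eqv_def
proof (elim exE)
  fix p assume "x - y = dv p + lop w p"
  then have "lop T x - lop T y = dv (lop T p) + lop w (lop T p)"
    by (simp add: dv_lop lop_add lop_commute[of w T] flip: additive.diff[OF additive_lop])
  then show "\<exists>r. lop T x - lop T y = dv r + lop w r" ..
qed

text \<open>The action of u intertwines \<partial> + w with \<partial> + T + w, which is why its
  label joins the parameter.\<close>

lemma eqv_act: "eqv w x y \<Longrightarrow> eqv (T + w) (act u T x) (act u T y)"
  unfolding eqv_def
proof (elim exE)
  fix p assume "x - y = dv p + lop w p"
  then have "act u T x - act u T y = dv (act u T p) + lop (T + w) (act u T p)"
    by (simp add: act_dv act_add act_lop lop_add_left add.assoc flip: additive.diff[OF additive_act])
  then show "\<exists>r. act u T x - act u T y = dv r + lop (T + w) r" ..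
qed

lemma eqv_psubst: "(\<And>c. eqv w (g c) (h c)) \<Longrightarrow> eqv w (psubst (lop T) g q) (psubst (lop T) h q)"
proof -
  assume *: "\<And>c. eqv w (g c) (h c)"
  have "eqv w ((lop T ^^ n) (g c)) ((lop T ^^ n) (h c))" for n c
    by (induction n) (simp_all add: * eqv_lop)
  then show ?thesis
    by (simp add: psubst_def eqv_sum)
qed

text \<open>Skew-symmetry puts -\<lambda> - \<partial> in place of \<lambda>. Under \<open>g\<close>
  the operator \<partial> acts as -(T + R), so inserting \<open>R\<close> for \<lambda> results in
  -R + (T + R) = T.\<close>

lemma psubst_skew:
  assumes g: "additive g" and g_dE: "\<And>e. eqv w (g (dE e)) (- lop (T + R) (g e))"
  shows "eqv w (psubst (lop R) g (br v u)) (- psubst (lop T) g (br u v))"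
proof -
  let ?Q = "\<lambda>q. psubst (\<lambda>p. - var_plus dE p) (\<lambda>e. [:e:]) q"
  have T: "additive (\<lambda>p. - var_plus dE p)"
    using additive_var_plus[OF additive_dE] by (simp add: additive_def)
  have "eqv w (psubst (lop R) g (?Q q)) (psubst (lop T) g q)" for q
  proof (induction q)
    case (pCons c q)
    let ?X = "psubst (lop R) g (?Q q)"
    have Q: "?Q (pCons c q) = [:c:] - var_plus dE (?Q q)"
      by (subst psubst_pCons[OF T]) simp_all
    have "psubst (lop R) g (?Q (pCons c q)) = g c - (lop R ?X + psubst (lop R) (\<lambda>c. g (dE c)) (?Q q))"
      unfolding Q additive.diff[OF additive_psubst[OF additive_lop g]]
        psubst_var_plus[OF additive_lop g additive_dE]
      by simp
    also have "eqv w \<dots> (g c - (lop R ?X + psubst (lop R) (\<lambda>c. - lop (T + R) (g c)) (?Q q)))"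
      by (intro eqv_diff eqv_add eqv_psubst g_dE) simp_all
    also have "psubst (lop R) (\<lambda>c. - lop (T + R) (g c)) (?Q q) = - lop (T + R) ?X"
      by (simp add: psubst_lop_rules psubst_lop_hom[OF additive_lop lop_commute])
    also have "g c - (lop R ?X + - lop (T + R) ?X) = g c + lop T ?X"
      by (simp add: lop_add_left)
    also have "eqv w (g c + lop T ?X) (g c + lop T (psubst (lop T) g q))"
      by (intro eqv_add eqv_lop pCons.IH) simp
    also have "g c + lop T (psubst (lop T) g q) = psubst (lop T) g (pCons c q)"
      by (subst psubst_pCons[where g=g, OF additive_lop additive.zero[OF g]]) simp
    finally show ?case .
  qed (simp add: additive.zero[OF g])
  from eqv_minus[OF this] show ?thesis
    by (subst br_skew) (simp add: additive.minus[OF additive_psubst[OF additive_lop g]])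
qed

text \<open>Here \<open>w\<close> collects the labels of slots already contracted. A bracket slot
  has label \<open>T + snd x\<close>, so all terms of the Lie derivative have the same total
  label.\<close>

lemma lie_der_cong:
  "(\<And>ys. length ys = length xs \<Longrightarrow> eqv (w + wt ys) (F ys) (\<Psi> ys)) \<Longrightarrow>
    eqv (T + w + wt xs) (lie_der u T F xs) (lie_der u T \<Psi> xs)"
proof (induction xs arbitrary: F \<Psi> w)
  case Nil
  then show ?case
    using eqv_act[of w "F []" "\<Psi> []" T u] Nil[of "[]"] by simp
next
  case (Cons x xs)
  have "eqv (T + (w + snd x) + wt xs) (lie_der u T (\<lambda>ys. F (x # ys)) xs) (lie_der u T (\<lambda>ys. \<Psi> (x # ys)) xs)"
  proof (rule Cons.IH)
    show "eqv (w + snd x + wt ys) (F (x # ys)) (\<Psi> (x # ys))" if "length ys = length xs" for ys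
      using Cons.prems[of "x # ys"] that by (simp add: add_ac)
  qed
  moreover have "eqv (T + (w + snd x) + wt xs) (F ((e, T + snd x) # xs)) (\<Psi> ((e, T + snd x) # xs))" for e
    using Cons.prems[of "(e, T + snd x) # xs"] by (simp add: add_ac)
  ultimately show ?case
    by (simp add: add_ac eqv_diff eqv_psubst)
qed

lemma loday_diff_cong:
  "(\<And>ys. Suc (length ys) = length xs \<Longrightarrow> eqv (w + wt ys) (F ys) (\<Psi> ys)) \<Longrightarrow>
    eqv (w + wt xs) (loday_diff F xs) (loday_diff \<Psi> xs)"
proof (induction xs arbitrary: F \<Psi> w)
  case (Cons x xs)
  have "eqv (snd x + w + wt xs) (lie_der (fst x) (snd x) F xs) (lie_der (fst x) (snd x) \<Psi> xs)"
    using Cons.prems by (intro lie_der_cong) simp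
  moreover have "eqv (w + snd x + wt xs) (loday_diff (\<lambda>ys. F (x # ys)) xs) (loday_diff (\<lambda>ys. \<Psi> (x # ys)) xs)"
  proof (rule Cons.IH)
    show "eqv (w + snd x + wt ys) (F (x # ys)) (\<Psi> (x # ys))" if "Suc (length ys) = length xs" for ys
      using Cons.prems[of "x # ys"] that by (simp add: add_ac)
  qed
  ultimately show ?case
    by (simp add: add_ac eqv_diff)
qed simp

text \<open>Exchanges of neighbours fit the recursion on lists; general permutations are recovered
  in \<open>alternating_permute\<close>. The parameter is again the label of contracted
  slots.\<close>

definition alternating :: "'l \<Rightarrow> (('e \<times> 'l) list \<Rightarrow> 'v) \<Rightarrow> bool" where
  "alternating w F \<longleftrightarrow> (\<forall>xs x y ys.
     eqv (w + wt (xs @ x # y # ys)) (F (xs @ x # y # ys)) (- F (xs @ y # x # ys)))"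

definition sesquilinear :: "'l \<Rightarrow> (('e \<times> 'l) list \<Rightarrow> 'v) \<Rightarrow> bool" where
  "sesquilinear w F \<longleftrightarrow> (\<forall>xs e T ys.
     eqv (w + wt (xs @ (e, T) # ys)) (F (xs @ (dE e, T) # ys)) (- lop T (F (xs @ (e, T) # ys))))"

lemma alternatingD: "alternating w F \<Longrightarrow>
    eqv (w + wt (xs @ x # y # ys)) (F (xs @ x # y # ys)) (- F (xs @ y # x # ys))"
  unfolding alternating_def by blast

lemma sesquilinearD: "sesquilinear w F \<Longrightarrow>
    eqv (w + wt (xs @ (e, T) # ys)) (F (xs @ (dE e, T) # ys)) (- lop T (F (xs @ (e, T) # ys)))"
  unfolding sesquilinear_def by blast

lemma alternating_Cons:
  assumes "alternating w F" shows "alternating (w + snd z) (\<lambda>ys. F (z # ys))"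
  unfolding alternating_def
proof (intro allI)
  fix xs x y ys
  show "eqv (w + snd z + wt (xs @ x # y # ys)) (F (z # xs @ x # y # ys)) (- F (z # xs @ y # x # ys))"
    using alternatingD[OF assms, of "z # xs" x y ys] by (simp add: add_ac)
qed

lemma sesquilinear_Cons:
  assumes "sesquilinear w F" shows "sesquilinear (w + snd z) (\<lambda>ys. F (z # ys))"
  unfolding sesquilinear_def
proof (intro allI)
  fix xs e T ys
  show "eqv (w + snd z + wt (xs @ (e, T) # ys)) (F (z # xs @ (dE e, T) # ys))
     (- lop T (F (z # xs @ (e, T) # ys)))"
    using sesquilinearD[OF assms, of "z # xs" e T ys] by (simp add: add_ac)
qed

text \<open>With both slots at the front, the exchange interchanges the term containing [u, x] with
  the one containing [u, y]; the remaining term is the Lie derivative of the double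
  contraction.\<close>

lemma alternating_lie_der:
  assumes "alternating w F" shows "alternating (T + w) (lie_der u T F)"
proof -
  have "eqv (T + w + wt (xs @ x # y # ys)) (lie_der u T F (xs @ x # y # ys))
      (- lie_der u T F (xs @ y # x # ys))" for xs x y ys
    using assms
  proof (induction xs arbitrary: F w)
    case Nil
    have 1: "eqv (T + (w + snd x + snd y) + wt ys) (lie_der u T (\<lambda>zs. F (x # y # zs)) ys)
        (lie_der u T (\<lambda>zs. - F (y # x # zs)) ys)"
    proof (rule lie_der_cong)
      show "eqv (w + snd x + snd y + wt zs) (F (x # y # zs)) (- F (y # x # zs))" for zs
        using alternatingD[OF Nil, of "[]" x y zs] by (simp add: add_ac)
    qed
    have 2: "eqv (T + (w + snd x + snd y) + wt ys) (F (x # (e, T + snd y) # ys))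
        (- F ((e, T + snd y) # x # ys))" for e
      using alternatingD[OF Nil, of "[]" x "(e, T + snd y)" ys] by (simp add: add_ac)
    have 3: "eqv (T + (w + snd x + snd y) + wt ys) (F ((e, T + snd x) # y # ys))
        (- F (y # (e, T + snd x) # ys))" for e
      using alternatingD[OF Nil, of "[]" "(e, T + snd x)" y ys] by (simp add: add_ac)
    let ?W = "T + (w + snd x + snd y) + wt ys"
    have 2: "eqv ?W (psubst (lop T) (\<lambda>e. F (x # (e, T + snd y) # ys)) (br u (fst y)))
        (psubst (lop T) (\<lambda>e. - F ((e, T + snd y) # x # ys)) (br u (fst y)))"
      by (rule eqv_psubst) (rule 2)
    have 3: "eqv ?W (psubst (lop T) (\<lambda>e. F ((e, T + snd x) # y # ys)) (br u (fst x)))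
        (psubst (lop T) (\<lambda>e. - F (y # (e, T + snd x) # ys)) (br u (fst x)))"
      by (rule eqv_psubst) (rule 3)
    from eqv_diff[OF eqv_diff[OF 1 2] 3] show ?case
      by (simp add: lie_der_minus psubst_lop_rules algebra_simps)
  next
    case (Cons z xs)
    have "eqv (T + (w + snd z) + wt (xs @ x # y # ys)) (lie_der u T (\<lambda>zs. F (z # zs)) (xs @ x # y # ys))
        (- lie_der u T (\<lambda>zs. F (z # zs)) (xs @ y # x # ys))"
      by (rule Cons.IH) (rule alternating_Cons[OF Cons.prems])
    moreover have "eqv (T + (w + snd z) + wt (xs @ x # y # ys)) (F ((e, T + snd z) # xs @ x # y # ys))
        (- F ((e, T + snd z) # xs @ y # x # ys))" for e
      using alternatingD[OF Cons.prems, of "(e, T + snd z) # xs" x y ys] by (simp add: add_ac)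
    ultimately have "eqv (T + (w + snd z) + wt (xs @ x # y # ys))
        (lie_der u T F (z # xs @ x # y # ys))
        (- lie_der u T (\<lambda>zs. F (z # zs)) (xs @ y # x # ys)
         - psubst (lop T) (\<lambda>e. - F ((e, T + snd z) # xs @ y # x # ys)) (br u (fst z)))"
      unfolding lie_der.simps by (intro eqv_diff eqv_psubst)
    then show ?case
      by (simp add: psubst_lop_rules add_ac)
  qed
  then show ?thesis
    by (simp add: alternating_def)
qed

text \<open>At the front, dF(x, y, ...) is L_x F(y, ...) - L_y F(x, ...) - F([x, y], ...) + d(F(x,
  y, ...)). The first two terms are exchanged up to sign, the last changes sign because
  \<open>F\<close> alternates, and the bracket term does so by skew-symmetry, which is where
  sesquilinearity enters.\<close>

lemma alternating_loday_diff:
  assumes "multiadditive F" "alternating w F" "sesquilinear w F"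
  shows "alternating w (loday_diff F)"
proof -
  have "eqv (w + wt (xs @ x # y # ys)) (loday_diff F (xs @ x # y # ys))
      (- loday_diff F (xs @ y # x # ys))" for xs x y ys
    using assms
  proof (induction xs arbitrary: F w)
    case Nil
    let ?w = "w + (snd x + (snd y + wt ys))"
    let ?g = "\<lambda>e. F ((e, snd x + snd y) # ys)"
    have "eqv ?w (psubst (lop (snd y)) ?g (br (fst y) (fst x)))
        (- psubst (lop (snd x)) ?g (br (fst x) (fst y)))"
    proof (rule psubst_skew)
      show "additive ?g"
        by (rule multiadditiveD[OF Nil(1)])
      show "eqv ?w (?g (dE e)) (- lop (snd x + snd y) (?g e))" for e
        using sesquilinearD[OF Nil(3), of "[]" e "snd x + snd y" ys] by (simp add: add_ac)
    qed
    moreover have "eqv (w + snd x + snd y + wt ys) (loday_diff (\<lambda>zs. F (x # y # zs)) ys)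
       (loday_diff (\<lambda>zs. - F (y # x # zs)) ys)"
    proof (rule loday_diff_cong)
      show "eqv (w + snd x + snd y + wt zs) (F (x # y # zs)) (- F (y # x # zs))" for zs
        using alternatingD[OF Nil(2), of "[]" x y zs] by (simp add: add_ac)
    qed
    ultimately have "eqv ?w (loday_diff (\<lambda>zs. F (x # y # zs)) ys
         + - psubst (lop (snd x)) ?g (br (fst x) (fst y)))
        (loday_diff (\<lambda>zs. - F (y # x # zs)) ys
         + psubst (lop (snd y)) ?g (br (fst y) (fst x)))"
      by (intro eqv_add) (simp_all add: add_ac eqv_sym)
    then have "eqv ?w (lie_der (fst x) (snd x) (\<lambda>zs. F (y # zs)) ys
           - lie_der (fst y) (snd y) (\<lambda>zs. F (x # zs)) ys
           + (loday_diff (\<lambda>zs. F (x # y # zs)) ys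
             + - psubst (lop (snd x)) ?g (br (fst x) (fst y))))
        (lie_der (fst x) (snd x) (\<lambda>zs. F (y # zs)) ys
           - lie_der (fst y) (snd y) (\<lambda>zs. F (x # zs)) ys
           + (loday_diff (\<lambda>zs. - F (y # x # zs)) ys
             + psubst (lop (snd y)) ?g (br (fst y) (fst x))))"
      by (rule eqv_add[OF eqv_refl])
    then show ?case
      by (simp add: loday_diff_minus add.commute[of "snd y" "snd x"] algebra_simps)
  next
    case (Cons z xs)
    have "eqv (w + snd z + wt (xs @ x # y # ys)) (loday_diff (\<lambda>zs. F (z # zs)) (xs @ x # y # ys))
        (- loday_diff (\<lambda>zs. F (z # zs)) (xs @ y # x # ys))"
      by (rule Cons.IH) (intro multiadditive_Cons alternating_Cons sesquilinear_Cons Cons.prems)+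
    from eqv_diff[OF alternatingD[OF alternating_lie_der[OF Cons.prems(2), of "snd z" "fst z"], of xs x y ys] this[unfolded add.commute[of w]]]
    show ?case
      by (simp add: add_ac)
  qed
  then show ?thesis
    by (simp add: alternating_def)
qed

text \<open>An equality and not just a congruence: \<open>u\<close> enters only through the action
  and the left argument of the bracket, both of which are sesquilinear on the nose.\<close>

lemma lie_der_dE: "multiadditive F \<Longrightarrow> lie_der (dE u) T F xs = - lop T (lie_der u T F xs)"
proof (induction xs arbitrary: F)
  case (Cons x xs)
  let ?g = "\<lambda>e. F ((e, T + snd x) # xs)"
  have g: "additive ?g"
    by (rule multiadditiveD[OF Cons.prems])
  have "psubst (lop T) ?g (- pCons 0 q) = - lop T (psubst (lop T) ?g q)" for q
    unfolding additive.minus[OF additive_psubst[OF additive_lop g]]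
    by (subst psubst_pCons[where g="?g", OF additive_lop additive.zero[OF g]])
      (simp add: additive.zero[OF g])
  then show ?case
    using Cons.IH[OF multiadditive_Cons[OF Cons.prems], of x]
    by (simp add: br_dE_left additive.diff[OF additive_lop])
qed (simp add: act_dE)

text \<open>In the bracket term, [u, \<partial>e] contributes \<partial> + T, and \<partial> acts as
  -(T + R) in a slot with label \<open>T + R\<close>. The resulting factor is -R, the same as in the
  other terms.\<close>

lemma sesquilinear_lie_der:
  assumes "multiadditive F" "sesquilinear w F" shows "sesquilinear (T + w) (lie_der u T F)"
proof -
  have "eqv (T + w + wt (xs @ (e, R) # ys)) (lie_der u T F (xs @ (dE e, R) # ys))
      (- lop R (lie_der u T F (xs @ (e, R) # ys)))" for xs e R ys
    using assms
  proof (induction xs arbitrary: F w)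
    case Nil
    let ?W = "T + (w + R) + wt ys" and ?g = "\<lambda>e. F ((e, T + R) # ys)"
    have 1: "eqv ?W (lie_der u T (\<lambda>zs. F ((dE e, R) # zs)) ys)
        (lie_der u T (\<lambda>zs. - lop R (F ((e, R) # zs))) ys)"
    proof (rule lie_der_cong)
      show "eqv (w + R + wt zs) (F ((dE e, R) # zs)) (- lop R (F ((e, R) # zs)))" for zs
        using sesquilinearD[OF Nil(2), of "[]" e R zs] by (simp add: add_ac)
    qed
    have "eqv ?W (psubst (lop T) (\<lambda>c. ?g (dE c)) (br u e)) (psubst (lop T) (\<lambda>c. - lop (T + R) (?g c)) (br u e))"
    proof (rule eqv_psubst)
      show "eqv ?W (?g (dE c)) (- lop (T + R) (?g c))" for c
        using sesquilinearD[OF Nil(2), of "[]" c "T + R" ys] by (simp add: add_ac)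
    qed
    from eqv_add[OF eqv_refl this, of "lop T (psubst (lop T) ?g (br u e))"]
    have 2: "eqv ?W (psubst (lop T) ?g (br u (dE e))) (- lop R (psubst (lop T) ?g (br u e)))"
      by (simp add: br_dE_right psubst_var_plus[OF additive_lop multiadditiveD[OF Nil(1)] additive_dE]
          psubst_lop_rules psubst_lop_hom[OF additive_lop lop_commute] lop_add_left)
    from eqv_diff[OF 1 2] show ?case
      by (simp add: lie_der_minus lie_der_lop additive.diff[OF additive_lop] algebra_simps)
  next
    case (Cons z xs)
    let ?W = "T + (w + snd z) + wt (xs @ (e, R) # ys)"
    have 1: "eqv ?W (lie_der u T (\<lambda>zs. F (z # zs)) (xs @ (dE e, R) # ys))
        (- lop R (lie_der u T (\<lambda>zs. F (z # zs)) (xs @ (e, R) # ys)))"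
      by (rule Cons.IH) (intro multiadditive_Cons sesquilinear_Cons Cons.prems)+
    have 2: "eqv ?W (psubst (lop T) (\<lambda>c. F ((c, T + snd z) # xs @ (dE e, R) # ys)) (br u (fst z)))
        (psubst (lop T) (\<lambda>c. - lop R (F ((c, T + snd z) # xs @ (e, R) # ys))) (br u (fst z)))"
    proof (rule eqv_psubst)
      show "eqv ?W (F ((c, T + snd z) # xs @ (dE e, R) # ys))
          (- lop R (F ((c, T + snd z) # xs @ (e, R) # ys)))" for c
        using sesquilinearD[OF Cons.prems(2), of "(c, T + snd z) # xs" e R ys] by (simp add: add_ac)
    qed
    from eqv_diff[OF 1 2] show ?case
      by (simp add: psubst_lop_rules psubst_lop_hom[OF additive_lop lop_commute]
          additive.diff[OF additive_lop] algebra_simps)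
  qed
  then show ?thesis
    by (simp add: sesquilinear_def)
qed

lemma sesquilinear_loday_diff:
  assumes "multiadditive F" "sesquilinear w F"
  shows "sesquilinear w (loday_diff F)"
proof -
  have "eqv (w + wt (xs @ (e, R) # ys)) (loday_diff F (xs @ (dE e, R) # ys))
      (- lop R (loday_diff F (xs @ (e, R) # ys)))" for xs e R ys
    using assms
  proof (induction xs arbitrary: F w)
    case Nil
    have "eqv (w + R + wt ys) (loday_diff (\<lambda>zs. F ((dE e, R) # zs)) ys)
        (loday_diff (\<lambda>zs. - lop R (F ((e, R) # zs))) ys)"
    proof (rule loday_diff_cong)
      show "eqv (w + R + wt zs) (F ((dE e, R) # zs)) (- lop R (F ((e, R) # zs)))" for zs
        using sesquilinearD[OF Nil(2), of "[]" e R zs] by (simp add: add_ac)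
    qed
    from eqv_diff[OF eqv_refl this, of "lie_der (dE e) R F ys"] show ?case
      by (simp add: loday_diff_minus loday_diff_lop lie_der_dE[OF Nil(1)]
          additive.diff[OF additive_lop] algebra_simps)
  next
    case (Cons z xs)
    let ?W = "w + snd z + wt (xs @ (e, R) # ys)"
    have 1: "eqv ?W (loday_diff (\<lambda>zs. F (z # zs)) (xs @ (dE e, R) # ys))
        (- lop R (loday_diff (\<lambda>zs. F (z # zs)) (xs @ (e, R) # ys)))"
      by (rule Cons.IH) (intro multiadditive_Cons sesquilinear_Cons Cons.prems)+
    have 2: "eqv ?W (lie_der (fst z) (snd z) F (xs @ (dE e, R) # ys))
        (- lop R (lie_der (fst z) (snd z) F (xs @ (e, R) # ys)))"
      using sesquilinearD[OF sesquilinear_lie_der[OF Cons.prems, of "snd z" "fst z"], of xs e R ys]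
      by (simp add: add_ac)
    from eqv_diff[OF 2 1] show ?case
      by (simp add: additive.diff[OF additive_lop] algebra_simps)
  qed
  then show ?thesis
    by (simp add: sesquilinear_def)
qed

end

section \<open>Omitted entries, transpositions and signs\<close>

lemma nths_compl_nth: "i < length xs \<Longrightarrow> nths xs (- {i}) = take i xs @ drop (Suc i) xs"
proof (induction xs arbitrary: i)
  case (Cons x xs)
  have "{j. Suc j \<in> - {Suc i}} = - {i}" "{j. Suc j \<in> - {0}} = UNIV" for i :: nat
    by auto
  with Cons show ?case
    by (cases i) (auto simp: nths_Cons nths_all)
qed simp

lemma nths_Cons_compl:
  "nths (x # xs) (- {0}) = xs"
  "nths (x # xs) (- {Suc i}) = x # nths xs (- {i})"
  "nths (x # xs) (- {0, Suc j}) = nths xs (- {j})"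
  "nths (x # xs) (- {Suc i, Suc j}) = x # nths xs (- {i, j})"
proof -
  have "{k. Suc k \<in> - {0}} = UNIV" "{k. Suc k \<in> - {Suc i}} = - {i}"
    "{k. Suc k \<in> - {0, Suc j}} = - {j}" "{k. Suc k \<in> - {Suc i, Suc j}} = - {i, j}"
    by auto
  then show "nths (x # xs) (- {0}) = xs"
    "nths (x # xs) (- {Suc i}) = x # nths xs (- {i})"
    "nths (x # xs) (- {0, Suc j}) = nths xs (- {j})"
    "nths (x # xs) (- {Suc i, Suc j}) = x # nths xs (- {i, j})"
    by (simp_all add: nths_Cons nths_all)
qed

lemma permute_list_transpose:
  assumes "a = length ps" "b = Suc (length ps + length ms)"
  shows "permute_list (Transposition.transpose a b) (ps @ x # ms @ y # ss) = ps @ y # ms @ x # ss"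
  (is "?l = ?r")
proof (rule nth_equalityI)
  fix i assume "i < length ?l"
  then have i: "i < Suc (Suc (length ps + length ms + length ss))"
    by simp
  have "Transposition.transpose a b permutes {..<length (ps @ x # ms @ y # ss)}"
    using assms by (intro permutes_swap_id) auto
  from permute_list_nth[OF this] i
  have l: "?l ! i = (ps @ x # ms @ y # ss) ! Transposition.transpose a b i"
    by simp
  consider "i < a" | "i = a" | "a < i" "i < b" | "i = b" | "b < i"
    by linarith
  then show "?l ! i = ?r ! i"
  proof cases
    case 3
    define k where "k = i - Suc a"
    have "i = Suc (a + k)" "k < length ms"
      using 3 assms by (auto simp: k_def)
    then show ?thesis
      unfolding l using i assms by (simp add: nth_append Transposition.transpose_def)
  next
    case 5
    define k where "k = i - Suc b"
    have "i = Suc (b + k)"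
      using 5 by (simp add: k_def)
    then show ?thesis
      unfolding l using i assms by (simp add: nth_append Transposition.transpose_def)
  qed (unfold l, use i assms in \<open>simp_all add: nth_append Transposition.transpose_def\<close>)
qed simp

lemma wt_permute_list: "\<pi> permutes {..<length xs} \<Longrightarrow> wt (permute_list \<pi> xs) = wt xs"
  unfolding wt_def sum_mset_sum_list[symmetric] mset_map by simp

definition psigned :: "(nat \<Rightarrow> nat) \<Rightarrow> 'v::ab_group_add \<Rightarrow> 'v" where
  "psigned \<pi> v = (if evenperm \<pi> then v else - v)"

context leibniz_diff
begin

lemma alternating_move:
  assumes "alternating w F"
  shows "eqv (w + wt (xs @ ys @ x # zs)) (F (xs @ ys @ x # zs)) (signed (length ys) (F (xs @ x # ys @ zs)))"
proof (induction ys arbitrary: xs)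
  case (Cons y ys)
  have "eqv (w + wt (xs @ (y # ys) @ x # zs)) (F (xs @ (y # ys) @ x # zs)) (signed (length ys) (F (xs @ y # x # ys @ zs)))"
    using Cons[of "xs @ [y]"] by (simp add: add_ac)
  also have "eqv (w + wt (xs @ (y # ys) @ x # zs)) \<dots> (signed (length ys) (- F (xs @ x # y # ys @ zs)))"
    using eqv_signed[OF alternatingD[OF assms, of xs y x "ys @ zs"], of "length ys"] by (simp add: add_ac)
  finally show ?case
    by (simp add: signed_minus)
qed simp

text \<open>Both lists are brought to the form in which \<open>y\<close> and \<open>x\<close> stand
  next to each other before \<open>ms\<close>. The numbers of neighbour exchanges differ by one,
  hence the sign.\<close>

lemma alternating_swap:
  assumes "alternating w F"
  shows "eqv (w + wt (ps @ x # ms @ y # ss)) (F (ps @ x # ms @ y # ss)) (- F (ps @ y # ms @ x # ss))"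
proof -
  let ?n = "length ms" and ?W = "w + wt (ps @ x # ms @ y # ss)"
  have "eqv ?W (F (ps @ x # ms @ y # ss)) (signed (Suc ?n) (F (ps @ y # x # ms @ ss)))"
    using alternating_move[OF assms, of ps "x # ms" y ss] by (simp add: add_ac)
  moreover have "eqv ?W (F (ps @ y # ms @ x # ss)) (signed ?n (F (ps @ y # x # ms @ ss)))"
    using alternating_move[OF assms, of "ps @ [y]" ms x ss] by (simp add: add_ac)
  ultimately show ?thesis
    using eqv_trans[OF _ eqv_sym[OF eqv_minus]] by simp
qed

lemma alternating_permute:
  assumes alt: "alternating w F" and \<pi>: "\<pi> permutes {..<length xs}"
  shows "eqv (w + wt xs) (F xs) (psigned \<pi> (F (permute_list \<pi> xs)))"
proof -
  define n where "n = length xs"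
  have fin: "finite {..<n}"
    by simp
  have "\<forall>xs. length xs = n \<longrightarrow> eqv (w + wt xs) (F xs) (psigned \<pi> (F (permute_list \<pi> xs)))"
    using \<pi>[folded n_def] fin
  proof (induction rule: permutes_induct)
    case id
    then show ?case
      by (simp add: psigned_def evenperm_id[unfolded id_def] id_def)
  next
    case (swap a b p)
    show ?case
    proof (intro allI impI)
      fix xs :: "('e \<times> 'l) list"
      assume n: "length xs = n"
      define t where "t = Transposition.transpose a b"
      \<comment> \<open>The two positions are put in increasing order so that the list can be cut at
        them.\<close>
      define c d where "c = min a b" and "d = max a b"
      have cd: "c < d" "d < length xs" and t: "t = Transposition.transpose c d"
        using swap n by (auto simp: c_def d_def t_def min_def max_def transpose_commute)
      obtain ps x ms y ss where xs: "xs = ps @ x # ms @ y # ss"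
        and len: "c = length ps" "d = Suc (length ps + length ms)"
      proof
        let ?ys = "drop (Suc c) xs"
        have *: "d - Suc c < length ?ys"
          using cd by auto
        show "xs = take c xs @ xs ! c # take (d - Suc c) ?ys @ ?ys ! (d - Suc c) # drop (Suc (d - Suc c)) ?ys"
          using id_take_nth_drop[of c xs] id_take_nth_drop[OF *] cd by simp
        show "c = length (take c xs)"
          "d = Suc (length (take c xs) + length (take (d - Suc c) ?ys))"
          using cd by simp_all
      qed
      have txs: "permute_list t xs = ps @ y # ms @ x # ss"
        unfolding t xs by (rule permute_list_transpose) (use len in auto)
      have p: "p permutes {..<length xs}"
        using swap n by simp
      have "t permutes {..<length xs}"
        using swap n by (auto simp: t_def intro: permutes_swap_id)
      then have wt: "wt (permute_list t xs) = wt xs"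
        by (rule wt_permute_list)
      have perm: "permute_list (t \<circ> p) xs = permute_list p (permute_list t xs)"
        by (rule permute_list_compose) (rule p)
      have even: "evenperm (t \<circ> p) \<longleftrightarrow> \<not> evenperm p"
        using swap permutes_imp_permutation[OF _ p]
        by (simp add: evenperm_comp permutation_swap_id evenperm_swap t_def)
      have "eqv (w + wt xs) (F xs) (- F (permute_list t xs))"
        unfolding txs unfolding xs by (rule alternating_swap[OF alt])
      also have "eqv (w + wt xs) \<dots> (- psigned p (F (permute_list p (permute_list t xs))))"
        using swap.IH[rule_format, of "permute_list t xs"] n wt by (intro eqv_minus) simp
      also have "- psigned p (F (permute_list p (permute_list t xs))) = psigned (t \<circ> p) (F (permute_list (t \<circ> p) xs))"
        by (simp add: psigned_def even perm)
      finally show "eqv (w + wt xs) (F xs) (psigned (Transposition.transpose a b \<circ> p)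
          (F (permute_list (Transposition.transpose a b \<circ> p) xs)))"
        by (simp add: t_def)
    qed
  qed
  then show ?thesis
    by (simp add: n_def)
qed

section \<open>Comparison of the two formulas for the differential\<close>

lemma lie_der_eq_sum: "lie_der u T F xs = act u T (F xs)
    - (\<Sum>j<length xs. psubst (lop T) (\<lambda>e. F (xs[j := (e, T + snd (xs ! j))])) (br u (fst (xs ! j))))"
  by (induction xs arbitrary: F) (simp_all add: sum.lessThan_Suc_shift del: sum.lessThan_Suc)

text \<open>The formula of the theorem on slots with arbitrary labels and with indices from 0. When
  the labels are the variables themselves it is \<open>diff_formula\<close>, by
  \<open>diff_formula_eq\<close>.\<close>

definition ce_formula :: "(('e \<times> 'l) list \<Rightarrow> 'v) \<Rightarrow> ('e \<times> 'l) list \<Rightarrow> 'v" where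
  "ce_formula F xs =
    (\<Sum>i<length xs. signed i (act (fst (xs ! i)) (snd (xs ! i)) (F (nths xs (- {i})))))
    + (\<Sum>j<length xs. \<Sum>i<j. signed (i + j) (psubst (lop (snd (xs ! i)))
        (\<lambda>e. F ((e, snd (xs ! i) + snd (xs ! j)) # nths xs (- {i, j}))) (br (fst (xs ! i)) (fst (xs ! j)))))"

text \<open>Separates the terms in which \<open>x\<close> acts or is bracketed. In the last sum the
  bracket entry still precedes \<open>x\<close>; the minus sign before \<open>F\<close> anticipates
  their exchange.\<close>

lemma ce_formula_Cons: "ce_formula F (x # xs) =
    act (fst x) (snd x) (F xs)
    - (\<Sum>j<length xs. signed j (psubst (lop (snd x))
         (\<lambda>e. F ((e, snd x + snd (xs ! j)) # nths xs (- {j}))) (br (fst x) (fst (xs ! j)))))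
    - ((\<Sum>i<length xs. signed i (act (fst (xs ! i)) (snd (xs ! i)) (F (x # nths xs (- {i})))))
      + (\<Sum>j<length xs. \<Sum>i<j. signed (i + j) (psubst (lop (snd (xs ! i)))
        (\<lambda>e. - F ((e, snd (xs ! i) + snd (xs ! j)) # x # nths xs (- {i, j}))) (br (fst (xs ! i)) (fst (xs ! j))))))"
  by (simp add: ce_formula_def sum.lessThan_Suc_shift nths_Cons_compl psubst_lop_rules sum.distrib
      sum_subtractf sum_negf signed_minus algebra_simps del: sum.lessThan_Suc)

lemma wt_nths_compl: "i < length xs \<Longrightarrow> snd (xs ! i) + wt (nths xs (- {i})) = wt xs"
  by (subst (3) id_take_nth_drop, assumption) (simp add: nths_compl_nth add_ac)

lemma wt_nths_compl2:
  assumes "i < j" "j < length xs"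
  shows "snd (xs ! i) + (snd (xs ! j) + wt (nths xs (- {i, j}))) = wt xs"
  using assms
proof (induction xs arbitrary: i j)
  case (Cons x xs)
  then obtain j' where j: "j = Suc j'"
    by (cases j) auto
  show ?case
  proof (cases i)
    case 0
    with Cons j show ?thesis
      by (simp add: nths_Cons_compl wt_nths_compl)
  next
    case (Suc i')
    with Cons j have "snd (xs ! i') + (snd (xs ! j') + wt (nths xs (- {i', j'}))) = wt xs"
      by simp
    with Suc j show ?thesis
      by (simp add: nths_Cons_compl add_ac)
  qed
qed simp

text \<open>Moving a bracket entry from the front to position j of \<open>xs\<close> costs (-1)^j,
  which cancels the sign of its term and produces the bracket part of L_x F. In the other double sum
  the entry is moved past \<open>x\<close>, and the formula for the contraction by \<open>x\<close>
  appears.\<close>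

lemma ce_formula_eqv:
  "alternating w F \<Longrightarrow> eqv (w + wt xs) (ce_formula F xs) (loday_diff F xs)"
proof (induction xs arbitrary: w F)
  case Nil
  then show ?case
    by (simp add: ce_formula_def)
next
  case (Cons x xs)
  let ?W = "w + snd x + wt xs"
  have 1: "eqv ?W (\<Sum>j<length xs. signed j (psubst (lop (snd x))
         (\<lambda>e. F ((e, snd x + snd (xs ! j)) # nths xs (- {j}))) (br (fst x) (fst (xs ! j)))))
      (\<Sum>j<length xs. psubst (lop (snd x))
         (\<lambda>e. F (xs[j := (e, snd x + snd (xs ! j))])) (br (fst x) (fst (xs ! j))))"
  proof (rule eqv_sum)
    fix j assume j: "j \<in> {..<length xs}"
    let ?y = "\<lambda>e. (e, snd x + snd (xs ! j))"
    have "eqv ?W (F (xs[j := ?y e])) (signed j (F (?y e # nths xs (- {j}))))" for e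
      using alternating_move[OF Cons.prems, of "[]" "take j xs" "?y e" "drop (Suc j) xs"]
        wt_nths_compl[of j xs] j
      by (simp add: nths_compl_nth upd_conv_take_nth_drop add_ac min_def)
    from eqv_sym[OF this] eqv_psubst[where g="\<lambda>e. signed j (F (?y e # nths xs (- {j})))"
        and h="\<lambda>e. F (xs[j := ?y e])" and w="?W" and T="snd x" and q="br (fst x) (fst (xs ! j))"]
    show "eqv ?W (signed j (psubst (lop (snd x)) (\<lambda>e. F (?y e # nths xs (- {j}))) (br (fst x) (fst (xs ! j)))))
       (psubst (lop (snd x)) (\<lambda>e. F (xs[j := ?y e])) (br (fst x) (fst (xs ! j))))"
      by (cases "even j") (simp_all add: signed_def psubst_lop_rules)
  qed
  have 2: "eqv ?W (\<Sum>j<length xs. \<Sum>i<j. signed (i + j) (psubst (lop (snd (xs ! i)))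
        (\<lambda>e. - F ((e, snd (xs ! i) + snd (xs ! j)) # x # nths xs (- {i, j}))) (br (fst (xs ! i)) (fst (xs ! j)))))
      (\<Sum>j<length xs. \<Sum>i<j. signed (i + j) (psubst (lop (snd (xs ! i)))
        (\<lambda>e. F (x # (e, snd (xs ! i) + snd (xs ! j)) # nths xs (- {i, j}))) (br (fst (xs ! i)) (fst (xs ! j)))))"
  proof (intro eqv_sum eqv_signed eqv_psubst)
    fix i j e assume *: "j \<in> {..<length xs}" "i \<in> {..<j}"
    show "eqv ?W (- F ((e, snd (xs ! i) + snd (xs ! j)) # x # nths xs (- {i, j})))
      (F (x # (e, snd (xs ! i) + snd (xs ! j)) # nths xs (- {i, j})))"
      using eqv_sym[OF alternatingD[OF Cons.prems, of "[]" x "(e, snd (xs ! i) + snd (xs ! j))" "nths xs (- {i, j})"]]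
        wt_nths_compl2[of i j xs] *
      by (simp add: add_ac)
  qed
  have 3: "eqv ?W (ce_formula (\<lambda>ys. F (x # ys)) xs) (loday_diff (\<lambda>ys. F (x # ys)) xs)"
    by (rule Cons.IH) (rule alternating_Cons[OF Cons.prems])
  have "eqv ?W (ce_formula F (x # xs))
      (lie_der (fst x) (snd x) F xs - ce_formula (\<lambda>ys. F (x # ys)) xs)"
    unfolding ce_formula_Cons lie_der_eq_sum ce_formula_def[of "\<lambda>ys. F (x # ys)"]
    by (rule eqv_diff[OF eqv_diff[OF eqv_refl 1] eqv_add[OF eqv_refl 2]])
  also have "eqv ?W \<dots> (loday_diff F (x # xs))"
    using eqv_diff[OF eqv_refl 3] by simp
  finally show ?case
    by (simp add: add_ac)
qed

end

section \<open>Simultaneous substitution\<close>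

lemma lookup_map_0: "f 0 = 0 \<Longrightarrow> Poly_Mapping.lookup (Poly_Mapping.map f p) \<alpha> = f (Poly_Mapping.lookup p \<alpha>)"
  by (cases "Poly_Mapping.lookup p \<alpha> = 0") (auto simp: Poly_Mapping.map.rep_eq)

lemma additive_map: "additive f \<Longrightarrow> additive (Poly_Mapping.map f)"
  by (auto simp: additive_def poly_mapping_eq_iff fun_eq_iff lookup_add
      lookup_map_0 additive.zero[unfolded additive_def])

lemma map_mconst: "additive f \<Longrightarrow> Poly_Mapping.map f (mconst c) = mconst (f c)"
  by (simp add: mconst_def additive.zero)

lemma map_mvar:
  fixes p :: "'x::ab_group_add mpoly" and f :: "'x \<Rightarrow> 'y::ab_group_add"
  assumes f: "additive f"
  shows "Poly_Mapping.map f (mvar i p) = mvar i (Poly_Mapping.map f p)"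
  by (subst (1 2) mpoly_sum_single[of p, symmetric])
    (simp add: additive.sum[OF additive_mvar] additive.sum[OF additive_map[OF f]] mvar_single
      additive.zero[OF f])

lemma foldr_funpow_indep:
  assumes "Poly_Mapping.keys \<alpha> \<subseteq> {..<n}" "n \<le> m"
  shows "foldr (\<lambda>l. \<tau> l ^^ Poly_Mapping.lookup \<alpha> l) [0..<m] x =
    foldr (\<lambda>l. \<tau> l ^^ Poly_Mapping.lookup \<alpha> l) [0..<n] x"
  using assms(2)
proof (induction m rule: dec_induct)
  case (step m)
  then have "Poly_Mapping.lookup \<alpha> m = 0"
    using assms(1) by (auto simp: in_keys_iff)
  with step show ?case
    by simp
qed simp

lemma foldr_funpow_cong:
  assumes "\<And>l. l \<in> set ls \<Longrightarrow> l \<in> Poly_Mapping.keys \<alpha> \<Longrightarrow> \<tau> l = \<tau>' l"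
  shows "foldr (\<lambda>l. \<tau> l ^^ Poly_Mapping.lookup \<alpha> l) ls x =
    foldr (\<lambda>l. \<tau>' l ^^ Poly_Mapping.lookup \<alpha> l) ls x"
proof (rule foldr_cong[OF refl refl])
  show "(\<tau> l ^^ Poly_Mapping.lookup \<alpha> l) y = (\<tau>' l ^^ Poly_Mapping.lookup \<alpha> l) y" if "l \<in> set ls" for l y
    using assms[OF that] by (cases "l \<in> Poly_Mapping.keys \<alpha>") (auto simp: in_keys_iff)
qed

lemma foldr_funpow_incr:
  assumes comm: "\<And>i j x. \<tau> i (\<tau> j x) = \<tau> j (\<tau> i x)"
  shows "distinct ls \<Longrightarrow> i \<in> set ls \<Longrightarrow>
    foldr (\<lambda>l. \<tau> l ^^ Poly_Mapping.lookup (Poly_Mapping.single i 1 + \<alpha>) l) ls x =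
    \<tau> i (foldr (\<lambda>l. \<tau> l ^^ Poly_Mapping.lookup \<alpha> l) ls x)"
proof (induction ls)
  case (Cons y ys)
  have pow: "(\<tau> y ^^ n) (\<tau> i z) = \<tau> i ((\<tau> y ^^ n) z)" for n z
    by (induction n) (simp_all add: comm[of i])
  show ?case
  proof (cases "y = i")
    case True
    have "foldr (\<lambda>l. \<tau> l ^^ Poly_Mapping.lookup (Poly_Mapping.single i 1 + \<alpha>) l) ys x =
      foldr (\<lambda>l. \<tau> l ^^ Poly_Mapping.lookup \<alpha> l) ys x"
      using Cons.prems True by (intro foldr_cong) (auto simp: lookup_add lookup_single when_def)
    with True show ?thesis
      by (simp add: lookup_add)
  next
    case False
    with Cons show ?thesis
      by (simp add: lookup_add lookup_single when_def pow)
  qed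
qed simp

definition commuting :: "('i \<Rightarrow> 'p \<Rightarrow> 'p::ab_group_add) \<Rightarrow> bool" where
  "commuting \<tau> \<longleftrightarrow> (\<forall>i. additive (\<tau> i)) \<and> (\<forall>i j x. \<tau> i (\<tau> j x) = \<tau> j (\<tau> i x))"

lemma commutingD: "commuting \<tau> \<Longrightarrow> additive (\<tau> i)" "commuting \<tau> \<Longrightarrow> \<tau> i (\<tau> j x) = \<tau> j (\<tau> i x)"
  by (auto simp: commuting_def)

lemma commuting_mvar: "commuting (mvar :: nat \<Rightarrow> 'x::ab_group_add mpoly \<Rightarrow> 'x mpoly)"
  unfolding commuting_def using additive_mvar mvar_commute by blast

text \<open>One operator for every natural number, so no number of variables has to be carried
  along. The \<open>Max\<close> is just a bound for the variables of the monomial.\<close>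

definition gsubst :: "(nat \<Rightarrow> 'p \<Rightarrow> 'p) \<Rightarrow> ('x::zero \<Rightarrow> 'p::ab_group_add) \<Rightarrow> 'x mpoly \<Rightarrow> 'p" where
  "gsubst \<tau> g = msum (\<lambda>\<alpha> c. foldr (\<lambda>l. \<tau> l ^^ Poly_Mapping.lookup \<alpha> l)
     [0..<Suc (Max (insert 0 (Poly_Mapping.keys \<alpha>)))] (g c))"

lemma keys_subset_Max: "Poly_Mapping.keys \<alpha> \<subseteq> {..<Suc (Max (insert 0 (Poly_Mapping.keys \<alpha>)))}"
  by (auto simp: less_Suc_eq_le)

lemma additive_foldr_funpow:
  "commuting \<tau> \<Longrightarrow> additive g \<Longrightarrow> additive (\<lambda>c. foldr (\<lambda>l. \<tau> l ^^ f l) ls (g c))"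
proof (induction ls)
  case (Cons a ls)
  have "additive (\<lambda>c. (\<tau> a ^^ f a) (foldr (\<lambda>l. \<tau> l ^^ f l) ls (g c)))"
    by (rule additive_comp[OF additive_funpow[OF commutingD(1)[OF Cons.prems(1)]] Cons.IH[OF Cons.prems]])
  then show ?case
    by simp
qed simp

lemma additive_gsubst: "commuting \<tau> \<Longrightarrow> additive g \<Longrightarrow> additive (gsubst \<tau> g)"
  unfolding gsubst_def by (intro additive_msum additive_foldr_funpow)

lemma gsubst_single:
  assumes "commuting \<tau>" "additive g" "Poly_Mapping.keys \<alpha> \<subseteq> {..<n}"
  shows "gsubst \<tau> g (Poly_Mapping.single \<alpha> c) = foldr (\<lambda>l. \<tau> l ^^ Poly_Mapping.lookup \<alpha> l) [0..<n] (g c)"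
proof -
  let ?N = "Suc (Max (insert 0 (Poly_Mapping.keys \<alpha>)))"
  have "gsubst \<tau> g (Poly_Mapping.single \<alpha> c) = foldr (\<lambda>l. \<tau> l ^^ Poly_Mapping.lookup \<alpha> l) [0..<?N] (g c)"
    unfolding gsubst_def
    by (rule msum_single) (rule additive.zero[OF additive_foldr_funpow[OF assms(1,2)]])
  also have "\<dots> = foldr (\<lambda>l. \<tau> l ^^ Poly_Mapping.lookup \<alpha> l) [0..<max n ?N] (g c)"
    by (rule foldr_funpow_indep[symmetric, OF keys_subset_Max]) simp
  also have "\<dots> = foldr (\<lambda>l. \<tau> l ^^ Poly_Mapping.lookup \<alpha> l) [0..<n] (g c)"
    by (rule foldr_funpow_indep[OF assms(3)]) simp
  finally show ?thesis .
qed

lemma gsubst_mconst: "commuting \<tau> \<Longrightarrow> additive g \<Longrightarrow> gsubst \<tau> g (mconst c) = g c"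
  using gsubst_single[of \<tau> g 0 0 c] by (simp add: mconst_def)

lemma gsubst_mvar:
  assumes \<tau>: "commuting \<tau>" and g: "additive g"
  shows "gsubst \<tau> g (mvar i p) = \<tau> i (gsubst \<tau> g p)"
proof -
  have "gsubst \<tau> g (mvar i (Poly_Mapping.single \<alpha> c)) = \<tau> i (gsubst \<tau> g (Poly_Mapping.single \<alpha> c))" for \<alpha> c
  proof -
    define n where "n = Suc (Max (insert 0 (insert i (Poly_Mapping.keys \<alpha>))))"
    have n: "i < n" "Poly_Mapping.keys \<alpha> \<subseteq> {..<n}"
      by (auto simp: n_def less_Suc_eq_le)
    moreover have "Poly_Mapping.keys (Poly_Mapping.single i 1 + \<alpha>) \<subseteq> {..<n}"
      using n Poly_Mapping.keys_add[of "Poly_Mapping.single i 1" \<alpha>] by fastforce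
    ultimately show ?thesis
      unfolding mvar_single
      by (simp only: gsubst_single[OF \<tau> g, of _ n])
        (rule foldr_funpow_incr[where \<tau>=\<tau>, OF commutingD(2)[OF \<tau>]]; simp)
  qed
  then show ?thesis
    by (subst (1 2) mpoly_sum_single[of p, symmetric])
      (simp add: additive.sum[OF additive_mvar] additive.sum[OF additive_gsubst[OF \<tau> g]]
        additive.sum[OF commutingD(1)[OF \<tau>]])
qed

text \<open>The universal property of polynomials: additivity, the values on constants and the rule
  for variables determine a substitution. It replaces most calculations with monomials.\<close>

lemma gsubst_unique:
  assumes "commuting \<tau>" "additive g" "additive X" "p \<in> mpolys_on V"
    and "\<And>c. X (mconst c) = g c"
    and "\<And>i p. i \<in> V \<Longrightarrow> p \<in> mpolys_on V \<Longrightarrow> X (mvar i p) = \<tau> i (X p)"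
  shows "X p = gsubst \<tau> g p"
  by (rule mpoly_hom_eqI[OF assms(4)])
    (simp_all add: assms additive_gsubst gsubst_mconst gsubst_mvar)

lemma gsubst_cong:
  assumes "commuting \<tau>" "commuting \<tau>'" "additive g" "p \<in> mpolys_on V"
    and "\<And>i. i \<in> V \<Longrightarrow> \<tau> i = \<tau>' i"
  shows "gsubst \<tau> g p = gsubst \<tau>' g p"
  by (rule gsubst_unique[OF assms(2,3) _ assms(4)])
    (use assms in \<open>simp_all add: additive_gsubst gsubst_mconst gsubst_mvar\<close>)

lemma gsubst_hom:
  assumes \<tau>: "commuting \<tau>" and \<tau>': "commuting \<tau>'" and g: "additive g" and S: "additive S"
    and comm: "\<And>i x. S (\<tau> i x) = \<tau>' i (S x)"
  shows "S (gsubst \<tau> g p) = gsubst \<tau>' (\<lambda>c. S (g c)) p"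
  by (rule gsubst_unique[OF \<tau>' additive_comp[OF S g] _ mpolys_on_UNIV])
    (simp_all add: additive_comp[OF S additive_gsubst[OF \<tau> g]] gsubst_mconst[OF \<tau> g]
      gsubst_mvar[OF \<tau> g] comm)

lemma gsubst_mpolys_on:
  assumes "commuting \<tau>" "additive g" "p \<in> mpolys_on V" and "\<And>c. g c \<in> mpolys_on W"
    and "\<And>i q. i \<in> V \<Longrightarrow> q \<in> mpolys_on W \<Longrightarrow> \<tau> i q \<in> mpolys_on W"
  shows "gsubst \<tau> g p \<in> mpolys_on W"
  using assms(3)
  by (induction p rule: mpoly_induct)
    (simp_all add: assms additive.add[OF additive_gsubst] gsubst_mconst gsubst_mvar mpolys_on_add)

text \<open>\<open>msubst\<close> ignores exponents of variables beyond its list, which amounts to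
  substituting the identity for them.\<close>

definition nth_op :: "('p \<Rightarrow> 'p) list \<Rightarrow> nat \<Rightarrow> 'p \<Rightarrow> 'p" where
  "nth_op Ts i = (if i < length Ts then Ts ! i else id)"

lemma commuting_nth_op:
  assumes "\<And>T. T \<in> set Ts \<Longrightarrow> additive T"
    and "\<And>T R x. T \<in> set Ts \<Longrightarrow> R \<in> set Ts \<Longrightarrow> T (R x) = R (T x)"
  shows "commuting (nth_op Ts)"
  using assms by (auto simp: commuting_def nth_op_def additive_def)

lemma msubst_eq_gsubst:
  assumes \<tau>: "commuting (nth_op Ts)" and g: "additive g"
  shows "msubst Ts g p = gsubst (nth_op Ts) g p"
  unfolding msubst_def gsubst_def msum_def
proof (rule sum.cong[OF refl])
  fix \<alpha>
  let ?N = "Suc (Max (insert 0 (Poly_Mapping.keys \<alpha>)))" and ?c = "g (Poly_Mapping.lookup p \<alpha>)"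
  let ?f = "\<lambda>l. nth_op Ts l ^^ Poly_Mapping.lookup \<alpha> l"
  have id: "foldr ?f ls x = x" if "\<forall>l\<in>set ls. length Ts \<le> l" for ls x
    using that by (induction ls) (auto simp: nth_op_def)
  have "foldr (\<lambda>l. (Ts ! l) ^^ Poly_Mapping.lookup \<alpha> l) [0..<length Ts] ?c = foldr ?f [0..<length Ts] ?c"
    by (rule foldr_funpow_cong) (simp add: nth_op_def)
  also have "\<dots> = foldr ?f [0..<max (length Ts) ?N] ?c"
  proof -
    have "foldr ?f [0..<length Ts + k] ?c = foldr ?f [0..<length Ts] ?c" for k
      by (simp only: upt_add_eq_append[OF le0] foldr_append) (simp add: id)
    from this[of "max (length Ts) ?N - length Ts"] show ?thesis
      by simp
  qed
  also have "\<dots> = foldr ?f [0..<?N] ?c"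
    by (rule foldr_funpow_indep[OF keys_subset_Max]) simp
  finally show "foldr (\<lambda>l. (Ts ! l) ^^ Poly_Mapping.lookup \<alpha> l) [0..<length Ts] ?c = foldr ?f [0..<?N] ?c" .
qed

section \<open>Linear forms\<close>

text \<open>Multisets of variables form the free commutative monoid on them: multiplicities are the
  coefficients of a linear form. They serve as the labels.\<close>

definition lvar :: "nat multiset \<Rightarrow> 'x::ab_group_add mpoly \<Rightarrow> 'x mpoly" where
  "lvar W p = (\<Sum>i\<in>#W. mvar i p)"

lemma lvar_empty [simp]: "lvar {#} p = 0"
  and lvar_single [simp]: "lvar {#i#} p = mvar i p"
  and lvar_add_left: "lvar (V + W) p = lvar V p + lvar W p"
  by (simp_all add: lvar_def)

lemma lvar_add_mset: "lvar (add_mset i W) p = mvar i p + lvar W p"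
  by (simp add: lvar_def)

lemma lvar_hom:
  assumes "additive S" "\<And>i x. S (mvar i x) = mvar i (S x)"
  shows "S (lvar W p) = lvar W (S p)"
  by (induction W) (simp_all add: lvar_add_mset assms additive.add[OF assms(1)] additive.zero[OF assms(1)])

lemma additive_lvar: "additive (lvar W)"
  by (induction W) (simp_all add: additive_def lvar_add_mset)

lemmas lvar_additive [simp] = additive.add[OF additive_lvar] additive.zero[OF additive_lvar]
  additive.minus[OF additive_lvar] additive.diff[OF additive_lvar]

lemma lvar_mvar: "lvar W (mvar i p) = mvar i (lvar W p)"
  by (rule lvar_hom[where S="mvar i", symmetric]) (simp_all add: additive_mvar mvar_commute)

lemma lvar_commute: "lvar V (lvar W p) = lvar W (lvar V p)"
  by (rule lvar_hom[where S="lvar V"]) (simp_all add: additive_lvar lvar_mvar)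

lemma commuting_lvar: "commuting (\<lambda>i. lvar (\<sigma> i))"
  unfolding commuting_def using additive_lvar lvar_commute by blast

lemma mpolys_on_lvar: "p \<in> mpolys_on V \<Longrightarrow> set_mset W \<subseteq> V \<Longrightarrow> lvar W p \<in> mpolys_on V"
  by (induction W) (auto simp: lvar_add_mset mpolys_on_zero intro: mpolys_on_add mpolys_on_mvar)

lemma lvar_eq_mvar: "(lvar {#i#} :: 'x::ab_group_add mpoly \<Rightarrow> 'x mpoly) = mvar i"
  by (simp add: fun_eq_iff)

lemma mpolys_on_psubst:
  assumes "additive T" "additive g" "\<And>c. g c \<in> mpolys_on V" "\<And>p. p \<in> mpolys_on V \<Longrightarrow> T p \<in> mpolys_on V"
  shows "psubst T g q \<in> mpolys_on V"
  by (induction q)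
    (simp_all add: psubst_pCons[where T=T and g=g] assms additive.zero[OF assms(2)] mpolys_on_zero mpolys_on_add)

section \<open>Modules over differential operators\<close>

lemma twist_eq_sum:
  assumes "degree w \<le> n" "\<And>b. mul b 0 = 0"
  shows "twist D mul q w = (\<Sum>i\<le>n. map_poly (\<lambda>b. mul b (coeff w i)) ((var_plus D ^^ i) q))"
  unfolding twist_def
  by (rule sum.mono_neutral_left) (use assms in \<open>auto simp: coeff_eq_0 poly_eq_iff coeff_map_poly\<close>)

lemma twist_zero: "(\<And>b. mul b 0 = 0) \<Longrightarrow> twist D mul q 0 = 0"
  by (simp add: twist_def poly_eq_iff coeff_map_poly)

lemma twist_pCons:
  assumes "\<And>b. mul b 0 = 0"
  shows "twist D mul q (pCons c w) = map_poly (\<lambda>b. mul b c) q + twist D mul (var_plus D q) w"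
proof -
  have "twist D mul q (pCons c w) =
      (\<Sum>i\<le>Suc (degree w). map_poly (\<lambda>b. mul b (coeff (pCons c w) i)) ((var_plus D ^^ i) q))"
    by (rule twist_eq_sum) (simp_all add: assms degree_pCons_le)
  then show ?thesis
    by (simp only: sum.atMost_Suc_shift twist_def) (simp add: funpow_swap1)
qed

context differential_algebra
begin

lemma additive_D: "additive D"
  using D_linear by (simp add: additive_def Vector_Spaces.linear_iff)

lemma D_zero [simp]: "D 0 = 0"
  by (rule additive.zero[OF additive_D])

lemma D_one [simp]: "D 1 = 0"
  using D_mult[of 1 1] by simp

lemma D_scale_one [simp]: "D (scA c 1) = 0"
  using D_linear by (simp add: Vector_Spaces.linear_iff)

lemma var_plus_const: "var_plus D [:a:] = [:D a, a:]"
  by (simp add: var_plus_def map_poly_pCons)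

lemma var_plus_pCons_0: "var_plus D (pCons 0 q) = pCons 0 (var_plus D q)"
  by (simp add: var_plus_def map_poly_pCons)

lemma adj_symbol_const: "adj_symbol D [:a:] = [:a:]"
  by (simp add: adj_symbol_def)

lemma adj_symbol_pCons: "adj_symbol D (pCons a P) = [:a:] - var_plus D (adj_symbol D P)"
proof -
  have "additive (\<lambda>p. - var_plus D p)"
    using additive_var_plus[OF additive_D] by (simp add: additive_def)
  then show ?thesis
    unfolding adj_symbol_def by (subst psubst_pCons) simp_all
qed

lemma dop_mult_var: "dop_mult D [:0, 1:] Q = var_plus D Q"
proof -
  have "dop_mult D [:0, 1:] Q = map_poly ((*) 0) Q + map_poly ((*) 1) (var_plus D Q)"
    by (simp add: dop_mult_def symbol_shift_def)
  then show ?thesis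
    by (simp add: poly_eq_iff coeff_map_poly)
qed

lemma dop_mult_var_right: "dop_mult D P [:0, 1:] = pCons 0 P"
proof -
  have pow: "(var_plus D ^^ i) [:0, 1:] = monom 1 (Suc i)" for i
  proof (induction i)
    case (Suc i)
    have "var_plus D (monom 1 n) = monom 1 (Suc n)" for n
      by (simp add: var_plus_def map_poly_monom monom_Suc)
    with Suc show ?case
      by simp
  qed (simp add: monom_Suc)
  have "dop_mult D P [:0, 1:] = (\<Sum>i\<le>degree P. pCons 0 (monom (coeff P i) i))"
    unfolding dop_mult_def symbol_shift_def pow
    by (intro sum.cong refl) (simp add: map_poly_monom monom_Suc map_poly_pCons)
  also have "\<dots> = pCons 0 P"
    by (simp add: poly_as_sum_of_monoms flip: additive.sum[OF additive_pCons_0])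
  finally show ?thesis .
qed

end

context dop_module
begin

abbreviation "mul \<equiv> mod_mul act"
abbreviation "dmod \<equiv> mod_D act"

lemma act_zero_left [simp]: "act 0 u = 0"
  using act_add_left[of 0 0 u] by simp

lemma additive_mul: "additive (mul a)"
  by (simp add: additive_def mod_mul_def act_add_right)

lemma additive_mul_left: "additive (\<lambda>a. mul a u)"
  by (simp add: additive_def mod_mul_def flip: act_add_left)

lemma mul_zero [simp]: "mul a 0 = 0" "mul 0 u = 0"
  by (rule additive.zero[OF additive_mul], simp add: mod_mul_def)

lemma mul_one [simp]: "mul 1 u = u"
  using act_one by (simp add: mod_mul_def one_pCons)

lemma additive_dmod: "additive dmod"
  by (simp add: additive_def mod_D_def act_add_right)

lemma act_pCons: "act (pCons a P) u = mul a u + act P (dmod u)"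
proof -
  have "act (pCons a P) u = act [:a:] u + act (dop_mult D P [:0, 1:]) u"
    unfolding dop_mult_var_right act_add_left[symmetric] by simp
  then show ?thesis
    by (simp add: act_mult mod_mul_def mod_D_def)
qed

lemma dmod_mul: "dmod (mul a u) = mul a (dmod u) + mul (D a) u"
proof -
  have "dmod (mul a u) = act [:D a, a:] u"
    by (simp add: mod_D_def mod_mul_def dop_mult_var var_plus_const flip: act_mult)
  then show ?thesis
    by (simp add: act_pCons)
qed

lemma mod_scale_eq_mul: "mod_scale scA act c = mul (scA c 1)"
  by (simp add: mod_scale_def mod_mul_def fun_eq_iff)

lemma additive_mpoly_mul: "additive (mpoly_mul mul i q)"
  by (auto simp: additive_def mpoly_mul_def additive.add[OF additive_map[OF additive_mul]]
      psubst_add_fun[OF additive_mvar])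

lemma map_mul_add: "Poly_Mapping.map (mul (a + b)) p = Poly_Mapping.map (mul a) p + Poly_Mapping.map (mul b) p"
  by (simp add: poly_mapping_eq_iff fun_eq_iff lookup_add lookup_map_0
      additive.add[OF additive_mul_left])

lemma additive_map_mul_left: "additive (\<lambda>a. Poly_Mapping.map (mul a) p)"
  by (simp add: additive_def map_mul_add)

lemma additive_mpoly_mul_left: "additive (\<lambda>q. mpoly_mul mul i q p)"
  unfolding mpoly_mul_def by (rule additive_psubst[OF additive_mvar additive_map_mul_left])

lemma mpoly_mul_pCons_0: "mpoly_mul mul i (pCons 0 q) p = mvar i (mpoly_mul mul i q p)"
  unfolding mpoly_mul_def
  by (subst psubst_pCons[where g="\<lambda>a. Poly_Mapping.map (mul a) p", OF additive_mvar additive.zero[OF additive_map_mul_left]])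
    (simp add: additive.zero[OF additive_map_mul_left])

lemma mpoly_mul_mvar: "mpoly_mul mul i q (mvar j p) = mvar j (mpoly_mul mul i q p)"
  unfolding mpoly_mul_def map_mvar[OF additive_mul]
  by (simp only: psubst_hom[where S="mvar j" and T="mvar i" and T'="mvar i", OF additive_mvar mvar_commute])

lemma mpoly_mul_const: "mpoly_mul mul i [:a:] p = Poly_Mapping.map (mul a) p"
  by (simp add: mpoly_mul_def)

text \<open>
  \<open>om i q\<close> is the part of \<^const>\<open>multi_twist\<close> that concerns the variable \<open>\<lambda>\<^sub>i\<close>, with the adjoint symbol
  replaced by an arbitrary \<open>q\<close>. It is characterised by \<open>om i q \<circ> \<lambda>\<^sub>i = om i ((\<lambda> + \<partial>) q)\<close>, so it is the
  substitution of \<open>F \<mapsto> F \<circ> (\<lambda> + \<partial>)\<close> for \<open>\<lambda>\<^sub>i\<close>, acting on functions \<open>F\<close> of \<open>q\<close>.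
\<close>

definition om_op :: "nat \<Rightarrow> nat \<Rightarrow> ('a poly \<Rightarrow> 'u mpoly) \<Rightarrow> 'a poly \<Rightarrow> 'u mpoly" where
  "om_op i j F q = (if j = i then F (var_plus D q) else mvar j (F q))"

definition om :: "nat \<Rightarrow> 'a poly \<Rightarrow> 'u mpoly \<Rightarrow> 'u mpoly" where
  "om i q p = gsubst (om_op i) (\<lambda>m q. mpoly_mul mul i q (mconst m)) p q"

lemma commuting_om_op: "commuting (om_op i)"
  by (auto simp: commuting_def additive_def fun_eq_iff om_op_def
      mvar_commute)

lemma additive_om_start: "additive (\<lambda>m q. mpoly_mul mul i q (mconst m))"
  by (simp add: additive_def fun_eq_iff additive.add[OF additive_mconst] additive.add[OF additive_mpoly_mul])

lemma additive_om: "additive (om i q)"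
  by (simp add: additive_def om_def additive.add[OF additive_gsubst[OF commuting_om_op additive_om_start]])

lemmas om_additive [simp] = additive.add[OF additive_om] additive.zero[OF additive_om]
  additive.minus[OF additive_om] additive.diff[OF additive_om]

lemma om_mconst: "om i q (mconst m) = mpoly_mul mul i q (mconst m)"
  by (simp add: om_def gsubst_mconst[OF commuting_om_op additive_om_start])

lemma om_mvar: "om i q (mvar j p) = (if j = i then om i (var_plus D q) p else mvar j (om i q p))"
  unfolding om_def gsubst_mvar[OF commuting_om_op additive_om_start] by (simp add: om_op_def)

lemma om_add_left: "om i (q + r) p = om i q p + om i r p"
proof (induction p arbitrary: q r rule: mpoly_induct_all)
  case (var j p)
  then show ?case
    by (simp add: om_mvar additive.add[OF additive_var_plus[OF additive_D]])
qed (simp_all add: om_mconst additive.add[OF additive_mpoly_mul_left])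

lemma additive_om_left: "additive (\<lambda>q. om i q p)"
  by (simp add: additive_def om_add_left)

lemma om_pCons_0: "om i (pCons 0 q) p = mvar i (om i q p)"
  by (induction p arbitrary: q rule: mpoly_induct_all)
    (simp_all add: om_mvar var_plus_pCons_0 mvar_commute
      om_mconst mpoly_mul_pCons_0)

lemma om_var_plus: "om i (var_plus D q) p = mvar i (om i q p) + om i (map_poly D q) p"
  by (simp add: var_plus_def om_add_left om_pCons_0)

text \<open>The symbol \<open>q\<close> is shifted only when a factor of the variable
  \<open>i\<close> is passed.\<close>

lemma om_free: "p \<in> mpolys_on V \<Longrightarrow> i \<notin> V \<Longrightarrow> om i q p = mpoly_mul mul i q p"
proof (induction p rule: mpoly_induct)
  case (var j p)
  then have "j \<noteq> i"
    by auto
  with var show ?case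
    by (simp add: om_mvar mpoly_mul_mvar)
qed (simp_all add: additive.add[OF additive_mpoly_mul] om_mconst)

lemma om_lvar: "i \<notin># W \<Longrightarrow> om i q (lvar W p) = lvar W (om i q p)"
proof (induction W)
  case (add j W)
  then have "j \<noteq> i"
    by auto
  with add show ?case
    by (simp add: lvar_add_mset om_mvar)
qed simp

lemma map_dmod_om: "Poly_Mapping.map dmod (om i q p) =
    om i q (Poly_Mapping.map dmod p) + om i (map_poly D q) p"
proof (induction p arbitrary: q rule: mpoly_induct_all)
  case (add p r)
  then show ?case
    by (simp add: additive.add[OF additive_map[OF additive_dmod]])
next
  case (const m)
  have "Poly_Mapping.map dmod (Poly_Mapping.map (mul b) p) =
      Poly_Mapping.map (mul b) (Poly_Mapping.map dmod p) + Poly_Mapping.map (mul (D b)) p" for b and p :: "'u mpoly"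
    by (simp add: poly_mapping_eq_iff fun_eq_iff lookup_add lookup_map_0 dmod_mul
        additive.zero[OF additive_dmod])
  then have "Poly_Mapping.map dmod (mpoly_mul mul i q p) =
      mpoly_mul mul i q (Poly_Mapping.map dmod p) + mpoly_mul mul i (map_poly D q) p" for p
    unfolding mpoly_mul_def psubst_map_poly[where g="\<lambda>b. Poly_Mapping.map (mul b) p" and h=D,
        OF additive_mvar additive.zero[OF additive_map_mul_left] D_zero]
    by (simp add: psubst_hom[where S="Poly_Mapping.map dmod" and T="mvar i" and T'="mvar i",
        OF additive_map[OF additive_dmod] map_mvar[OF additive_dmod]] psubst_add_fun[OF additive_mvar])
  then show ?case
    by (simp add: om_mconst map_mconst[OF additive_dmod])
next
  case (var j p)
  have "map_poly D (var_plus D q) = var_plus D (map_poly D q)" for q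
    by (simp add: var_plus_def additive.add[OF additive_map_poly[OF additive_D]] map_poly_pCons)
  with var show ?case
    by (simp add: om_mvar map_mvar[OF additive_dmod])
qed

text \<open>Differentiating coefficients costs a term with \<partial>q, and passing the variable
  \<open>i\<close> produces the same term with the opposite sign. They cancel when \<open>i\<close>
  occurs once in \<open>W\<close>, and so the twist descends to the quotients.\<close>

lemma om_total:
  assumes "count W i = 1"
  shows "om i q (Poly_Mapping.map dmod p + lvar W p) =
    Poly_Mapping.map dmod (om i q p) + lvar W (om i q p)"
proof -
  from assms obtain V where W: "W = add_mset i V"
    by (metis count_eq_zero_iff multi_member_split zero_neq_one)
  with assms have "i \<notin># V"
    by (simp add: count_eq_zero_iff)
  then show ?thesis
    by (simp add: W lvar_add_mset om_mvar om_var_plus om_lvar map_dmod_om)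
qed

lemma om_one: "om i [:1:] p = p"
  by (induction p rule: mpoly_induct_all)
    (simp_all add: om_mconst mpoly_mul_const map_mconst[OF additive_mul]
      om_mvar var_plus_const om_pCons_0)

lemma om_scalar: "D a = 0 \<Longrightarrow> om i [:a:] p = Poly_Mapping.map (mul a) p"
  by (induction p rule: mpoly_induct_all)
    (simp_all add: om_mconst mpoly_mul_const map_mconst[OF additive_mul]
      om_mvar var_plus_const om_pCons_0 additive.add[OF additive_map[OF additive_mul]] map_mvar[OF additive_mul])

lemma om_const_mvar: "om i [:a:] (mvar j p) =
    mvar j (om i [:a:] p) + (if j = i then om i [:D a:] p else 0)"
  by (simp add: om_mvar om_var_plus map_poly_pCons)

text \<open>Connects the twist in the module axiom, in one anonymous variable, with the operator for
  the variable \<open>i\<close> of a polynomial in several.\<close>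

lemma psubst_mvar_twist:
  "psubst (mvar i) mconst (twist D mul q w) = om i q (psubst (mvar i) mconst w)"
proof (induction w arbitrary: q)
  case 0
  then show ?case
    by (simp add: twist_zero additive.zero[OF additive_mconst]
        psubst_0[where g=mconst])
next
  case (pCons c w)
  have "psubst (mvar i) mconst (map_poly (\<lambda>b. mul b c) q) = mpoly_mul mul i q (mconst c)"
    by (simp add: psubst_map_poly[where g=mconst and h="\<lambda>b. mul b c", OF additive_mvar additive.zero[OF additive_mconst]]
        mpoly_mul_def map_mconst[OF additive_mul])
  then show ?case
    by (simp add: twist_pCons psubst_add[OF additive_mvar additive_mconst] pCons.IH
        psubst_pCons[where g=mconst, OF additive_mvar additive.zero[OF additive_mconst]]
        om_mconst om_mvar)
qed

lemma twist_add_left: "twist D mul (q + r) w = twist D mul q w + twist D mul r w"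
  by (induction w arbitrary: q r)
    (simp_all add: twist_zero twist_pCons additive.add[OF additive_map_poly[OF additive_mul_left]]
      additive.add[OF additive_var_plus[OF additive_D]])

lemma twist_pCons_0: "twist D mul (pCons 0 q) w = pCons 0 (twist D mul q w)"
  by (induction w arbitrary: q)
    (simp_all add: twist_zero twist_pCons var_plus_pCons_0 map_poly_pCons)

lemma twist_one: "twist D mul [:1:] w = w"
  by (induction w)
    (simp_all add: twist_zero twist_pCons var_plus_const twist_pCons_0 map_poly_pCons)

lemma twist_adj_var: "twist D mul (adj_symbol D [:0, 1:]) w = - pCons 0 w"
proof -
  have adj: "adj_symbol D [:0, 1:] = - pCons 0 [:1:]"
    by (simp add: adj_symbol_pCons[of 0 "[:1:]"] adj_symbol_const var_plus_const)
  have "additive (\<lambda>q. twist D mul q w)"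
    by (simp add: additive_def twist_add_left)
  then have "twist D mul (adj_symbol D [:0, 1:]) w = - twist D mul (pCons 0 [:1:]) w"
    unfolding adj by (rule additive.minus)
  then show ?thesis
    by (simp only: twist_pCons_0 twist_one)
qed

end

section \<open>The Cartan calculus of a Lie conformal algebroid module\<close>

lemma linear_additive: "Vector_Spaces.linear s t f \<Longrightarrow> additive f"
  by (simp add: additive_def Vector_Spaces.linear_iff)

lemma symbol_shift_const:
  "(\<And>a. mul a 0 = 0) \<Longrightarrow> symbol_shift mul d [:a:] w = map_poly (mul a) w"
  by (simp add: symbol_shift_def)

lemma anchor_term_const: "anchor_term mul d t [:a:] v = map_poly (\<lambda>b. mul b v) (t a)"
  by (simp add: anchor_term_def)

context lie_conformal_algebroid
begin

lemma additive_anchor: "additive (\<theta> u)"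
  using anchor_CDer[of u] by (auto simp: CDer_def intro: linear_additive)

lemma anchor_D: "\<theta> u (D a) = var_plus D (\<theta> u a)"
  using anchor_CDer[of u] by (simp add: CDer_def)

lemma anchor_one: "\<theta> u 1 = 0"
proof -
  have "\<theta> u (1 * 1) = smult 1 (\<theta> u 1) + smult 1 (\<theta> u 1)"
    using anchor_CDer[of u] unfolding CDer_def by blast
  then show ?thesis
    by simp
qed

lemma br_mul: "br u (A.mul a v) = map_poly (A.mul a) (br u v) + map_poly (\<lambda>b. A.mul b v) (\<theta> u a)"
  unfolding mod_mul_def[of actE a v] br_act by (simp add: symbol_shift_const anchor_term_const)

end

context lie_conformal_algebroid_module
begin

lemma additive_lact_left: "additive (\<lambda>u. lact u m)"
  and additive_lact: "additive (lact u)"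
  using lact_linear_left[of m] lact_linear_right[of u] by (auto dest!: linear_additive)

lemma lact_mul: "lact u (M.mul a m) = map_poly (M.mul a) (lact u m) + map_poly (\<lambda>b. M.mul b m) (\<theta> u a)"
  unfolding mod_mul_def[of actM a m] lact_act_right by (simp add: symbol_shift_const anchor_term_const)

text \<open>The symbol of \<partial> has coefficients 0 and 1, on which the anchor vanishes, so no
  anchor term is left.\<close>

lemma lact_dmod: "lact u (M.dmod m) = var_plus M.dmod (lact u m)"
proof -
  have "lact u (M.dmod m) = (\<Sum>i\<le>Suc 0. map_poly (M.mul (coeff [:0, 1:] i)) ((var_plus M.dmod ^^ i) (lact u m)))
     + (\<Sum>i\<le>Suc 0. map_poly (\<lambda>b. M.mul b ((M.dmod ^^ i) m)) (\<theta> u (coeff [:0, 1:] i)))"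
    unfolding mod_D_def lact_act_right symbol_shift_def anchor_term_def mod_mul_def by simp
  then show ?thesis
    by (simp add: E.anchor_one additive.zero[OF E.additive_anchor] poly_eq_iff coeff_map_poly)
qed

definition actv :: "'e \<Rightarrow> nat multiset \<Rightarrow> 'm mpoly \<Rightarrow> 'm mpoly" where
  "actv u W = gsubst mvar (\<lambda>m. psubst (lvar W) mconst (lact u m))"

lemma additive_lact_subst: "additive (\<lambda>m. psubst (lvar W) mconst (lact u m))"
  by (rule additive_comp[OF additive_psubst[OF additive_lvar additive_mconst] additive_lact])

lemma additive_actv: "additive (actv u W)"
  unfolding actv_def by (rule additive_gsubst[OF commuting_mvar additive_lact_subst])

lemmas actv_additive [simp] = additive.add[OF additive_actv] additive.zero[OF additive_actv]
  additive.minus[OF additive_actv] additive.diff[OF additive_actv]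

lemma actv_mconst: "actv u W (mconst m) = psubst (lvar W) mconst (lact u m)"
  unfolding actv_def by (rule gsubst_mconst[OF commuting_mvar additive_lact_subst])

lemma actv_mvar: "actv u W (mvar i v) = mvar i (actv u W v)"
  unfolding actv_def by (rule gsubst_mvar[OF commuting_mvar additive_lact_subst])

lemma actv_lvar: "actv u W (lvar V v) = lvar V (actv u W v)"
  by (rule lvar_hom[OF additive_actv actv_mvar])

lemma psubst_lvar_mvar: "psubst (lvar W) (\<lambda>c. mvar i (g c)) p = mvar i (psubst (lvar W) g p)"
  by (simp only: psubst_hom[where S="mvar i" and T="lvar W" and T'="lvar W", OF additive_mvar lvar_mvar[symmetric]])

lemma gsubst_psubst:
  assumes "commuting \<tau>" "additive g"
    and "\<And>x. gsubst \<tau> g (T x) = T' (gsubst \<tau> g x)"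
  shows "gsubst \<tau> g (psubst T f p) = psubst T' (\<lambda>c. gsubst \<tau> g (f c)) p"
  by (rule psubst_hom[where S="gsubst \<tau> g" and T=T and T'=T', OF additive_gsubst[OF assms(1,2)] assms(3)])

text \<open>Most rules for \<open>actv\<close> are reduced to constants by induction on polynomials.
  The identities with brackets come from the two-variable axioms by inserting linear forms for
  \<lambda> and \<mu>.\<close>

sublocale C: leibniz_diff br lvar actv "mod_D actE" "Poly_Mapping.map (mod_D actM) :: 'm mpoly \<Rightarrow> 'm mpoly"
proof
  fix u v w :: 'e and T R :: "nat multiset" and x y :: "'m mpoly" and g :: "'e \<Rightarrow> 'm mpoly"
  show "br (u + v) w = br u w + br v w"
    using linear_additive[OF E.L.br_linear_left[of w]] by (rule additive.add)
  show "br u (v + w) = br u v + br u w"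
    using linear_additive[OF E.L.br_linear_right[of u]] by (rule additive.add)
  show "lvar (T + R) x = lvar T x + lvar R x"
    by (rule lvar_add_left)
  show "lvar T (x + y) = lvar T x + lvar T y"
    by (rule additive.add[OF additive_lvar])
  show "lvar T (lvar R x) = lvar R (lvar T x)"
    by (rule lvar_commute)
  show "actv (u + v) T x = actv u T x + actv v T x"
    by (induction x rule: mpoly_induct_all)
      (simp_all add: actv_mconst additive.add[OF additive_lact_left]
        additive.add[OF additive_psubst[OF additive_lvar additive_mconst]] actv_mvar)
  show "actv u T (x + y) = actv u T x + actv u T y"
    by (rule additive.add[OF additive_actv])
  show "actv u T (lvar R x) = lvar R (actv u T x)"
    by (rule actv_lvar)
  show "psubst (lvar T) (\<lambda>e. actv e (T + R) x) (br u v) = actv u T (actv v R x) - actv v R (actv u T x)"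
  proof (induction x rule: mpoly_induct_all)
    case (add p q)
    then show ?case
      by (simp add: psubst_add_fun[OF additive_lvar])
  next
    case (const m)
    \<comment> \<open>Here \<lambda> becomes \<open>T\<close> and \<mu> becomes
      \<open>T + R\<close>, so that \<mu> - \<lambda> becomes \<open>R\<close>.\<close>
    define \<tau> :: "nat \<Rightarrow> 'm mpoly \<Rightarrow> 'm mpoly" where "\<tau> i = lvar (if i = 0 then T else T + R)" for i :: nat
    have \<tau>: "commuting \<tau>"
      unfolding \<tau>_def by (rule commuting_lvar)
    note gs = gsubst_psubst[OF \<tau> additive_mconst, where T="mvar i" and T'="lvar (if i = 0 then T else T + R)" for i]
      gsubst_psubst[OF \<tau> additive_mconst, where T="\<lambda>p. mvar (Suc 0) p - mvar 0 p" and T'="lvar R"]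
    note ms = gsubst_mvar[OF \<tau> additive_mconst] gsubst_mconst[OF \<tau> additive_mconst]
      additive.diff[OF additive_gsubst[OF \<tau> additive_mconst]]
    have \<tau>_simps: "\<tau> i = lvar (if i = 0 then T else T + R)" for i
      by (simp add: \<tau>_def fun_eq_iff)
    have a: "actv a V (psubst (lvar W) mconst q) = psubst (lvar W) (\<lambda>n. psubst (lvar V) mconst (lact a n)) q" for a V W q
      by (simp only: psubst_hom[where S="actv a V" and T="lvar W" and T'="lvar W", OF additive_actv actv_lvar] actv_mconst)
    from arg_cong[OF lact_br[of m u v], of "gsubst \<tau> mconst"] show ?case
      by (simp add: gs ms \<tau>_simps lvar_add_left actv_mconst a)
  next
    case (var i p)
    then show ?case
      by (simp add: actv_mvar psubst_lvar_mvar)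
  qed
  show "psubst (lvar R) (\<lambda>e. psubst (lvar T) g (br u e)) (br v w) - psubst (lvar T) (\<lambda>e. psubst (lvar R) g (br v e)) (br u w)
      = psubst (lvar T) (\<lambda>e. psubst (lvar (T + R)) g (br e w)) (br u v)" if g: "additive g"
  proof -
    \<comment> \<open>Now \<lambda> becomes \<open>T\<close>, \<mu> becomes \<open>R\<close>, and a
      constant \<open>e\<close> is sent to \<open>g e\<close>; this substitution is additive because
      \<open>g\<close> is.\<close>
    define \<tau> :: "nat \<Rightarrow> 'm mpoly \<Rightarrow> 'm mpoly" where "\<tau> i = lvar (if i = 0 then T else R)" for i :: nat
    have \<tau>: "commuting \<tau>"
      unfolding \<tau>_def by (rule commuting_lvar)
    note gs = gsubst_psubst[OF \<tau> g, where T="mvar i" and T'="lvar (if i = 0 then T else R)" for i]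
      gsubst_psubst[OF \<tau> g, where T="\<lambda>p. mvar 0 p + mvar (Suc 0) p" and T'="lvar (T + R)"]
    note ms = gsubst_mvar[OF \<tau> g] gsubst_mconst[OF \<tau> g] additive.diff[OF additive_gsubst[OF \<tau> g]]
      additive.add[OF additive_gsubst[OF \<tau> g]]
    have \<tau>_simps: "\<tau> i = lvar (if i = 0 then T else R)" for i
      by (simp add: \<tau>_def fun_eq_iff)
    from arg_cong[OF E.L.br_jacobi[of u v w], of "gsubst \<tau> g"] show ?thesis
      by (simp add: gs ms \<tau>_simps lvar_add_left)
  qed
  show "mod_D actE (u + v) = mod_D actE u + mod_D actE v"
    by (rule additive.add[OF E.A.additive_dmod])
  show "Poly_Mapping.map (mod_D actM) (x + y) = Poly_Mapping.map (mod_D actM) x + Poly_Mapping.map (mod_D actM) y"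
    by (rule additive.add[OF additive_map[OF M.additive_dmod]])
  show dv_lvar: "Poly_Mapping.map (mod_D actM) (lvar T x) = lvar T (Poly_Mapping.map (mod_D actM) x)" for T x
    by (rule lvar_hom[OF additive_map[OF M.additive_dmod] map_mvar[OF M.additive_dmod]])
  show "actv u T (Poly_Mapping.map (mod_D actM) x) = Poly_Mapping.map (mod_D actM) (actv u T x) + lvar T (actv u T x)"
  proof (induction x rule: mpoly_induct_all)
    case (add p q)
    then show ?case
      by (simp add: additive.add[OF additive_map[OF M.additive_dmod]])
  next
    case (const m)
    show ?case
      by (simp add: map_mconst[OF M.additive_dmod] actv_mconst lact_dmod
          psubst_var_plus[OF additive_lvar additive_mconst M.additive_dmod]
          psubst_hom[where S="Poly_Mapping.map (mod_D actM)" and T="lvar T" and T'="lvar T",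
            OF additive_map[OF M.additive_dmod] dv_lvar])
  next
    case (var i p)
    then show ?case
      by (simp add: actv_mvar map_mvar[OF M.additive_dmod] lvar_mvar)
  qed
  show "actv (mod_D actE u) T x = - lvar T (actv u T x)"
  proof (induction x rule: mpoly_induct_all)
    case (add p q)
    then show ?case
      by simp
  next
    case (const m)
    have "lact (mod_D actE u) m = - pCons 0 (lact u m)"
      by (simp only: mod_D_def lact_act_left M.twist_adj_var)
    then show ?case
      by (simp add: actv_mconst psubst_pCons[where g=mconst, OF additive_lvar additive.zero[OF additive_mconst]]
          additive.minus[OF additive_psubst[OF additive_lvar additive_mconst]] additive.zero[OF additive_mconst]
          del: minus_pCons)
  next
    case (var i p)
    then show ?case
      by (simp add: actv_mvar lvar_mvar)
  qed
  show "br (mod_D actE u) v = - pCons 0 (br u v)"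
    by (rule E.L.br_dE_left)
  show "br u (mod_D actE v) = var_plus (mod_D actE) (br u v)"
    by (rule E.L.br_dE_right)
  show "br v u = - psubst (\<lambda>p. - var_plus (mod_D actE) p) (\<lambda>e. [:e:]) (br u v)"
    by (rule E.L.br_skew)
qed

section \<open>Multiplication by elements of A and the anchor\<close>

definition shift_var :: "nat \<Rightarrow> nat multiset \<Rightarrow> 'm mpoly \<Rightarrow> 'm mpoly" where
  "shift_var i W = gsubst (\<lambda>j. lvar (if j = i then add_mset i W else {#j#})) mconst"

lemma additive_shift_var: "additive (shift_var i W)"
  unfolding shift_var_def by (rule additive_gsubst[OF commuting_lvar additive_mconst])

lemma shift_var_mconst: "shift_var i W (mconst m) = mconst m"
  unfolding shift_var_def by (rule gsubst_mconst[OF commuting_lvar additive_mconst])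

lemma shift_var_mvar: "shift_var i W (mvar j v) = mvar j (shift_var i W v) + (if j = i then lvar W (shift_var i W v) else 0)"
  unfolding shift_var_def gsubst_mvar[OF commuting_lvar additive_mconst] by (simp add: lvar_add_mset)

text \<open>The derivation property of the action in several variables. As the anchor of u turns
  \<partial> into \<partial> + W, a power of \<lambda>_i + \<partial> applied to \<open>a\<close>
  becomes a power of \<lambda>_i + W + \<partial> applied to the anchor term. Hence the variable
  \<open>i\<close> is shifted by \<open>W\<close> there.\<close>

lemma actv_om:
  assumes "i \<notin># W"
  shows "actv u W (M.om i [:a:] v) = M.om i [:a:] (actv u W v)
    + psubst (lvar W) (\<lambda>b. M.om i [:b:] (shift_var i W v)) (\<theta> u a)"
proof (induction v arbitrary: a rule: mpoly_induct_all)
  case (add p q)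
  then show ?case
    by (simp add: additive.add[OF additive_shift_var] psubst_add_fun[OF additive_lvar])
next
  case (const m)
  have om: "M.om i [:a:] (psubst (lvar W) mconst q) = psubst (lvar W) (\<lambda>n. mconst (M.mul a n)) q" for a q
    by (simp add: psubst_hom[where S="M.om i [:a:]" and T="lvar W" and T'="lvar W", OF M.additive_om M.om_lvar[OF assms]]
        M.om_mconst M.mpoly_mul_const map_mconst[OF M.additive_mul])
  have "actv u W (M.om i [:a:] (mconst m)) = psubst (lvar W) mconst (lact u (M.mul a m))"
    by (simp add: M.om_mconst M.mpoly_mul_const map_mconst[OF M.additive_mul] actv_mconst)
  also have "\<dots> = psubst (lvar W) (\<lambda>n. mconst (M.mul a n)) (lact u m)
      + psubst (lvar W) (\<lambda>b. mconst (M.mul b m)) (\<theta> u a)"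
    unfolding lact_mul psubst_add[OF additive_lvar additive_mconst]
    by (simp add: psubst_map_poly[where g=mconst and h="M.mul a", OF additive_lvar additive.zero[OF additive_mconst]]
        psubst_map_poly[where g=mconst and h="\<lambda>b. M.mul b m", OF additive_lvar additive.zero[OF additive_mconst]])
  finally show ?case
    by (simp add: actv_mconst om shift_var_mconst M.om_mconst M.mpoly_mul_const map_mconst[OF M.additive_mul])
next
  case (var j v)
  have h: "additive (\<lambda>b. M.om i [:b:] w)" for w
    using additive_comp[OF M.additive_om_left additive_const_poly] .
  show ?case
    using var(3)[of a] var(3)[of "D a"]
    by (simp add: actv_mvar M.om_const_mvar shift_var_mvar
        M.om_lvar[OF assms] E.anchor_D
        psubst_var_plus[where g="\<lambda>b. M.om i [:b:] w" for w, OF additive_lvar h E.A.additive_D]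
        psubst_add_fun[OF additive_lvar] psubst_lvar_mvar C.psubst_lop_hom[OF additive_lvar lvar_commute]
        psubst_zero_fun[OF additive_lvar]
        add_ac)
qed

text \<open>\<open>om i\<close> also twists occurrences of the variable \<open>i\<close> in
  \<open>v\<close>. When there are none, only the variable of the action is twisted, as in the
  module axiom.\<close>

lemma actv_mul:
  assumes "v \<in> mpolys_on V" "i \<notin> V"
  shows "actv (E.A.mul a u) {#i#} v = M.om i [:a:] (actv u {#i#} v)"
  using assms(1)
proof (induction v rule: mpoly_induct)
  case (add p q)
  then show ?case
    by simp
next
  case (const m)
  show ?case
    unfolding actv_mconst lvar_eq_mvar mod_mul_def[of actE a u] lact_act_left E.A.adj_symbol_const
    by (rule M.psubst_mvar_twist)
next
  case (var j p)
  then have "j \<noteq> i"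
    using assms(2) by auto
  with var show ?case
    by (simp add: actv_mvar M.om_const_mvar)
qed

end

section \<open>Evaluation of cochains at linear forms\<close>

lemma lvar_sum: "lvar (sum f A) p = (\<Sum>a\<in>A. lvar (f a) p)"
  by (induction A rule: infinite_finite_induct) (simp_all add: lvar_add_left)

definition sum_labels :: "(nat \<Rightarrow> nat multiset) \<Rightarrow> nat multiset \<Rightarrow> nat multiset" where
  "sum_labels \<sigma> W = (\<Sum>i\<in>#W. \<sigma> i)"

lemma sum_labels_simps [simp]: "sum_labels \<sigma> {#} = {#}" "sum_labels \<sigma> {#i#} = \<sigma> i"
    "sum_labels \<sigma> (V + W) = sum_labels \<sigma> V + sum_labels \<sigma> W"
    "sum_labels \<sigma> (add_mset i W) = \<sigma> i + sum_labels \<sigma> W"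
  by (simp_all add: sum_labels_def)

lemma gsubst_lvar:
  assumes "additive g"
  shows "gsubst (\<lambda>i. lvar (\<sigma> i)) g (lvar W p) = lvar (sum_labels \<sigma> W) (gsubst (\<lambda>i. lvar (\<sigma> i)) g p)"
  by (induction W) (simp_all add: lvar_add_mset lvar_add_left additive.zero[OF additive_gsubst[OF commuting_lvar assms]]
      additive.add[OF additive_gsubst[OF commuting_lvar assms]] gsubst_mvar[OF commuting_lvar assms])

lemma commuting_nth_lvar: "commuting (nth_op (map lvar Ws))"
  by (rule commuting_nth_op) (auto simp: additive_lvar lvar_commute)

lemma gsubst_nth_lvar_basic:
  fixes p :: "'x::ab_group_add mpoly"
  shows "gsubst (nth_op (map lvar Ws)) mconst (lvar (mset [0..<length Ws]) p) =
    lvar (sum_list Ws) (gsubst (nth_op (map lvar Ws)) mconst p)"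
proof -
  let ?G = "gsubst (nth_op (map lvar Ws)) mconst :: 'x mpoly \<Rightarrow> 'x mpoly"
  have "lvar (mset [0..<length Ws]) p = (\<Sum>i<length Ws. mvar i p)"
    unfolding lvar_def mset_map[symmetric] sum_mset_sum_list by (simp add: sum_list_sum_nth atLeast0LessThan)
  then have "?G (lvar (mset [0..<length Ws]) p) = (\<Sum>i<length Ws. lvar (Ws ! i) (?G p))"
    by (simp add: additive.sum[OF additive_gsubst[OF commuting_nth_lvar additive_mconst]]
        gsubst_mvar[OF commuting_nth_lvar additive_mconst] nth_op_def)
  also have "\<dots> = lvar (sum_list Ws) (?G p)"
    by (simp add: sum_list_sum_nth atLeast0LessThan lvar_sum)
  finally show ?thesis .
qed

lemma map_gsubst:
  fixes f :: "'x::ab_group_add \<Rightarrow> 'x"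
  assumes "commuting \<tau>" "additive f" "\<And>i p. Poly_Mapping.map f (\<tau> i p) = \<tau> i (Poly_Mapping.map f p)"
  shows "Poly_Mapping.map f (gsubst \<tau> mconst p) = gsubst \<tau> mconst (Poly_Mapping.map f p)"
  by (rule mpoly_hom_eqI[OF mpolys_on_UNIV])
    (simp_all add: additive_comp additive_map assms additive_gsubst[OF _ additive_mconst] map_mconst
      gsubst_mconst[OF _ additive_mconst] gsubst_mvar[OF _ additive_mconst] map_mvar)

type_synonym 'e slots = "('e \<times> nat multiset) list"

abbreviation relabel :: "(nat \<Rightarrow> nat multiset) \<Rightarrow> 'x::ab_group_add mpoly \<Rightarrow> 'x mpoly" where
  "relabel \<sigma> \<equiv> gsubst (\<lambda>i. lvar (\<sigma> i)) mconst"

abbreviation eval_at :: "nat multiset list \<Rightarrow> 'x::ab_group_add mpoly \<Rightarrow> 'x mpoly" where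
  "eval_at Ws \<equiv> gsubst (nth_op (map lvar Ws)) mconst"

abbreviation rename :: "nat \<Rightarrow> (nat \<Rightarrow> nat) \<Rightarrow> 'x::ab_group_add mpoly \<Rightarrow> 'x mpoly" where
  "rename k \<pi> \<equiv> gsubst (nth_op (map mvar (map \<pi> [0..<k]))) mconst"

lemmas additive_relabel = additive_gsubst[OF commuting_lvar additive_mconst]
  and relabel_mconst = gsubst_mconst[OF commuting_lvar additive_mconst]
  and relabel_mvar = gsubst_mvar[OF commuting_lvar additive_mconst]
  and relabel_lvar = gsubst_lvar[OF additive_mconst]
  and additive_eval_at = additive_gsubst[OF commuting_nth_lvar additive_mconst]
  and eval_at_mvar = gsubst_mvar[OF commuting_nth_lvar additive_mconst]

context lie_conformal_algebroid_module
begin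

abbreviation "basic_wt k \<equiv> mset [0..<k]"
abbreviation "beqv k \<equiv> C.eqv (basic_wt k)"
abbreviation "dformula \<equiv> diff_formula scA br actM lact"
abbreviation "qad \<equiv> qadd (mod_D actM)"
abbreviation "qsc \<equiv> qscale (mod_scale scA actM) (mod_D actM)"
abbreviation "om_adj as \<equiv> \<lambda>i. M.om i (adj_symbol D (as ! i))"

text \<open>
  The value 0 on lists of the wrong length makes multiadditivity hold for all lists.
\<close>

definition labelled :: "nat \<Rightarrow> ('e list \<Rightarrow> 'm mpoly) \<Rightarrow> 'e slots \<Rightarrow> 'm mpoly" where
  "labelled k f xs = (if length xs = k
     then eval_at (map snd xs) (f (map fst xs)) else 0)"

abbreviation "dmv \<equiv> Poly_Mapping.map (mod_D actM) :: 'm mpoly \<Rightarrow> 'm mpoly"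

lemma dmv_lvar: "dmv (lvar W p) = lvar W (dmv p)"
  by (rule C.dv_lop)

lemma dmv_nth_lvar: "dmv (nth_op (map lvar Ws) i p) = nth_op (map lvar Ws) i (dmv p)"
  by (simp add: nth_op_def dmv_lvar)

text \<open>Inserting the labels carries the sum of the variables to the sum of the labels and
  commutes with \<partial> on coefficients, so congruences in the quotient hold for all
  labels.\<close>

lemma eqv_gsubst_nth_lvar:
  assumes "C.eqv (mset [0..<length Ws]) p q"
  shows "C.eqv (sum_list Ws) (eval_at Ws p) (eval_at Ws q)"
proof -
  let ?G = "eval_at Ws :: 'm mpoly \<Rightarrow> 'm mpoly"
  have G: "additive ?G"
    by (rule additive_eval_at)
  obtain r where "p - q = dmv r + lvar (mset [0..<length Ws]) r"
    using assms by (auto simp: C.eqv_def)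
  then have "?G p - ?G q = ?G (dmv r + lvar (mset [0..<length Ws]) r)"
    by (simp flip: additive.diff[OF G])
  also have "\<dots> = dmv (?G r) + lvar (sum_list Ws) (?G r)"
    unfolding additive.add[OF G] gsubst_nth_lvar_basic
      map_gsubst[OF commuting_nth_lvar M.additive_dmod dmv_nth_lvar] ..
  finally show ?thesis
    by (rule C.eqvI)
qed

lemma eqv_labelled:
  assumes "length xs = k" "beqv k (f (map fst xs)) p"
  shows "C.eqv (wt xs) (labelled k f xs) (eval_at (map snd xs) p)"
  using eqv_gsubst_nth_lvar[of "map snd xs"] assms by (simp add: labelled_def wt_def)

lemma actv_gsubst_lvar:
  "relabel \<sigma> (actv u W v) =
    actv u (sum_labels \<sigma> W) (relabel \<sigma> v)"
proof (induction v rule: mpoly_induct_all)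
  case (add p q)
  then show ?case
    by (simp add: additive.add[OF additive_relabel])
next
  case (const m)
  show ?case
    by (simp add: actv_mconst relabel_mconst
        psubst_hom[where S="relabel \<sigma>" and T="lvar W" and T'="lvar (sum_labels \<sigma> W)",
          OF additive_relabel relabel_lvar])
next
  case (var i v)
  then show ?case
    by (simp add: actv_mvar actv_lvar relabel_mvar)
qed

lemma labelled_natural:
  "labelled k f (map (apsnd (sum_labels \<sigma>)) xs) = relabel \<sigma> (labelled k f xs)"
proof (cases "length xs = k")
  case True
  have fst: "map fst (map (apsnd (sum_labels \<sigma>)) xs) = map fst xs"
    and snd: "map snd (map (apsnd (sum_labels \<sigma>)) xs) = map (sum_labels \<sigma>) (map snd xs)"
    by simp_all
  have "relabel \<sigma> (eval_at (map snd xs) p) =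
      gsubst (nth_op (map lvar (map (sum_labels \<sigma>) (map snd xs))))
        (\<lambda>c. relabel \<sigma> (mconst c)) p" for p :: "'m mpoly"
    by (rule gsubst_hom[OF commuting_nth_lvar commuting_nth_lvar additive_mconst
          additive_relabel])
      (simp add: nth_op_def relabel_lvar)
  then show ?thesis
    unfolding labelled_def fst snd using True by (simp add: relabel_mconst)
next
  case False
  then show ?thesis
    by (simp add: labelled_def additive.zero[OF additive_relabel])
qed

lemma loday_diff_labelled_natural:
  "C.loday_diff (labelled k f) (map (apsnd (sum_labels \<sigma>)) xs) =
    relabel \<sigma> (C.loday_diff (labelled k f) xs)"
  by (rule C.loday_diff_natural[where S="relabel \<sigma>" and s="sum_labels \<sigma>"])
    (simp_all add: additive_relabel relabel_lvar
      actv_gsubst_lvar labelled_natural)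

lemma multiadditive_labelled:
  assumes "\<And>es e e' fs. length es + Suc (length fs) = k \<Longrightarrow>
    f (es @ (e + e') # fs) = f (es @ e # fs) + f (es @ e' # fs)"
  shows "C.multiadditive (labelled k f)"
  unfolding C.multiadditive_def
proof (intro allI)
  fix xs ys :: "'e slots" and T
  show "additive (\<lambda>e. labelled k f (xs @ (e, T) # ys))"
    using assms[of "map fst xs" "map fst ys"]
      additive.add[OF additive_gsubst[OF commuting_nth_lvar[of "map snd xs @ T # map snd ys"] additive_mconst], simplified]
    by (auto simp: labelled_def additive_def)
qed

lemma labelled_mpolys_on:
  assumes f: "\<And>us. length us = k \<Longrightarrow> f us \<in> mpolys k"
  shows "labelled k f xs \<in> mpolys_on (set_mset (wt xs))"
proof (cases "length xs = k")
  case True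
  have "set_mset (snd (xs ! i)) \<subseteq> set_mset (wt xs)" if "i < k" for i
  proof -
    have "xs ! i \<in> set xs"
      using that True by simp
    moreover have "x \<in> set xs \<Longrightarrow> set_mset (snd x) \<subseteq> set_mset (wt xs)" for x and xs :: "'e slots"
      by (induction xs) auto
    ultimately show ?thesis by blast
  qed
  then have "eval_at (map snd xs) (f (map fst xs)) \<in> mpolys_on (set_mset (wt xs))"
    using f[of "map fst xs"] True unfolding mpolys_eq
    by (intro gsubst_mpolys_on[OF commuting_nth_lvar additive_mconst, of _ "{..<k}"])
      (auto simp: nth_op_def intro!: mpolys_on_lvar mpolys_on_mconst)
  then show ?thesis
    using True by (simp add: labelled_def)
qed (simp add: labelled_def mpolys_on_zero)

lemma sesquilinear_labelled:
  assumes f: "\<And>es e fs. length es + Suc (length fs) = k \<Longrightarrow>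
    beqv k (f (es @ mod_D actE e # fs)) (- mvar (length es) (f (es @ e # fs)))"
  shows "C.sesquilinear 0 (labelled k f)"
  unfolding C.sesquilinear_def
proof (intro allI)
  fix xs ys :: "'e slots" and e T
  let ?xs = "\<lambda>e. xs @ (e, T) # ys"
  show "C.eqv (0 + wt (?xs e)) (labelled k f (?xs (mod_D actE e))) (- lvar T (labelled k f (?xs e)))"
  proof (cases "length (?xs e) = k")
    case True
    have "C.eqv (wt (?xs (mod_D actE e))) (labelled k f (?xs (mod_D actE e)))
      (gsubst (nth_op (map lvar (map snd (?xs (mod_D actE e))))) mconst (- mvar (length xs) (f (map fst (?xs e)))))"
      using f[of "map fst xs" "map fst ys"] True by (intro eqv_labelled) simp_all
    also have "gsubst (nth_op (map lvar (map snd (?xs (mod_D actE e))))) mconst (- mvar (length xs) (f (map fst (?xs e))))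
      = - lvar T (labelled k f (?xs e))"
      using True unfolding additive.minus[OF additive_eval_at]
        eval_at_mvar
      by (simp add: labelled_def nth_op_def nth_append)
    finally show ?thesis
      by simp
  qed (simp add: labelled_def)
qed

text \<open>Renaming variables by \<pi> and then inserting labels is the same as inserting the
  permuted labels.\<close>

lemma labelled_permute:
  assumes f: "beqv k (f (map fst xs))
      (psigned \<pi> (rename k \<pi> (f (permute_list \<pi> (map fst xs)))))"
    and xs: "length xs = k" and \<pi>: "\<pi> permutes {..<k}"
  shows "C.eqv (wt xs) (labelled k f xs) (psigned \<pi> (labelled k f (permute_list \<pi> xs)))"
proof -
  define \<tau> :: "nat \<Rightarrow> 'm mpoly \<Rightarrow> 'm mpoly" where "\<tau> = nth_op (map lvar (map snd xs))"
  let ?G = "gsubst \<tau> mconst"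
  have \<tau>: "commuting \<tau>"
    unfolding \<tau>_def by (rule commuting_nth_lvar)
  have G: "additive ?G"
    by (rule additive_gsubst[OF \<tau> additive_mconst])
  have \<tau>_nth: "\<tau> i = (if i < k then lvar (snd (xs ! i)) else id)" for i
    using xs by (simp add: \<tau>_def nth_op_def)
  have c: "commuting (nth_op (map mvar (map \<pi> [0..<k])) :: nat \<Rightarrow> 'm mpoly \<Rightarrow> 'm mpoly)"
    by (rule commuting_nth_op) (auto simp: additive_mvar mvar_commute)
  have \<pi>': "\<pi> permutes {..<length xs}"
    using \<pi> xs by simp
  have \<pi>_less: "\<pi> i < k" if "i < k" for i
    using permutes_in_image[OF \<pi>, of i] that by simp
  have "?G (rename k \<pi> p)
      = gsubst (nth_op (map lvar (map snd (permute_list \<pi> xs)))) (\<lambda>c. ?G (mconst c)) p" for p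
  proof (rule gsubst_hom[OF c commuting_nth_lvar additive_mconst G])
    show "?G (nth_op (map mvar (map \<pi> [0..<k])) i x) = nth_op (map lvar (map snd (permute_list \<pi> xs))) i (?G x)" for i x
      using xs \<pi>_less[of i] permute_list_nth[OF \<pi>', of i]
      by (auto simp: nth_op_def gsubst_mvar[OF \<tau> additive_mconst] \<tau>_nth)
  qed
  then have G_perm: "?G (rename k \<pi> (f (permute_list \<pi> (map fst xs))))
      = labelled k f (permute_list \<pi> xs)"
    unfolding labelled_def gsubst_mconst[OF \<tau> additive_mconst] permute_list_map[OF \<pi>'] using xs by simp
  have "?G (psigned \<pi> p) = psigned \<pi> (?G p)" for p
    by (simp add: psigned_def additive.minus[OF G])
  with eqv_labelled[where f=f, OF xs f, folded \<tau>_def] show ?thesis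
    by (simp only: G_perm)
qed

lemma alternating_labelled:
  assumes "\<And>us \<pi>. length us = k \<Longrightarrow> \<pi> permutes {..<k} \<Longrightarrow> beqv k (f us)
      (psigned \<pi> (rename k \<pi> (f (permute_list \<pi> us))))"
  shows "C.alternating 0 (labelled k f)"
  unfolding C.alternating_def
proof (intro allI)
  fix xs ys :: "'e slots" and x y
  let ?xs = "xs @ x # y # ys"
  show "C.eqv (0 + wt ?xs) (labelled k f ?xs) (- labelled k f (xs @ y # x # ys))"
  proof (cases "length ?xs = k")
    case True
    let ?\<pi> = "Transposition.transpose (length xs) (Suc (length xs))"
    have \<pi>: "?\<pi> permutes {..<k}"
      using True by (intro permutes_swap_id) auto
    have "permute_list ?\<pi> ?xs = xs @ y # x # ys"
      using permute_list_transpose[of "length xs" xs "Suc (length xs)" "[]" x y ys] by simp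
    moreover have "\<not> evenperm ?\<pi>"
      by (simp add: evenperm_swap)
    ultimately show ?thesis
      using labelled_permute[where f=f and \<pi>="?\<pi>" and xs="?xs", OF assms[OF _ \<pi>] True \<pi>] True
      by (simp add: psigned_def)
  qed (simp add: labelled_def)
qed

text \<open>The invariant for contractions of a cochain, with \<open>w\<close> the label of the
  contracted slots. The last label \<open>W\<close> may be any form that contains the variable
  \<open>i\<close> once, since a Lie derivative adds its label to it. The shift clause says that
  this addition is a substitution in the values; the final clause supplies the freeness that
  \<open>actv_mul\<close> requires.\<close>

definition last_linear :: "nat \<Rightarrow> nat multiset \<Rightarrow> ('e slots \<Rightarrow> 'm mpoly) \<Rightarrow> bool" where
  "last_linear i w F \<longleftrightarrow> C.multiadditive F
    \<and> (\<forall>ys e a W. i \<notin># w + wt ys \<longrightarrow> count W i = 1 \<longrightarrow>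
        C.eqv (w + wt ys + W) (F (ys @ [(E.A.mul a e, W)])) (M.om i [:a:] (F (ys @ [(e, W)]))))
    \<and> (\<forall>ys e W V. i \<notin># w + wt ys \<longrightarrow> count W i = 1 \<longrightarrow> i \<notin># V \<longrightarrow>
        F (ys @ [(e, W + V)]) = shift_var i V (F (ys @ [(e, W)])))
    \<and> (\<forall>ys. i \<notin># w + wt ys \<longrightarrow> F ys \<in> mpolys_on (- {i}))"

lemma last_linearD:
  assumes "last_linear i w F"
  shows last_linear_multiadditive: "C.multiadditive F"
    and last_linear_mul: "i \<notin># w + wt ys \<Longrightarrow> count W i = 1 \<Longrightarrow>
        C.eqv (w + wt ys + W) (F (ys @ [(E.A.mul a e, W)])) (M.om i [:a:] (F (ys @ [(e, W)])))"
    and last_linear_shift: "i \<notin># w + wt ys \<Longrightarrow> count W i = 1 \<Longrightarrow> i \<notin># V \<Longrightarrow>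
        F (ys @ [(e, W + V)]) = shift_var i V (F (ys @ [(e, W)]))"
    and last_linear_free: "i \<notin># w + wt ys \<Longrightarrow> F ys \<in> mpolys_on (- {i})"
  using assms unfolding last_linear_def by blast+

lemma last_linear_Cons:
  assumes "last_linear i w F" "i \<notin># snd x"
  shows "last_linear i (w + snd x) (\<lambda>ys. F (x # ys))"
  unfolding last_linear_def
proof (intro conjI allI impI)
  show "C.multiadditive (\<lambda>ys. F (x # ys))"
    by (rule C.multiadditive_Cons[OF last_linear_multiadditive[OF assms(1)]])
  fix ys :: "'e slots" and e a and W V :: "nat multiset"
  assume "i \<notin># w + snd x + wt ys"
  then have i: "i \<notin># w + wt (x # ys)"
    by simp
  show "F (x # ys) \<in> mpolys_on (- {i})"
    by (rule last_linear_free[OF assms(1) i])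
  assume W: "count W i = 1"
  show "C.eqv (w + snd x + wt ys + W) (F (x # ys @ [(E.A.mul a e, W)])) (M.om i [:a:] (F (x # ys @ [(e, W)])))"
    using last_linear_mul[OF assms(1) i W, of a e] by (simp add: add_ac)
  assume "i \<notin># V"
  from last_linear_shift[OF assms(1) i W this, of e]
  show "F (x # ys @ [(e, W + V)]) = shift_var i V (F (x # ys @ [(e, W)]))"
    by simp
qed

lemma eqv_om:
  assumes "count W i = 1" "C.eqv W x y"
  shows "C.eqv W (M.om i q x) (M.om i q y)"
proof -
  obtain r where "x - y = dmv r + lvar W r"
    using assms(2) by (auto simp: C.eqv_def)
  then have "M.om i q x - M.om i q y = dmv (M.om i q r) + lvar W (M.om i q r)"
    by (simp only: M.om_total[OF assms(1), symmetric] additive.diff[OF M.additive_om, symmetric])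
  then show ?thesis
    by (rule C.eqvI)
qed

lemma om_psubst: "i \<notin># T \<Longrightarrow> M.om i q (psubst (lvar T) g p) = psubst (lvar T) (\<lambda>c. M.om i q (g c)) p"
  by (rule psubst_hom[where S="M.om i q" and T="lvar T" and T'="lvar T"])
    (simp_all add: M.additive_om M.om_lvar)

text \<open>In the one-slot case, the action of u yields an anchor term times \<open>F\<close> with
  the variable \<open>i\<close> shifted by \<open>T\<close>. The bracket [u, a e] yields the same
  coefficient times \<open>F\<close> with label \<open>T + {#i#}\<close>. By the shift clause the
  two agree, and the difference in \<open>lie_der\<close> removes them.\<close>

lemma lie_der_last_mul:
  assumes "last_linear i w F" "i \<notin># w + T + wt ys"
  shows "C.eqv (T + w + wt ys + {#i#}) (C.lie_der u T F (ys @ [(E.A.mul a e, {#i#})]))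
    (M.om i [:a:] (C.lie_der u T F (ys @ [(e, {#i#})])))"
  using assms
proof (induction ys arbitrary: F w)
  case Nil
  let ?g = "\<lambda>c. F [(c, T + {#i#})]" and ?W = "T + w + {#i#}"
  have add: "additive ?g"
    by (rule C.multiadditiveD[OF last_linear_multiadditive[OF Nil(1)]])
  have lin: "C.eqv (w + W) (F [(E.A.mul a e, W)]) (M.om i [:a:] (F [(e, W)]))"
    if "count W i = 1" for W a e
    using last_linear_mul[OF Nil(1), of "[]" W a e] Nil(2) that by simp
  have shift: "?g e = shift_var i T (F [(e, {#i#})])"
  proof -
    have "F ([] @ [(e, {#i#} + T)]) = shift_var i T (F ([] @ [(e, {#i#})]))"
      by (rule last_linear_shift[OF Nil(1)]) (use Nil(2) in simp_all)
    then show ?thesis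
      by (simp add: add.commute)
  qed
  have T: "i \<notin># T"
    using Nil by simp
  then have cT: "count (T + {#i#}) i = 1"
    by (simp add: count_eq_zero_iff)
  have 1: "C.eqv ?W (actv u T (F [(E.A.mul a e, {#i#})])) (actv u T (M.om i [:a:] (F [(e, {#i#})])))"
    unfolding add.assoc by (rule C.eqv_act) (rule lin, simp)
  have lin': "C.eqv ?W (?g (E.A.mul a c)) (M.om i [:a:] (?g c))" for a c
    using lin[OF cT, of a c] by (simp add: add_ac)
  have 2: "C.eqv ?W (psubst (lvar T) (\<lambda>c. ?g (E.A.mul a c)) (br u e)) (psubst (lvar T) (\<lambda>c. M.om i [:a:] (?g c)) (br u e))"
    by (rule C.eqv_psubst) (rule lin')
  have 3: "C.eqv ?W (psubst (lvar T) (\<lambda>b. ?g (E.A.mul b e)) (\<theta> u a)) (psubst (lvar T) (\<lambda>b. M.om i [:b:] (?g e)) (\<theta> u a))"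
    by (rule C.eqv_psubst) (rule lin')
  have br: "psubst (lvar T) ?g (br u (E.A.mul a e)) =
      psubst (lvar T) (\<lambda>c. ?g (E.A.mul a c)) (br u e) + psubst (lvar T) (\<lambda>b. ?g (E.A.mul b e)) (\<theta> u a)"
    unfolding E.br_mul psubst_add[OF additive_lvar add]
      psubst_map_poly[where g="?g" and h="E.A.mul a", OF additive_lvar additive.zero[OF add] E.A.mul_zero(1)]
      psubst_map_poly[where g="?g" and h="\<lambda>b. E.A.mul b e", OF additive_lvar additive.zero[OF add] E.A.mul_zero(2)] ..
  from C.eqv_diff[OF 1 C.eqv_add[OF 2 3]] show ?case
    unfolding actv_om[OF T] shift[symmetric]
    by (simp add: br[simplified] additive.diff[OF M.additive_om] om_psubst[OF T] algebra_simps)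
next
  case (Cons x ys)
  have T: "i \<notin># T" and i: "i \<notin># snd x"
    using Cons.prems(2) by simp_all
  let ?W = "T + (w + snd x) + wt ys + {#i#}"
  have 1: "C.eqv ?W (C.lie_der u T (\<lambda>zs. F (x # zs)) (ys @ [(E.A.mul a e, {#i#})]))
      (M.om i [:a:] (C.lie_der u T (\<lambda>zs. F (x # zs)) (ys @ [(e, {#i#})])))"
    by (rule Cons.IH[OF last_linear_Cons[OF Cons.prems(1) i]]) (use Cons.prems(2) in simp)
  have "C.eqv ?W (F (((c, T + snd x) # ys) @ [(E.A.mul a e, {#i#})]))
      (M.om i [:a:] (F (((c, T + snd x) # ys) @ [(e, {#i#})])))" for c
  proof -
    have "i \<notin># w + wt ((c, T + snd x) # ys)"
      using Cons.prems(2) by simp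
    then have "C.eqv (w + wt ((c, T + snd x) # ys) + {#i#}) (F (((c, T + snd x) # ys) @ [(E.A.mul a e, {#i#})]))
      (M.om i [:a:] (F (((c, T + snd x) # ys) @ [(e, {#i#})])))"
      by (rule last_linear_mul[OF Cons.prems(1)]) simp
    then show ?thesis
      by (simp add: add_ac)
  qed
  then have 2: "C.eqv ?W (psubst (lvar T) (\<lambda>c. F ((c, T + snd x) # ys @ [(E.A.mul a e, {#i#})])) (br u (fst x)))
      (psubst (lvar T) (\<lambda>c. M.om i [:a:] (F ((c, T + snd x) # ys @ [(e, {#i#})]))) (br u (fst x)))"
    by (intro C.eqv_psubst) simp
  from C.eqv_diff[OF 1 2] show ?case
    by (simp add: om_psubst[OF T] add_ac)
qed

text \<open>With a single slot, only the action of that argument on \<open>F []\<close> is left, and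
  \<open>F []\<close> is free of the variable \<open>i\<close>.\<close>

lemma loday_diff_last_mul:
  assumes "last_linear i w F" "i \<notin># w + wt ys"
  shows "C.eqv (w + wt ys + {#i#}) (C.loday_diff F (ys @ [(E.A.mul a e, {#i#})]))
    (M.om i [:a:] (C.loday_diff F (ys @ [(e, {#i#})])))"
  using assms
proof (induction ys arbitrary: F w)
  case Nil
  have "F [] \<in> mpolys_on (- {i})"
    by (rule last_linear_free[OF Nil(1)]) (use Nil(2) in simp)
  from actv_mul[OF this, of i a e] show ?case
    by simp
next
  case (Cons x ys)
  have i: "i \<notin># snd x"
    using Cons.prems(2) by simp
  have "C.eqv (snd x + w + wt ys + {#i#}) (C.loday_diff (\<lambda>zs. F (x # zs)) (ys @ [(E.A.mul a e, {#i#})]))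
      (M.om i [:a:] (C.loday_diff (\<lambda>zs. F (x # zs)) (ys @ [(e, {#i#})])))"
    unfolding add.commute[of "snd x" w]
    by (rule Cons.IH[OF last_linear_Cons[OF Cons.prems(1) i]]) (use Cons.prems(2) in simp)
  from C.eqv_diff[OF lie_der_last_mul[OF Cons.prems(1), of "snd x" ys "fst x" a e] this] Cons.prems(2)
  show ?case
    by (simp add: add_ac)
qed

end

section \<open>Dependence of the formula on representatives, and its variables\<close>

lemma mpolys_on_map:
  assumes "additive h" "p \<in> mpolys_on V" shows "Poly_Mapping.map h p \<in> mpolys_on V"
  using assms(2)
  by (induction p rule: mpoly_induct)
    (simp_all add: additive.add[OF additive_map[OF assms(1)]] map_mconst[OF assms(1)] map_mvar[OF assms(1)]
      mpolys_on_add mpolys_on_mconst mpolys_on_mvar)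

context leibniz_diff
begin

text \<open>The source of independence of representatives: each term, whether an action or a
  bracket, has total label \<open>w + wt xs\<close>.\<close>

lemma ce_formula_cong:
  assumes "\<And>ys. Suc (length ys) = length xs \<Longrightarrow> eqv (w + wt ys) (F ys) (\<Psi> ys)"
  shows "eqv (w + wt xs) (ce_formula F xs) (ce_formula \<Psi> xs)"
proof -
  have len2: "i < j \<Longrightarrow> j < length xs \<Longrightarrow> Suc (Suc (length (nths xs (- {i, j})))) = length xs"
    for i j and xs :: "('e \<times> 'l) list"
  proof (induction xs arbitrary: i j)
    case (Cons x xs)
    then obtain j' where j: "j = Suc j'"
      by (cases j) auto
    with Cons show ?case
      by (cases i) (auto simp: nths_Cons_compl nths_compl_nth)
  qed simp
  show ?thesis
    unfolding ce_formula_def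
  proof (intro eqv_add eqv_sum eqv_signed eqv_psubst)
    fix i assume i: "i \<in> {..<length xs}"
    have "eqv (snd (xs ! i) + (w + wt (nths xs (- {i}))))
       (act (fst (xs ! i)) (snd (xs ! i)) (F (nths xs (- {i}))))
       (act (fst (xs ! i)) (snd (xs ! i)) (\<Psi> (nths xs (- {i}))))"
      using i by (intro eqv_act assms) (simp add: nths_compl_nth)
    moreover have "snd (xs ! i) + (w + wt (nths xs (- {i}))) = w + wt xs"
      using wt_nths_compl[of i xs] i by (simp add: add.left_commute)
    ultimately show "eqv (w + wt xs) (act (fst (xs ! i)) (snd (xs ! i)) (F (nths xs (- {i}))))
       (act (fst (xs ! i)) (snd (xs ! i)) (\<Psi> (nths xs (- {i}))))"
      by simp
  next
    fix i j e assume ij: "j \<in> {..<length xs}" "i \<in> {..<j}"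
    let ?ys = "(e, snd (xs ! i) + snd (xs ! j)) # nths xs (- {i, j})"
    have "eqv (w + wt ?ys) (F ?ys) (\<Psi> ?ys)"
      using ij len2[of i j xs] by (intro assms) simp
    moreover have "wt ?ys = wt xs"
      using wt_nths_compl2[of i j xs] ij by (simp add: add.assoc)
    ultimately show "eqv (w + wt xs) (F ?ys) (\<Psi> ?ys)"
      by simp
  qed
qed

lemma ce_formula_add: "ce_formula (\<lambda>ys. F ys + \<Psi> ys) xs = ce_formula F xs + ce_formula \<Psi> xs"
  by (simp add: ce_formula_def act_add psubst_lop_rules signed_add_fun sum.distrib add_ac)

lemma ce_formula_hom:
  assumes S: "additive S" and S_lop: "\<And>T v. S (lop T v) = lop T (S v)"
    and S_act: "\<And>u T v. S (act u T v) = act u T (S v)"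
  shows "ce_formula (\<lambda>ys. S (F ys)) xs = S (ce_formula F xs)"
  by (simp add: ce_formula_def additive.add[OF S] additive.sum[OF S] signed_hom[OF S] S_act
      psubst_lop_hom[OF S S_lop])

end

context lie_conformal_algebroid_module
begin

lemma mpolys_on_actv:
  assumes "v \<in> mpolys_on V" "set_mset W \<subseteq> V"
  shows "actv u W v \<in> mpolys_on V"
  using assms(1)
proof (induction v rule: mpoly_induct)
  case (const m)
  have "psubst (lvar W) mconst q \<in> mpolys_on V" for q :: "'m poly"
    using assms(2) by (intro mpolys_on_psubst additive_lvar additive_mconst mpolys_on_mconst mpolys_on_lvar)
  then show ?case
    by (simp add: actv_mconst)
qed (simp_all add: actv_mvar mpolys_on_add mpolys_on_mvar)

lemma mpolys_on_signed: "p \<in> mpolys_on V \<Longrightarrow> signed n p \<in> mpolys_on V" for p :: "'m mpoly"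
  by (simp add: signed_def mpolys_on_uminus)

lemma mpolys_on_psubst_lvar:
  assumes "\<And>c. g c \<in> mpolys_on V" "set_mset W \<subseteq> V"
  shows "psubst (lvar W) g q \<in> mpolys_on V"
proof -
  have "(lvar W ^^ n) (g c) \<in> mpolys_on V" for n c
    by (induction n) (simp_all add: assms mpolys_on_lvar)
  then show ?thesis
    by (simp add: psubst_def mpolys_on_sum)
qed

text \<open>The set \<open>A\<close> records the variables of slots that the recursion has
  contracted.\<close>

lemma mpolys_on_lie_der:
  assumes "\<And>ys. F ys \<in> mpolys_on (A \<union> set_mset (wt ys))"
  shows "C.lie_der u T F xs \<in> mpolys_on (A \<union> set_mset T \<union> set_mset (wt xs))"
  using assms
proof (induction xs arbitrary: A F)
  case Nil
  have "F [] \<in> mpolys_on (A \<union> set_mset T)"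
    using Nil[of "[]"] by (rule mpolys_on_mono) simp
  then show ?case
    by (simp add: mpolys_on_actv)
next
  case (Cons x xs)
  have "C.lie_der u T (\<lambda>ys. F (x # ys)) xs \<in> mpolys_on (A \<union> set_mset (snd x) \<union> set_mset T \<union> set_mset (wt xs))"
    by (rule Cons.IH) (rule mpolys_on_mono[OF Cons.prems], auto)
  moreover have "F ((e, T + snd x) # xs) \<in> mpolys_on (A \<union> set_mset T \<union> set_mset (wt (x # xs)))" for e
    by (rule mpolys_on_mono[OF Cons.prems]) auto
  ultimately show ?case
    by (auto intro!: mpolys_on_diff mpolys_on_psubst_lvar elim!: mpolys_on_mono)
qed

lemma mpolys_on_loday_diff:
  assumes "\<And>ys. F ys \<in> mpolys_on (A \<union> set_mset (wt ys))"
  shows "C.loday_diff F xs \<in> mpolys_on (A \<union> set_mset (wt xs))"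
  using assms
proof (induction xs arbitrary: A F)
  case Nil
  show ?case
    by (simp add: mpolys_on_zero)
next
  case (Cons x xs)
  have "C.loday_diff (\<lambda>ys. F (x # ys)) xs \<in> mpolys_on (A \<union> set_mset (snd x) \<union> set_mset (wt xs))"
    by (rule Cons.IH) (rule mpolys_on_mono[OF Cons.prems], auto)
  moreover have "C.lie_der (fst x) (snd x) F xs \<in> mpolys_on (A \<union> set_mset (snd x) \<union> set_mset (wt xs))"
    by (rule mpolys_on_lie_der[OF Cons.prems])
  ultimately show ?case
    by (auto intro!: mpolys_on_diff elim!: mpolys_on_mono)
qed

lemma mpolys_on_ce_formula:
  assumes F: "\<And>ys. F ys \<in> mpolys_on (set_mset (wt ys))"
  shows "C.ce_formula F xs \<in> mpolys_on (set_mset (wt xs))"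
proof -
  have 1: "F (nths xs (- {i})) \<in> mpolys_on (set_mset (wt xs))"
      "set_mset (snd (xs ! i)) \<subseteq> set_mset (wt xs)" if "i < length xs" for i
    using C.wt_nths_compl[OF that, symmetric] by (auto intro: mpolys_on_mono[OF F])
  have 2: "F ((e, snd (xs ! i) + snd (xs ! j)) # nths xs (- {i, j})) \<in> mpolys_on (set_mset (wt xs))"
    if "i < j" "j < length xs" for i j e
    using C.wt_nths_compl2[OF that, symmetric] by (auto intro: mpolys_on_mono[OF F])
  show ?thesis
    unfolding C.ce_formula_def
    using 1 2 by (intro mpolys_on_add mpolys_on_sum mpolys_on_signed mpolys_on_actv mpolys_on_psubst_lvar) auto
qed

declare mset_upt [simp del]

section \<open>Quotients of polynomial spaces\<close>

lemma count_basic_wt: "i < k \<Longrightarrow> count (basic_wt k) i = 1"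
  by (simp add: mset_upt)

lemma total_D_eq: "total_D (mod_D actM) k p = dmv p + lvar (basic_wt k) p"
  unfolding total_D_def lvar_def mset_map[symmetric] sum_mset_sum_list
  by (simp add: sum_list_sum_nth atLeast0LessThan)

lemma gsubst_mvar_id: "gsubst mvar mconst p = p" for p :: "'x::ab_group_add mpoly"
  by (rule gsubst_unique[OF commuting_mvar additive_mconst _ mpolys_on_UNIV, symmetric, where X="\<lambda>p. p"])
    (simp_all add: additive_def)

lemma qrel_iff: "(p, q) \<in> qrel (mod_D actM) k \<longleftrightarrow> p \<in> mpolys k \<and> q \<in> mpolys k \<and> beqv k p q"
proof -
  \<comment> \<open>The witness of the congruence may contain variables from \<open>k\<close> on.
    Setting them to 0 fixes \<open>p\<close>, \<open>q\<close> and the sum of the first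
    \<open>k\<close> variables, and moves the witness into \<open>mpolys k\<close>.\<close>
  define \<sigma> where "\<sigma> i = (if i < k then {#i#} else {#})" for i :: nat
  let ?G = "relabel \<sigma> :: 'm mpoly \<Rightarrow> 'm mpoly"
  have G: "additive ?G"
    by (rule additive_relabel)
  have G_mem: "?G r \<in> mpolys k" for r
    unfolding mpolys_eq
    by (rule gsubst_mpolys_on[OF commuting_lvar additive_mconst mpolys_on_UNIV mpolys_on_mconst])
      (auto simp: \<sigma>_def mpolys_on_zero intro: mpolys_on_mvar)
  have G_id: "?G r = r" if "r \<in> mpolys k" for r
  proof -
    have "?G r = gsubst mvar mconst r"
      by (rule gsubst_cong[OF commuting_lvar commuting_mvar additive_mconst that[unfolded mpolys_eq]])
        (simp add: \<sigma>_def fun_eq_iff)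
    then show ?thesis
      by (simp add: gsubst_mvar_id)
  qed
  have "sum_labels \<sigma> (mset ls) = mset ls" if "set ls \<subseteq> {..<k}" for ls
    using that by (induction ls) (simp_all add: \<sigma>_def)
  from this[of "[0..<k]"] have \<sigma>: "sum_labels \<sigma> (basic_wt k) = basic_wt k"
    by (auto simp del: mset_upt simp: atLeast0LessThan)
  have "p - q \<in> total_D (mod_D actM) k ` mpolys k" if "p \<in> mpolys k" "q \<in> mpolys k" "p - q = total_D (mod_D actM) k r" for r
  proof (rule image_eqI)
    have "p - q = ?G (p - q)"
      unfolding additive.diff[OF G] using that(1,2) by (simp add: G_id)
    also have "\<dots> = total_D (mod_D actM) k (?G r)"
      unfolding that(3) total_D_eq additive.add[OF G] relabel_lvar \<sigma>
      by (subst map_gsubst[OF commuting_lvar M.additive_dmod dmv_lvar]) simp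
    finally show "p - q = total_D (mod_D actM) k (?G r)" .
  qed (rule G_mem)
  then show ?thesis
    by (auto simp: qrel_def C.eqv_def total_D_eq)
qed

abbreviation "qcl \<equiv> qclass (mod_D actM)"

lemma qclass_iff: "q \<in> qcl k p \<longleftrightarrow> p \<in> mpolys k \<and> q \<in> mpolys k \<and> beqv k p q"
  by (simp add: qclass_def qrel_iff)

lemma qclass_eqI:
  assumes "p \<in> mpolys k" "q \<in> mpolys k" "beqv k p q"
  shows "qcl k p = qcl k q"
proof -
  have "beqv k p r \<longleftrightarrow> beqv k q r" for r
    using C.eqv_trans[OF assms(3)] C.eqv_trans[OF C.eqv_sym[OF assms(3)]] by blast
  then show ?thesis
    using assms(1,2) by (simp add: set_eq_iff qclass_iff)
qed

lemma qclass_eqD: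
  assumes "qcl k p = qcl k q" "p \<in> mpolys k"
  shows "beqv k p q" "q \<in> mpolys k"
proof -
  have "p \<in> qcl k q"
    using assms qclass_iff[of p k p] by simp
  then show "beqv k p q" "q \<in> mpolys k"
    by (simp_all add: qclass_iff C.eqv_sym)
qed

lemma quotient_qclass:
  assumes "X \<in> mpolys k // qrel (mod_D actM) k" "p \<in> X"
  shows "p \<in> mpolys k" "X = qcl k p"
proof -
  obtain q where q: "q \<in> mpolys k" "X = qcl k q"
    using assms(1) by (auto simp: quotient_def qclass_def)
  with assms(2) have p: "p \<in> mpolys k" and eqv: "beqv k q p"
    by (simp_all add: qclass_iff)
  show "p \<in> mpolys k"
    by (rule p)
  show "X = qcl k p"
    using qclass_eqI[OF q(1) p eqv] q(2) by simp
qed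

lemma qclass_in_quotient: "p \<in> mpolys k \<Longrightarrow> qcl k p \<in> mpolys k // qrel (mod_D actM) k"
  by (auto simp: quotient_def qclass_def)

lemma UN_qclass:
  assumes "p \<in> mpolys k"
    and "\<And>q. q \<in> mpolys k \<Longrightarrow> h q \<in> mpolys l"
    and "\<And>q. q \<in> mpolys k \<Longrightarrow> beqv k p q \<Longrightarrow> C.eqv (basic_wt l) (h p) (h q)"
  shows "(\<Union>q\<in>qcl k p. qcl l (h q)) = qcl l (h p)"
proof -
  have "qcl l (h q) = qcl l (h p)" if "q \<in> qcl k p" for q
    using that assms by (intro qclass_eqI[symmetric]) (auto simp: qclass_iff)
  moreover have "p \<in> qcl k p"
    using assms(1) by (simp add: qclass_iff)
  ultimately show ?thesis
    by blast
qed

lemma qadd_qclass: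
  assumes "p \<in> mpolys k" "q \<in> mpolys k"
  shows "qad k (qcl k p) (qcl k q) = qcl k (p + q)"
proof -
  have "(\<Union>q'\<in>qcl k q. qcl k (p' + q')) = qcl k (p' + q)" if "p' \<in> mpolys k" for p'
    using assms that by (intro UN_qclass) (auto simp: mpolys_eq mpolys_on_add C.eqv_add)
  then have "qad k (qcl k p) (qcl k q) = (\<Union>p'\<in>qcl k p. qcl k (p' + q))"
    unfolding qadd_def by (intro SUP_cong) (auto simp: qclass_iff)
  also have "\<dots> = qcl k (p + q)"
    using assms by (intro UN_qclass) (auto simp: mpolys_eq mpolys_on_add C.eqv_add)
  finally show ?thesis .
qed

abbreviation "scal c \<equiv> Poly_Mapping.map (mod_scale scA actM c) :: 'm mpoly \<Rightarrow> 'm mpoly"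

lemma additive_scal: "additive (scal c)"
  unfolding M.mod_scale_eq_mul by (rule additive_map[OF M.additive_mul])

lemmas scal_additive [simp] = additive.add[OF additive_scal] additive.zero[OF additive_scal]
  additive.minus[OF additive_scal] additive.diff[OF additive_scal]

lemma scal_mvar: "scal c (mvar i p) = mvar i (scal c p)"
  unfolding M.mod_scale_eq_mul by (rule map_mvar[OF M.additive_mul])

lemma scal_lvar: "scal c (lvar W p) = lvar W (scal c p)"
  by (rule lvar_hom[OF additive_scal scal_mvar])

lemma scal_mconst: "scal c (mconst m) = mconst (mod_scale scA actM c m)"
  unfolding M.mod_scale_eq_mul by (rule map_mconst[OF M.additive_mul])

lemma scal_dmv: "scal c (dmv p) = dmv (scal c p)"
  by (simp add: poly_mapping_eq_iff fun_eq_iff lookup_map_0 M.mod_scale_eq_mul M.dmod_mul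
      additive.zero[OF M.additive_dmod])

lemma scal_actv: "scal c (actv u W p) = actv u W (scal c p)"
proof (induction p rule: mpoly_induct_all)
  case (const m)
  have zero: "mod_scale scA actM c 0 = 0"
    by (simp add: M.mod_scale_eq_mul)
  have "lact u (mod_scale scA actM c m) = map_poly (mod_scale scA actM c) (lact u m)"
    using lact_linear_right[of u] by (simp add: Vector_Spaces.linear_iff)
  then show ?case
    by (simp add: actv_mconst scal_mconst
        psubst_hom[where S="scal c" and T="lvar W" and T'="lvar W", OF additive_scal scal_lvar]
        psubst_map_poly[where g=mconst and h="mod_scale scA actM c", OF additive_lvar additive.zero[OF additive_mconst] zero])
qed (simp_all add: actv_mvar scal_mvar)

lemma mpolys_scal: "p \<in> mpolys k \<Longrightarrow> scal c p \<in> mpolys k"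
  unfolding mpolys_eq M.mod_scale_eq_mul by (rule mpolys_on_map[OF M.additive_mul])

lemma eqv_scal: "C.eqv W x y \<Longrightarrow> C.eqv W (scal c x) (scal c y)"
proof -
  assume "C.eqv W x y"
  then obtain r where "x - y = dmv r + lvar W r"
    by (auto simp: C.eqv_def)
  then have "scal c x - scal c y = dmv (scal c r) + lvar W (scal c r)"
    by (simp add: scal_dmv scal_lvar additive.add[OF additive_scal] flip: additive.diff[OF additive_scal])
  then show ?thesis
    by (rule C.eqvI)
qed

lemma qscale_qclass:
  "p \<in> mpolys k \<Longrightarrow> qsc k c (qcl k p) = qcl k (scal c p)"
  unfolding qscale_def by (intro UN_qclass) (auto simp: mpolys_scal eqv_scal)

lemma map_uminus: "Poly_Mapping.map uminus p = - p" for p :: "'m mpoly"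
  by (simp add: poly_mapping_eq_iff fun_eq_iff lookup_map_0)

lemma map_id: "Poly_Mapping.map (\<lambda>m. m) p = p" for p :: "'m mpoly"
  by (simp add: poly_mapping_eq_iff fun_eq_iff lookup_map_0)

lemma mod_scale_one: "mod_scale scA actM 1 = (\<lambda>m. m)" 
  by (simp add: fun_eq_iff M.mod_scale_eq_mul E.A.scale_one)

lemma mod_scale_minus_one: "mod_scale scA actM (- 1) = uminus"
proof -
  have "M.mul (- 1) m = - m" for m
    using additive.minus[OF M.additive_mul_left, of 1 m] by simp
  then show ?thesis
    by (simp add: fun_eq_iff M.mod_scale_eq_mul)
qed

lemma scal_power: "scal ((- 1) ^ n) p = signed n p"
  by (cases "even n") (simp_all add: signed_def mod_scale_one mod_scale_minus_one map_uminus map_id)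

lemma scal_sign: "scal (of_int (sign \<pi>)) p = psigned \<pi> p"
  by (simp add: sign_def psigned_def mod_scale_one mod_scale_minus_one map_uminus map_id)

end

section \<open>Sesquilinearity in all slots\<close>

context dop_module
begin

text \<open>Each operator meets a polynomial in the variables treated before it, never its own, so
  \<open>om_free\<close> applies every time.\<close>

lemma foldr_om_mconst:
  "distinct ls \<Longrightarrow> foldr (\<lambda>i. om i (q i)) ls (mconst m) = foldr (\<lambda>i. mpoly_mul mul i (q i)) ls (mconst m)
    \<and> foldr (\<lambda>i. om i (q i)) ls (mconst m) \<in> mpolys_on (set ls)"
proof (induction ls)
  case (Cons i ls)
  let ?x = "foldr (\<lambda>i. om i (q i)) ls (mconst m)"
  have x: "?x \<in> mpolys_on (set ls)" and i: "i \<notin> set ls"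
    using Cons by auto
  have mem: "mpoly_mul mul i (q i) ?x \<in> mpolys_on (set (i # ls))"
    unfolding mpoly_mul_def
  proof (rule mpolys_on_psubst[OF additive_mvar additive_map_mul_left])
    show "Poly_Mapping.map (mul c) ?x \<in> mpolys_on (set (i # ls))" for c
      by (rule mpolys_on_map[OF additive_mul]) (rule mpolys_on_mono[OF x], auto)
  qed (simp add: mpolys_on_mvar)
  have om: "foldr (\<lambda>i. om i (q i)) (i # ls) (mconst m) = mpoly_mul mul i (q i) ?x"
    by (simp add: om_free[OF x i])
  have mm: "foldr (\<lambda>i. mpoly_mul mul i (q i)) (i # ls) (mconst m) = mpoly_mul mul i (q i) ?x"
    using Cons by simp
  show ?case
    unfolding om mm using mem by blast
qed (simp add: mpolys_on_mconst)

lemma foldr_om_mvar: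
  "distinct ls \<Longrightarrow> foldr (\<lambda>i. om i (q i)) ls (mvar j p) =
    (if j \<in> set ls then foldr (\<lambda>i. om i ((q(j := var_plus D (q j))) i)) ls p
     else mvar j (foldr (\<lambda>i. om i (q i)) ls p))"
proof (induction ls)
  case (Cons y ys)
  show ?case
  proof (cases "j = y")
    case True
    moreover have "foldr (\<lambda>i. om i ((q(y := var_plus D (q y))) i)) ys p = foldr (\<lambda>i. om i (q i)) ys p"
      using Cons.prems by (intro foldr_cong) auto
    ultimately show ?thesis
      using Cons by (simp add: om_mvar)
  qed (use Cons in \<open>auto simp: om_mvar\<close>)
qed simp

lemma additive_foldr_om: "additive (foldr (\<lambda>i. om i (q i)) ls)"
  by (induction ls) (simp_all add: additive_def)

text \<open>\<open>multi_twist\<close> is defined monomial by monomial, the operators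
  \<open>om\<close> one variable at a time. Both respond to a factor \<lambda>_j by replacing the
  j-th symbol q by (\<lambda> + \<partial>) q, and they agree on constants.\<close>

lemma multi_twist_eq:
  assumes "p \<in> mpolys (length as)"
  shows "multi_twist D mul as p = foldr (\<lambda>i. om i (adj_symbol D (as ! i))) [0..<length as] p"
proof -
  let ?ls = "[0..<length as]"
  define h where "h q \<alpha> c = foldr (\<lambda>i. mpoly_mul mul i ((var_plus D ^^ Poly_Mapping.lookup \<alpha> i) (q i)))
      ?ls (mconst c)" for q :: "nat \<Rightarrow> 'a poly" and \<alpha> :: "nat \<Rightarrow>\<^sub>0 nat" and c :: 'u
  have "additive (\<lambda>c. foldr (\<lambda>i. mpoly_mul mul i (r i)) ls (mconst c))" for ls r
    by (induction ls) (simp_all add: additive_mconst additive_comp[OF additive_mpoly_mul])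
  then have h: "additive (h q \<alpha>)" for q \<alpha>
    by (simp add: additive_def h_def)
  have h_mvar: "msum (h q) (mvar j p) = msum (h (q(j := var_plus D (q j)))) p" for q j p
  proof -
    have "msum (h q) (mvar j (Poly_Mapping.single \<alpha> c)) = msum (h (q(j := var_plus D (q j)))) (Poly_Mapping.single \<alpha> c)" for \<alpha> c
    proof -
      have "h q (Poly_Mapping.single j 1 + \<alpha>) c = h (q(j := var_plus D (q j))) \<alpha> c"
        unfolding h_def
        by (rule foldr_cong) (auto simp: lookup_add lookup_single when_def funpow_swap1)
      then show ?thesis
        by (simp add: mvar_single msum_single additive.zero[OF h])
    qed
    then show ?thesis
      by (subst (1 2) mpoly_sum_single[of p, symmetric])
        (simp add: additive.sum[OF additive_mvar] additive.sum[OF additive_msum[OF h]])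
  qed
  have "msum (h q) p = foldr (\<lambda>i. om i (q i)) ?ls p" for q
    using assms unfolding mpolys_eq
  proof (induction p arbitrary: q rule: mpoly_induct)
    case (add p p')
    then show ?case
      by (simp add: additive.add[OF additive_msum[OF h]] additive.add[OF additive_foldr_om])
  next
    case (const c)
    show ?case
      by (simp add: mconst_def msum_single additive.zero[OF h])
        (simp add: h_def foldr_om_mconst[THEN conjunct1] flip: mconst_def)
  next
    case (var j p)
    then show ?case
      by (simp add: h_mvar foldr_om_mvar)
  qed
  from this[of "\<lambda>i. adj_symbol D (as ! i)"] show ?thesis
    by (simp add: multi_twist_def msum_def h_def)
qed

lemma om_adj_pCons: "om i (adj_symbol D (pCons a P)) p = om i [:a:] p - om i (adj_symbol D P) (mvar i p)"
  by (simp add: adj_symbol_pCons additive.diff[OF additive_om_left] om_mvar)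

lemma om_adj_var: "om i (adj_symbol D [:0, 1:]) p = - mvar i p"
  by (simp add: om_adj_pCons[of i 0 "[:1:]"] adj_symbol_const om_one additive.zero[OF additive_om_left])

end

context lie_conformal_algebroid_module
begin

section \<open>Operators in one slot and in all slots\<close>

lemma foldr_om_single:
  "i < k \<Longrightarrow> foldr (\<lambda>j. M.om j (adj_symbol D ((replicate k 1)[i := P] ! j))) [0..<k] p = M.om i (adj_symbol D P) p"
proof -
  assume i: "i < k"
  let ?f = "\<lambda>j. M.om j (adj_symbol D ((replicate k 1)[i := P] ! j))"
  have one: "M.om j (adj_symbol D 1) x = x" for j and x :: "'m mpoly"
    by (simp add: one_pCons E.A.adj_symbol_const M.om_one)
  have id: "foldr ?f ls x = x" if "i \<notin> set ls" "set ls \<subseteq> {..<k}" for ls x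
    using that by (induction ls) (simp_all add: one)
  have "foldr ?f [Suc i..<k] p = p" "foldr ?f [0..<i] (M.om i (adj_symbol D P) p) = M.om i (adj_symbol D P) p"
    using i by (intro id; auto)+
  moreover have "[0..<k] = [0..<i] @ i # [Suc i..<k]"
    using i by (metis upt_conv_Cons upt_add_eq_append le0 less_imp_le_nat le_add_diff_inverse)
  ultimately show ?thesis
    using i by simp
qed

lemma map2_replicate_act:
  assumes "i < length us"
  shows "map2 actE ((replicate (length us) 1)[i := P]) us = us[i := actE P (us ! i)]"
  by (rule nth_equalityI) (use assms in \<open>auto simp: nth_list_update E.A.act_one\<close>)

text \<open>The symbol \<open>pCons a P\<close> belongs to the operator a + P \<partial>, and its
  adjoint is resolved by \<open>om_adj_pCons\<close>. Induction on the symbol thus splits linearity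
  over A[\<partial>] into additivity, multiplication by A and \<partial>.\<close>

lemma eqv_act_general:
  assumes i: "i < n"
    and add: "\<And>v w. beqv n (h (v + w)) (h v + h w)"
    and mul: "\<And>a v. beqv n (h (E.A.mul a v)) (M.om i [:a:] (h v))"
    and der: "\<And>v. beqv n (h (mod_D actE v)) (- mvar i (h v))"
  shows "beqv n (h (actE P v)) (M.om i (adj_symbol D P) (h v))"
proof (induction P arbitrary: v)
  case 0
  have "beqv n (h (E.A.mul 0 v)) (M.om i [:0:] (h v))"
    by (rule mul)
  then show ?case
    by (simp add: E.A.adj_symbol_const[of 0, simplified])
next
  case (pCons a P)
  have om: "beqv n x y \<Longrightarrow> beqv n (M.om i q x) (M.om i q y)" for q x y
    by (rule eqv_om[OF count_basic_wt[OF i]])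
  have "beqv n (h (actE (pCons a P) v)) (h (E.A.mul a v) + h (actE P (mod_D actE v)))"
    unfolding E.A.act_pCons by (rule add)
  also have "beqv n \<dots> (M.om i [:a:] (h v) + M.om i (adj_symbol D P) (h (mod_D actE v)))"
    by (intro C.eqv_add mul pCons.IH)
  also have "beqv n \<dots> (M.om i [:a:] (h v) + M.om i (adj_symbol D P) (- mvar i (h v)))"
    by (intro C.eqv_add C.eqv_refl om der)
  also have "\<dots> = M.om i (adj_symbol D (pCons a P)) (h v)"
    by (simp add: M.om_adj_pCons)
  finally show ?case .
qed

text \<open>Slots are treated from the last to the first, the order in which \<open>foldr\<close>
  applies the operators. In \<open>vs m\<close> those from \<open>m\<close> on are done.\<close>

lemma eqv_map2_act:
  assumes single: "\<And>us i P. length us = n \<Longrightarrow> i < n \<Longrightarrow>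
      beqv n (g (us[i := actE P (us ! i)])) (M.om i (adj_symbol D P) (g us))"
    and len: "length as = n" "length us = n"
  shows "beqv n (g (map2 actE as us)) (foldr (om_adj as) [0..<n] (g us))"
proof -
  define vs where "vs m = take m us @ map2 actE (drop m as) (drop m us)" for m
  have "beqv n (g (vs m)) (foldr (om_adj as) [m..<n] (g us))" if "m \<le> n" for m
    using that
  proof (induction m rule: inc_induct)
    case base
    then show ?case
      using len by (simp add: vs_def)
  next
    case (step m)
    have "vs m = (vs (Suc m))[m := actE (as ! m) (vs (Suc m) ! m)]"
    proof (rule nth_equalityI)
      show "vs m ! i = (vs (Suc m))[m := actE (as ! m) (vs (Suc m) ! m)] ! i" if "i < length (vs m)" for i
        using that step(1,2) len by (cases i m rule: linorder_cases)
          (simp_all add: vs_def nth_append nth_list_update min_def)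
    qed (use step(1,2) len in \<open>simp add: vs_def\<close>)
    then have "beqv n (g (vs m)) (M.om m (adj_symbol D (as ! m)) (g (vs (Suc m))))"
      using single[of "vs (Suc m)" m "as ! m"] step len by (simp add: vs_def)
    also have "beqv n \<dots> (M.om m (adj_symbol D (as ! m)) (foldr (om_adj as) [Suc m..<n] (g us)))"
      by (rule eqv_om[OF count_basic_wt step.IH]) (use step in simp)
    finally show ?case
      using step by (simp add: upt_conv_Cons)
  qed
  from this[of 0] show ?thesis
    by (simp add: vs_def)
qed

section \<open>Additive representatives\<close>

definition sect_op :: "nat \<Rightarrow> nat \<Rightarrow> 'm mpoly \<Rightarrow> 'm mpoly" where
  "sect_op n i p = (if i = n then - dmv p - lvar (basic_wt n) p else mvar i p)"

text \<open>
  Eliminating the last variable by \<open>\<lambda>\<^sub>n = - \<partial> - \<lambda>\<^sub>0 - \<dots> - \<lambda>\<^sub>n\<^sub>-\<^sub>1\<close> splits the quotient map.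
\<close>

definition sect :: "nat \<Rightarrow> 'm mpoly \<Rightarrow> 'm mpoly" where
  "sect k p = (if k = 0 then p else gsubst (sect_op (k - 1)) mconst p)"

lemma commuting_sect_op: "commuting (sect_op n)"
proof -
  have "additive dmv"
    by (rule additive_map[OF M.additive_dmod])
  note rules = additive.add[OF this] additive.diff[OF this] additive.minus[OF this]
  show ?thesis
    unfolding commuting_def additive_def sect_op_def
    by (auto simp: rules map_mvar[OF M.additive_dmod] mvar_commute lvar_mvar)
qed

lemma additive_sect: "additive (sect k)"
  using additive_gsubst[OF commuting_sect_op additive_mconst] by (simp add: sect_def additive_def)

lemma eqv_sect: "beqv k (sect k p) p"
proof (cases k)
  case (Suc n)
  have "beqv k (gsubst (sect_op n) mconst p) p"
  proof (induction p rule: mpoly_induct_all)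
    case (add p q)
    then show ?case
      by (simp add: additive.add[OF additive_gsubst[OF commuting_sect_op additive_mconst]] C.eqv_add)
  next
    case (const c)
    show ?case
      by (simp add: gsubst_mconst[OF commuting_sect_op additive_mconst])
  next
    case (var i p)
    let ?p = "gsubst (sect_op n) mconst p"
    have "beqv k (sect_op n i ?p) (mvar i ?p)"
    proof (cases "i = n")
      case True
      then have "mvar i ?p - sect_op n i ?p = dmv ?p + lvar (basic_wt k) ?p"
        by (simp add: sect_op_def Suc lvar_add_mset)
      then show ?thesis
        by (rule C.eqv_sym[OF C.eqvI])
    qed (simp add: sect_op_def)
    also have "beqv k (mvar i ?p) (mvar i p)"
      using C.eqv_lop[OF var(3), of "{#i#}"] by simp
    finally show ?case
      by (simp add: gsubst_mvar[OF commuting_sect_op additive_mconst])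
  qed
  then show ?thesis
    by (simp add: sect_def Suc)
qed (simp add: sect_def)

text \<open>The substitution commutes with \<partial> on coefficients and annihilates \<partial>
  plus the sum of the variables. For \<open>k = 0\<close> there is no variable to eliminate, but
  then there is no slot in which additivity could fail either.\<close>

lemma sect_eqI:
  assumes "k > 0" "beqv k p q"
  shows "sect k p = sect k q"
proof -
  obtain n where k: "k = Suc n"
    using assms(1) by (cases k) auto
  let ?G = "gsubst (sect_op n) mconst :: 'm mpoly \<Rightarrow> 'm mpoly"
  have G: "additive ?G"
    by (rule additive_gsubst[OF commuting_sect_op additive_mconst])
  obtain r where "p - q = dmv r + lvar (basic_wt k) r"
    using assms(2) by (auto simp: C.eqv_def)
  then have "?G p - ?G q = ?G (dmv r) + ?G (lvar (basic_wt k) r)"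
    by (simp flip: additive.diff[OF G] additive.add[OF G])
  also have "?G (dmv r) = dmv (?G r)"
  proof (rule map_gsubst[OF commuting_sect_op M.additive_dmod, symmetric])
    have "additive dmv"
      by (rule additive_map[OF M.additive_dmod])
    note rules = additive.diff[OF this] additive.minus[OF this]
    show "dmv (sect_op n i p) = sect_op n i (dmv p)" for i p
      by (simp add: sect_op_def rules dmv_lvar map_mvar[OF M.additive_dmod])
  qed
  also have "?G (lvar (basic_wt k) r) = sect_op n n (?G r) + ?G (lvar (basic_wt n) r)"
    by (simp add: k lvar_add_mset additive.add[OF G] gsubst_mvar[OF commuting_sect_op additive_mconst])
  also have "?G (lvar (mset ls) r) = lvar (mset ls) (?G r)" if "n \<notin> set ls" for ls
    using that by (induction ls) (auto simp: lvar_add_mset additive.zero[OF G] additive.add[OF G]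
        gsubst_mvar[OF commuting_sect_op additive_mconst] sect_op_def)
  then have "?G (lvar (basic_wt n) r) = lvar (basic_wt n) (?G r)"
    by simp
  finally have "?G p = ?G q"
    by (simp add: sect_op_def[of n n])
  then show ?thesis
    by (simp add: sect_def k)
qed

lemma mpolys_sect: "p \<in> mpolys k \<Longrightarrow> sect k p \<in> mpolys k"
proof (cases k)
  case (Suc n)
  assume "p \<in> mpolys k"
  then have "gsubst (sect_op n) mconst p \<in> mpolys k"
    unfolding mpolys_eq
  proof (rule gsubst_mpolys_on[OF commuting_sect_op additive_mconst _ mpolys_on_mconst])
    show "sect_op n i q \<in> mpolys_on {..<k}" if "i \<in> {..<k}" "q \<in> mpolys_on {..<k}" for i q
      using that Suc by (auto simp: sect_op_def intro!: mpolys_on_diff mpolys_on_uminus mpolys_on_mvar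
          mpolys_on_lvar mpolys_on_map[OF M.additive_dmod])
  qed
  then show ?thesis
    by (simp add: sect_def Suc)
qed (simp add: sect_def)

end

section \<open>Cochains and their representatives\<close>

lemma commuting_nth_mvar: "commuting (nth_op (map mvar is) :: nat \<Rightarrow> 'x::ab_group_add mpoly \<Rightarrow> 'x mpoly)"
  by (rule commuting_nth_op) (auto simp: additive_mvar mvar_commute)

context dop_module
begin

lemma mpolys_on_om:
  assumes "p \<in> mpolys_on V" "i \<in> V" shows "om i q p \<in> mpolys_on V"
  using assms(1)
proof (induction p arbitrary: q rule: mpoly_induct)
  case (const c)
  have "mpoly_mul mul i q (mconst c) \<in> mpolys_on V"
    unfolding mpoly_mul_def
    by (rule mpolys_on_psubst[OF additive_mvar additive_map_mul_left])
      (simp_all add: map_mconst[OF additive_mul] mpolys_on_mconst mpolys_on_mvar assms(2))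
  then show ?case
    by (simp add: om_mconst)
qed (simp_all add: om_mvar mpolys_on_add mpolys_on_mvar)

lemma mpolys_on_foldr_om:
  "p \<in> mpolys_on V \<Longrightarrow> set ls \<subseteq> V \<Longrightarrow> foldr (\<lambda>i. om i (q i)) ls p \<in> mpolys_on V"
  by (induction ls) (simp_all add: mpolys_on_om)

end

context lie_conformal_algebroid_module
begin

section \<open>The formula of the theorem in terms of slots\<close>

definition basic :: "'e list \<Rightarrow> 'e slots" where
  "basic us = zip us (map (\<lambda>i. {#i#}) [0..<length us])"

lemma length_basic [simp]: "length (basic us) = length us"
  and map_fst_basic [simp]: "map fst (basic us) = us"
  and map_snd_basic: "map snd (basic us) = map (\<lambda>i. {#i#}) [0..<length us]"
  and nth_basic [simp]: "i < length us \<Longrightarrow> basic us ! i = (us ! i, {#i#})"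
  by (simp_all add: basic_def)

lemma wt_basic [simp]: "wt (basic us) = basic_wt (length us)"
proof -
  have "sum_list (map (\<lambda>i. {#i#}) ls) = mset ls" for ls :: "nat list"
    by (induction ls) simp_all
  then show ?thesis
    by (simp add: wt_def map_snd_basic)
qed

lemma basic_update:
  assumes "i < length us"
  shows "basic (us[i := v]) = take i (basic us) @ (v, {#i#}) # drop (Suc i) (basic us)"
proof -
  have "basic (us[i := v]) = (basic us)[i := (v, {#i#})]"
    using assms by (intro nth_equalityI) (auto simp: nth_list_update)
  then show ?thesis
    using assms by (simp add: upd_conv_take_nth_drop)
qed

lemma wt_basic_remove:
  assumes "i < length us"
  shows "{#i#} + wt (take i (basic us) @ drop (Suc i) (basic us)) = basic_wt (length us)"
  using C.wt_nths_compl[of i "basic us"] assms by (simp add: nths_compl_nth)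

lemma labelled_nths_basic:
  assumes "length (nths us A) = k"
  shows "labelled k f (nths (basic us) A) =
    gsubst (nth_op (map mvar (nths [0..<length us] A))) mconst (f (nths us A))"
proof -
  have fst: "map fst (nths (basic us) A) = nths us A"
    by (simp flip: nths_map)
  have "map snd (nths (basic us) A) = map (\<lambda>i. {#i#}) (nths [0..<length us] A)"
    by (simp add: map_snd_basic flip: nths_map)
  then have "map lvar (map snd (nths (basic us) A)) = (map mvar (nths [0..<length us] A) :: ('m mpoly \<Rightarrow> 'm mpoly) list)"
    by (simp add: lvar_eq_mvar)
  moreover have "length (nths (basic us) A) = k"
    using assms fst by (metis length_map)
  ultimately show ?thesis
    by (simp add: labelled_def fst)
qed

lemma length_nths_compl2:
  "i < j \<Longrightarrow> j < length xs \<Longrightarrow> length (nths xs (- {i, j})) = length xs - 2"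
proof (induction xs arbitrary: i j)
  case (Cons x xs)
  then obtain j' where j: "j = Suc j'"
    by (cases j) auto
  with Cons show ?case
    by (cases i) (auto simp: nths_Cons_compl nths_compl_nth)
qed simp

text \<open>When slot i is labelled by the i-th variable, omitting a slot deletes the argument and
  its variable together, and the bracket slot is labelled by the sum of two variables.\<close>

lemma diff_formula_eq:
  assumes us: "length us = Suc k"
  shows "dformula k f us = C.ce_formula (labelled k f) (basic us)"
proof -
  have 1: "msubst (map mvar (nths [0..<Suc k] (- {i}))) (\<lambda>m. psubst (mvar i) mconst (lact (us ! i) m))
      (f (nths us (- {i}))) = actv (us ! i) {#i#} (labelled k f (nths (basic us) (- {i})))" if "i \<le> k" for i
  proof -
    let ?\<tau> = "nth_op (map mvar (nths [0..<Suc k] (- {i}))) :: nat \<Rightarrow> 'm mpoly \<Rightarrow> 'm mpoly"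
    have "actv (us ! i) {#i#} (gsubst ?\<tau> mconst p) = gsubst ?\<tau> (\<lambda>c. actv (us ! i) {#i#} (mconst c)) p" for p
      by (rule gsubst_hom[OF commuting_nth_mvar commuting_nth_mvar additive_mconst additive_actv])
        (simp add: nth_op_def actv_mvar)
    moreover have "length (nths us (- {i})) = k"
      using us that by (simp add: nths_compl_nth)
    ultimately show ?thesis
      using us additive_lact_subst[of "{#i#}" "us ! i"]
      by (simp only: labelled_nths_basic actv_mconst lvar_eq_mvar msubst_eq_gsubst[OF commuting_nth_mvar])
  qed
  have 2: "msubst ((\<lambda>p. mvar i p + mvar j p) # map mvar (nths [0..<Suc k] (- {i, j}))) mconst
       (f (e # nths us (- {i, j}))) = labelled k f ((e, {#i#} + {#j#}) # nths (basic us) (- {i, j}))"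
    if "i < j" "j \<le> k" for i j e
  proof -
    let ?l = "nths [0..<Suc k] (- {i, j})"
    have len: "length (nths xs (- {i, j})) = k - 1" if "length xs = Suc k" for xs :: "'z list"
      using length_nths_compl2[of i j xs] that \<open>i < j\<close> \<open>j \<le> k\<close> by simp
    have fst: "map fst (nths (basic us) (- {i, j})) = nths us (- {i, j})"
      by (simp flip: nths_map)
    have "map snd (nths (basic us) (- {i, j})) = map (\<lambda>i. {#i#}) ?l"
      using us by (simp add: map_snd_basic flip: nths_map)
    then have "map lvar (map snd ((e, {#i#} + {#j#}) # nths (basic us) (- {i, j})))
        = (\<lambda>p. mvar i p + mvar j p) # map mvar ?l"
      by (simp add: lvar_eq_mvar lvar_add_mset fun_eq_iff)
    note Ts = this[symmetric]
    have "length (nths (basic us) (- {i, j})) = k - 1"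
      using length_nths_compl2[of i j "basic us"] us that by simp
    then have "length ((e, {#i#} + {#j#}) # nths (basic us) (- {i, j})) = k"
      using that by simp
    then show ?thesis
      unfolding labelled_def Ts msubst_eq_gsubst[OF commuting_nth_lvar additive_mconst]
      by (simp add: fst)
  qed
  have "(\<Sum>i\<le>k. scal ((-1) ^ i) (msubst (map mvar (nths [0..<Suc k] (- {i})))
          (\<lambda>m. psubst (mvar i) mconst (lact (us ! i) m)) (f (nths us (- {i})))))
      = (\<Sum>i<length (basic us). signed i (actv (fst (basic us ! i)) (snd (basic us ! i)) (labelled k f (nths (basic us) (- {i})))))"
    using us by (intro sum.cong) (auto simp: 1 scal_power lessThan_Suc_atMost less_Suc_eq_le simp del: upt_Suc)
  moreover have "(\<Sum>j\<le>k. \<Sum>i<j. scal ((-1) ^ (i + j)) (psubst (mvar i)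
          (\<lambda>e. msubst ((\<lambda>p. mvar i p + mvar j p) # map mvar (nths [0..<Suc k] (- {i, j})))
             mconst (f (e # nths us (- {i, j})))) (br (us ! i) (us ! j))))
      = (\<Sum>j<length (basic us). \<Sum>i<j. signed (i + j) (psubst (lvar (snd (basic us ! i)))
        (\<lambda>e. labelled k f ((e, snd (basic us ! i) + snd (basic us ! j)) # nths (basic us) (- {i, j})))
          (br (fst (basic us ! i)) (fst (basic us ! j)))))"
    using us by (intro sum.cong) (auto simp: 2 scal_power lessThan_Suc_atMost less_Suc_eq_le lvar_eq_mvar simp del: upt_Suc)
  ultimately show ?thesis
    unfolding diff_formula_def C.ce_formula_def by (simp only:)
qed

lemma diff_formula_mpolys:
  assumes "length us = Suc k" "\<And>us. length us = k \<Longrightarrow> f us \<in> mpolys k"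
  shows "dformula k f us \<in> mpolys (Suc k)"
proof -
  have "C.ce_formula (labelled k f) (basic us) \<in> mpolys_on (set_mset (wt (basic us)))"
    by (rule mpolys_on_ce_formula) (rule labelled_mpolys_on, rule assms(2))
  moreover have "set_mset (wt (basic us)) = {..<Suc k}"
    by (simp add: assms(1) atLeast0LessThan del: upt_Suc)
  ultimately show ?thesis
    by (simp only: diff_formula_eq[OF assms(1)] mpolys_eq)
qed

lemma eqv_labelled_cong:
  assumes "\<And>us. length us = k \<Longrightarrow> beqv k (f us) (f' us)"
  shows "C.eqv (wt xs) (labelled k f xs) (labelled k f' xs)"
proof (cases "length xs = k")
  case True
  have "C.eqv (wt xs) (labelled k f xs) (eval_at (map snd xs) (f' (map fst xs)))"
    using True by (intro eqv_labelled assms) simp_all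
  with True show ?thesis
    by (simp add: labelled_def)
qed (simp add: labelled_def)

text \<open>Only the form of the values of \<open>X\<close> is assumed, so this also evaluates the
  differential of sums, multiples and differentials directly from given representatives.\<close>

lemma differential_qclass:
  assumes X: "\<And>us. length us = k \<Longrightarrow> f us \<in> mpolys k \<and> X us = qcl k (f us)"
    and us: "length us = Suc k"
  shows "differential scA br actM lact k X us = qcl (Suc k) (dformula k f us)"
proof -
  have const: "qcl (Suc k) (dformula k h us) = qcl (Suc k) (dformula k f us)"
    if h: "h \<in> reps k X" for h
  proof (rule qclass_eqI)
    have h: "h us \<in> mpolys k \<and> beqv k (f us) (h us)" if "length us = k" for us
      using h that X[OF that] by (auto simp: reps_def qclass_iff)
    show "dformula k h us \<in> mpolys (Suc k)"
      by (rule diff_formula_mpolys[OF us]) (simp add: h)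
    show "dformula k f us \<in> mpolys (Suc k)"
      by (rule diff_formula_mpolys[OF us]) (simp add: X)
    have "C.eqv (0 + wt (basic us)) (C.ce_formula (labelled k h) (basic us)) (C.ce_formula (labelled k f) (basic us))"
    proof (rule C.ce_formula_cong)
      show "C.eqv (0 + wt ys) (labelled k h ys) (labelled k f ys)" for ys
        using eqv_labelled_cong[of k h f ys] h by (simp add: C.eqv_sym)
    qed
    then show "beqv (Suc k) (dformula k h us) (dformula k f us)"
      by (simp add: diff_formula_eq[OF us] us del: upt_Suc)
  qed
  have "f \<in> reps k X"
    using X by (simp add: reps_def qclass_iff)
  then have "reps k X \<noteq> {}"
    by blast
  then have "(\<Union>h\<in>reps k X. qcl (Suc k) (dformula k h us)) =
      qcl (Suc k) (dformula k f us)"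
    by (rule SUP_eq_const) (rule const)
  then show ?thesis
    by (simp only: differential_def restrict_apply mem_Collect_eq us if_True simp_thms)
qed

text \<open>The conditions on a cochain, read on representatives up to congruence. Operators act in
  one slot at a time, the form that the arguments by slots deliver.\<close>

definition good_rep :: "nat \<Rightarrow> ('e list \<Rightarrow> 'm mpoly) \<Rightarrow> bool" where
  "good_rep k f \<longleftrightarrow> (\<forall>us. length us = k \<longrightarrow> f us \<in> mpolys k)
    \<and> (\<forall>us i v w. length us = k \<longrightarrow> i < k \<longrightarrow>
        beqv k (f (us[i := v + w])) (f (us[i := v]) + f (us[i := w])))
    \<and> (\<forall>us i P v. length us = k \<longrightarrow> i < k \<longrightarrow>
        beqv k (f (us[i := actE P v])) (M.om i (adj_symbol D P) (f (us[i := v]))))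
    \<and> (\<forall>us \<pi>. length us = k \<longrightarrow> \<pi> permutes {..<k} \<longrightarrow> beqv k (f us)
        (psigned \<pi> (rename k \<pi> (f (permute_list \<pi> us)))))"

lemma good_repD:
  assumes "good_rep k f" "length us = k"
  shows good_rep_mpolys: "f us \<in> mpolys k"
    and good_rep_add: "i < k \<Longrightarrow> beqv k (f (us[i := v + w])) (f (us[i := v]) + f (us[i := w]))"
    and good_rep_act: "i < k \<Longrightarrow> beqv k (f (us[i := actE P v])) (M.om i (adj_symbol D P) (f (us[i := v])))"
    and good_rep_permute: "\<pi> permutes {..<k} \<Longrightarrow> beqv k (f us)
        (psigned \<pi> (rename k \<pi> (f (permute_list \<pi> us))))"
  using assms unfolding good_rep_def by blast+

lemma eqv_psigned: "C.eqv w x y \<Longrightarrow> C.eqv w (psigned \<pi> x) (psigned \<pi> y)"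
  by (simp add: psigned_def C.eqv_minus)

text \<open>A permutation of the variables fixes their sum.\<close>

lemma eqv_rename:
  assumes "\<pi> permutes {..<k}" "beqv k p q"
  shows "beqv k (rename k \<pi> p)
    (rename k \<pi> q)"
proof -
  let ?Ws = "map (\<lambda>i. {#\<pi> i#}) [0..<k]"
  have "sum_list (map (\<lambda>i. {#\<pi> i#}) ls) = mset (map \<pi> ls)" for ls :: "nat list"
    by (induction ls) simp_all
  moreover have "permute_list \<pi> [0..<k] = map \<pi> [0..<k]"
    using permutes_in_image[OF assms(1)] by (auto simp: permute_list_def)
  then have "mset (map \<pi> [0..<k]) = basic_wt k"
    using mset_permute_list[of \<pi> "[0..<k]"] assms(1) by (metis diff_zero length_upt)
  ultimately have "sum_list ?Ws = basic_wt k"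
    by simp
  moreover have "map lvar ?Ws = (map mvar (map \<pi> [0..<k]) :: ('m mpoly \<Rightarrow> 'm mpoly) list)"
    by (simp add: lvar_eq_mvar)
  ultimately show ?thesis
    using eqv_gsubst_nth_lvar[of ?Ws p q] assms(2) by (simp only: length_map length_upt minus_nat.diff_0)
qed

lemma mpolys_rename:
  fixes p :: "'m mpoly"
  assumes "\<pi> permutes {..<k}" "p \<in> mpolys k"
  shows "rename k \<pi> p \<in> mpolys k"
  using assms(2) unfolding mpolys_eq
  by (rule gsubst_mpolys_on[OF commuting_nth_mvar additive_mconst _ mpolys_on_mconst])
    (use permutes_in_image[OF assms(1)] in \<open>auto simp: nth_op_def intro: mpolys_on_mvar\<close>)

lemma good_rep_cong:
  assumes f: "good_rep k f" and f': "\<And>us. length us = k \<Longrightarrow> f' us \<in> mpolys k"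
    and eqv: "\<And>us. length us = k \<Longrightarrow> beqv k (f' us) (f us)"
  shows "good_rep k f'"
  unfolding good_rep_def
proof (intro conjI allI impI)
  fix us :: "'e list" assume us: "length us = k"
  show "f' us \<in> mpolys k"
    by (rule f'[OF us])
  have upd: "beqv k (f' (us[i := v])) (f (us[i := v]))" for i v
    by (rule eqv) (simp add: us)
  note upd' = C.eqv_sym[OF upd]
  show "beqv k (f' (us[i := v + w])) (f' (us[i := v]) + f' (us[i := w]))" if "i < k" for i v w
    by (rule C.eqv_trans[OF upd C.eqv_trans[OF good_rep_add[OF f us that] C.eqv_add[OF upd' upd']]])
  show "beqv k (f' (us[i := actE P v])) (M.om i (adj_symbol D P) (f' (us[i := v])))" if "i < k" for i P v
    by (rule C.eqv_trans[OF upd C.eqv_trans[OF good_rep_act[OF f us that] eqv_om[OF count_basic_wt[OF that] upd']]])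
  show "beqv k (f' us)
        (psigned \<pi> (rename k \<pi> (f' (permute_list \<pi> us))))" if "\<pi> permutes {..<k}" for \<pi>
  proof (rule C.eqv_trans[OF eqv[OF us] C.eqv_trans[OF good_rep_permute[OF f us that] eqv_psigned[OF eqv_rename[OF that]]]])
    show "beqv k (f (permute_list \<pi> us)) (f' (permute_list \<pi> us))"
      by (rule C.eqv_sym[OF eqv]) (simp add: us)
  qed
qed

lemma UN_multi_twist:
  assumes "p \<in> mpolys k" "length as = k"
  shows "(\<Union>q\<in>qcl k p. qcl k (multi_twist D M.mul as q)) =
    qcl k (foldr (om_adj as) [0..<k] p)"
proof -
  let ?h = "foldr (om_adj as) [0..<k]"
  have "beqv k (foldr (om_adj as) ls x) (foldr (om_adj as) ls y)"
    if "beqv k x y" "set ls \<subseteq> {..<k}" for ls x y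
    using that by (induction ls) (auto intro: eqv_om[OF count_basic_wt])
  then have eqv: "beqv k (?h p) (?h q)" if "beqv k p q" for q
    using that by (simp add: atLeast0LessThan)
  have mem: "?h q \<in> mpolys k" if "q \<in> mpolys k" for q
    using that unfolding mpolys_eq by (rule M.mpolys_on_foldr_om) auto
  have "(\<Union>q\<in>qcl k p. qcl k (multi_twist D M.mul as q)) = (\<Union>q\<in>qcl k p. qcl k (?h q))"
    using assms(2) M.multi_twist_eq[of _ as] by (intro SUP_cong refl) (simp add: qclass_iff)
  also have "\<dots> = qcl k (?h p)"
    by (rule UN_qclass[where h="?h"]) (rule assms(1) mem eqv | assumption)+
  finally show ?thesis .
qed

lemma UN_rename:
  assumes "p \<in> mpolys k" "\<pi> permutes {..<k}"
  shows "qsc k (of_int (sign \<pi>))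
      (\<Union>q\<in>qcl k p. qcl k (msubst (map mvar (map \<pi> [0..<k])) mconst q)) =
    qcl k (psigned \<pi> (rename k \<pi> p))"
proof -
  have "(\<Union>q\<in>qcl k p. qcl k (msubst (map mvar (map \<pi> [0..<k])) mconst q)) =
      qcl k (rename k \<pi> p)"
    unfolding msubst_eq_gsubst[OF commuting_nth_mvar additive_mconst]
    by (rule UN_qclass[where h="rename k \<pi>"])
      (rule assms mpolys_rename eqv_rename | assumption)+
  then show ?thesis
    by (simp only: qscale_qclass[OF mpolys_rename[OF assms(2,1)]] scal_sign)
qed

lemma cochain_good_rep:
  assumes \<phi>: "\<phi> \<in> cochains scA D actE actM k" and f: "f \<in> reps k \<phi>"
  shows "good_rep k f" and "length us = k \<Longrightarrow> \<phi> us = qcl k (f us)"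
proof -
  have \<phi>_fun: "\<phi> \<in> {us. length us = k} \<rightarrow>\<^sub>E mpolys k // qrel (mod_D actM) k"
    and \<phi>_add: "\<forall>us i v w. length us = k \<longrightarrow> i < k \<longrightarrow>
        \<phi> (us[i := v + w]) = qad k (\<phi> (us[i := v])) (\<phi> (us[i := w]))"
    and \<phi>_act: "\<forall>as us. length as = k \<longrightarrow> length us = k \<longrightarrow>
        \<phi> (map2 actE as us) = (\<Union>p\<in>\<phi> us. qcl k (multi_twist D M.mul as p))"
    and \<phi>_perm: "\<forall>us \<pi>. length us = k \<longrightarrow> \<pi> permutes {..<k} \<longrightarrow>
        \<phi> us = qsc k (of_int (sign \<pi>))
          (\<Union>p\<in>\<phi> (permute_list \<pi> us). qcl k (msubst (map mvar (map \<pi> [0..<k])) mconst p))"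
    using \<phi> unfolding cochains_def mem_Collect_eq by - (elim conjE, assumption)+
  have quot: "\<phi> us \<in> mpolys k // qrel (mod_D actM) k" if "length us = k" for us
    using PiE_mem[OF \<phi>_fun] that by simp
  have mem: "f us \<in> mpolys k" and \<phi>_eq: "\<phi> us = qcl k (f us)" if "length us = k" for us
    using quotient_qclass[OF quot[OF that], of "f us"] f that by (auto simp: reps_def)
  show "length us = k \<Longrightarrow> \<phi> us = qcl k (f us)"
    by (rule \<phi>_eq)
  show "good_rep k f"
    unfolding good_rep_def
  proof (intro conjI allI impI)
    fix us :: "'e list" assume us: "length us = k"
    show "f us \<in> mpolys k"
      by (rule mem[OF us])
    have upd: "f (us[i := v]) \<in> mpolys k" "\<phi> (us[i := v]) = qcl k (f (us[i := v]))" for i v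
      using mem[of "us[i := v]"] \<phi>_eq[of "us[i := v]"] us by simp_all
    show "beqv k (f (us[i := v + w])) (f (us[i := v]) + f (us[i := w]))" if "i < k" for i v w
    proof -
      have "\<phi> (us[i := v + w]) = qad k (\<phi> (us[i := v])) (\<phi> (us[i := w]))"
        using \<phi>_add us that by blast
      then show ?thesis
        using qclass_eqD(1)[OF _ upd(1)] by (simp only: upd qadd_qclass)
    qed
    show "beqv k (f (us[i := actE P v])) (M.om i (adj_symbol D P) (f (us[i := v])))" if "i < k" for i P v
    proof -
      \<comment> \<open>All other slots receive the operator 1, whose twist is the identity.\<close>
      let ?as = "(replicate k 1)[i := P]"
      have "\<phi> (map2 actE ?as (us[i := v])) = (\<Union>p\<in>\<phi> (us[i := v]). qcl k (multi_twist D M.mul ?as p))"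
        using \<phi>_act us by (simp del: list_update.simps)
      moreover have "map2 actE ?as (us[i := v]) = us[i := actE P v]"
        using map2_replicate_act[of i "us[i := v]" P] us that by simp
      ultimately have "qcl k (f (us[i := actE P v])) = qcl k (M.om i (adj_symbol D P) (f (us[i := v])))"
        using UN_multi_twist[OF upd(1), of ?as i v] foldr_om_single[OF that, of P] by (simp add: upd(2))
      then show ?thesis
        by (rule qclass_eqD(1)[OF _ upd(1)])
    qed
    show "beqv k (f us)
        (psigned \<pi> (rename k \<pi> (f (permute_list \<pi> us))))"
      if \<pi>: "\<pi> permutes {..<k}" for \<pi>
    proof -
      have p: "length (permute_list \<pi> us) = k"
        using us by simp
      have "\<phi> us = qsc k (of_int (sign \<pi>))
          (\<Union>p\<in>\<phi> (permute_list \<pi> us). qcl k (msubst (map mvar (map \<pi> [0..<k])) mconst p))"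
        using \<phi>_perm us \<pi> by blast
      then have "qcl k (f us) = qcl k (psigned \<pi> (rename k \<pi> (f (permute_list \<pi> us))))"
        unfolding \<phi>_eq[OF us] \<phi>_eq[OF p] UN_rename[OF mem[OF p] \<pi>] .
      then show ?thesis
        by (rule qclass_eqD(1)[OF _ mem[OF us]])
    qed
  qed
qed

lemma good_rep_cochain:
  assumes g: "good_rep k g"
  shows "(\<lambda>us\<in>{us. length us = k}. qcl k (g us)) \<in> cochains scA D actE actM k" (is "?\<phi> \<in> _")
proof -
  have mem: "g us \<in> mpolys k" if "length us = k" for us
    by (rule good_rep_mpolys[OF g that])
  have \<phi>: "?\<phi> us = qcl k (g us)" if "length us = k" for us
    using that by simp
  show ?thesis
    unfolding cochains_def
  proof (intro CollectI conjI allI impI)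
    show "?\<phi> \<in> {us. length us = k} \<rightarrow>\<^sub>E mpolys k // qrel (mod_D actM) k"
      unfolding restrict_PiE_iff by (intro ballI qclass_in_quotient mem) simp
  next
    fix us :: "'e list" and i v w assume us: "length us = k" and i: "i < k"
    have upd: "length (us[i := v]) = k" for v
      using us by simp
    show "?\<phi> (us[i := v + w]) = qad k (?\<phi> (us[i := v])) (?\<phi> (us[i := w]))"
      unfolding \<phi>[OF upd] qadd_qclass[OF mem[OF upd] mem[OF upd]]
      by (rule qclass_eqI[OF mem[OF upd] _ good_rep_add[OF g us i]])
        (use mem[OF upd] in \<open>simp add: mpolys_eq mpolys_on_add\<close>)
    show "?\<phi> (us[i := mod_scale scA actE c v]) = qsc k c (?\<phi> (us[i := v]))" for c
      unfolding \<phi>[OF upd] qscale_qclass[OF mem[OF upd]]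
    proof (rule qclass_eqI[OF mem[OF upd] mpolys_scal[OF mem[OF upd]]])
      show "beqv k (g (us[i := mod_scale scA actE c v])) (scal c (g (us[i := v])))"
        \<comment> \<open>A scalar is the operator with symbol \<open>[:scA c 1:]\<close>. Since
          \<open>D\<close> kills its coefficient, its twist is multiplication of the coefficients of
          the value.\<close>
        using good_rep_act[OF g us i, of "[:scA c 1:]" v]
        by (simp add: mod_scale_def[of scA actE] E.A.adj_symbol_const M.om_scalar M.mod_scale_eq_mul)
    qed
  next
    fix as us assume as: "length (as :: 'a poly list) = k" and us: "length (us :: 'e list) = k"
    have map2: "length (map2 actE as us) = k"
      using as us by simp
    show "?\<phi> (map2 actE as us) = (\<Union>p\<in>?\<phi> us. qcl k (multi_twist D M.mul as p))"
      unfolding \<phi>[OF map2] \<phi>[OF us] UN_multi_twist[OF mem[OF us] as]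
    proof (rule qclass_eqI[OF mem[OF map2]])
      show "foldr (om_adj as) [0..<k] (g us) \<in> mpolys k"
        using mem[OF us] unfolding mpolys_eq by (rule M.mpolys_on_foldr_om) auto
      show "beqv k (g (map2 actE as us)) (foldr (om_adj as) [0..<k] (g us))"
      proof (rule eqv_map2_act[OF _ as us])
        show "beqv k (g (vs[i := actE P (vs ! i)])) (M.om i (adj_symbol D P) (g vs))"
          if "length vs = k" "i < k" for vs i P
          using good_rep_act[OF g that, of P "vs ! i"] by simp
      qed
    qed
  next
    fix us :: "'e list" and \<pi> assume us: "length us = k" and \<pi>: "\<pi> permutes {..<k}"
    have p: "length (permute_list \<pi> us) = k"
      using us by simp
    have psigned: "psigned \<pi> x \<in> mpolys k" if "x \<in> mpolys k" for x :: "'m mpoly"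
      using that by (simp add: psigned_def mpolys_eq mpolys_on_uminus)
    show "?\<phi> us = qsc k (of_int (sign \<pi>))
       (\<Union>p\<in>?\<phi> (permute_list \<pi> us). qcl k (msubst (map mvar (map \<pi> [0..<k])) mconst p))"
      unfolding \<phi>[OF us] \<phi>[OF p] UN_rename[OF mem[OF p] \<pi>]
      by (rule qclass_eqI[OF mem[OF us] psigned[OF mpolys_rename[OF \<pi> mem[OF p]]] good_rep_permute[OF g us \<pi>]])
  qed
qed

end

section \<open>The differential\<close>

context lie_conformal_algebroid_module
begin

text \<open>The single occurrence of \<open>i\<close> in \<open>W\<close> contributes the derivative
  of \<open>a\<close>; all other variables commute with the twist.\<close>

lemma om_lvar_main:
  assumes "count W i = 1"
  shows "M.om i [:a:] (lvar W p) = lvar W (M.om i [:a:] p) + M.om i [:D a:] p"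
proof -
  from assms obtain V where W: "W = add_mset i V"
    by (metis count_eq_zero_iff multi_member_split zero_neq_one)
  with assms have "i \<notin># V"
    by (simp add: count_eq_zero_iff)
  then show ?thesis
    by (simp add: W lvar_add_mset M.om_const_mvar M.om_lvar)
qed

text \<open>Inserting labels carries the twist in the variable of the last slot to the twist in
  \<open>i\<close>, because \<open>i\<close> occurs once in the last label and in no other.\<close>

lemma last_linear_labelled:
  assumes add: "C.multiadditive (labelled k f)"
    and mem: "\<And>us. length us = k \<Longrightarrow> f us \<in> mpolys k"
    and mul: "\<And>es e a. Suc (length es) = k \<Longrightarrow>
      beqv k (f (es @ [E.A.mul a e])) (M.om (length es) [:a:] (f (es @ [e])))"
  shows "last_linear i 0 (labelled k f)"
  unfolding last_linear_def
proof (intro conjI allI impI)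
  fix ys :: "'e slots" and e a and W V :: "nat multiset"
  assume "i \<notin># 0 + wt ys"
  then have i: "i \<notin># wt ys"
    by simp
  show "labelled k f ys \<in> mpolys_on (- {i})"
    by (rule mpolys_on_mono[OF labelled_mpolys_on[OF mem]]) (use i in auto)
  assume W: "count W i = 1"
  show "C.eqv (0 + wt ys + W) (labelled k f (ys @ [(E.A.mul a e, W)])) (M.om i [:a:] (labelled k f (ys @ [(e, W)])))"
  proof (cases "Suc (length ys) = k")
    case True
    define \<tau> :: "nat \<Rightarrow> 'm mpoly \<Rightarrow> 'm mpoly" where "\<tau> = nth_op (map lvar (map snd (ys @ [(e, W)])))"
    have \<tau>: "commuting \<tau>"
      unfolding \<tau>_def by (rule commuting_nth_lvar)
    have "C.eqv (wt (ys @ [(E.A.mul a e, W)])) (labelled k f (ys @ [(E.A.mul a e, W)]))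
        (gsubst (nth_op (map lvar (map snd (ys @ [(E.A.mul a e, W)])))) mconst (M.om (length ys) [:a:] (f (map fst ys @ [e]))))"
      using mul[of "map fst ys" a e] True by (intro eqv_labelled) simp_all
    moreover have "gsubst \<tau> mconst (M.om (length ys) [:a:] p) = M.om i [:a:] (gsubst \<tau> mconst p)" for p
    proof (induction p arbitrary: a rule: mpoly_induct_all)
      case (add p q)
      then show ?case
        by (simp add: additive.add[OF additive_gsubst[OF \<tau> additive_mconst]])
    next
      case (const m)
      show ?case
        by (simp add: M.om_mconst M.mpoly_mul_const map_mconst[OF M.additive_mul] gsubst_mconst[OF \<tau> additive_mconst])
    next
      case (var j p)
      have "M.om i [:a:] (\<tau> j x) = \<tau> j (M.om i [:a:] x) + (if j = length ys then M.om i [:D a:] x else 0)" for x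
      \<comment> \<open>Labels of earlier slots lack \<open>i\<close> and commute with the twist,
        the last one costs a derivative of \<open>a\<close>, and beyond the list the operator is the
        identity.\<close>
      proof (cases j "length ys" rule: linorder_cases)
        case less
        then have "snd (ys ! j) \<subseteq># wt ys"
          using C.wt_nths_compl[of j ys] by (metis mset_subset_eq_add_left)
        with i have "i \<notin># snd (ys ! j)"
          using mset_subset_eqD by fast
        with less show ?thesis
          by (simp add: \<tau>_def nth_op_def nth_append M.om_lvar)
      next
        case equal
        then show ?thesis
          by (simp add: \<tau>_def nth_op_def nth_append om_lvar_main[OF W])
      next
        case greater
        then show ?thesis
          by (simp add: \<tau>_def nth_op_def)
      qed
      then show ?case
        by (simp add: M.om_const_mvar additive.add[OF additive_gsubst[OF \<tau> additive_mconst]]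
            additive.zero[OF additive_gsubst[OF \<tau> additive_mconst]] gsubst_mvar[OF \<tau> additive_mconst] var(3))
    qed
    ultimately show ?thesis
      using True by (simp add: labelled_def \<tau>_def)
  qed (simp add: labelled_def)
  assume V: "i \<notin># V"
  \<comment> \<open>Adding \<open>V\<close> to the variable \<open>i\<close> turns \<open>W\<close>
    into \<open>W + V\<close> and leaves the other labels alone, so the shift clause becomes an
    instance of \<open>labelled_natural\<close>.\<close>
  define \<sigma> where "\<sigma> j = (if j = i then add_mset i V else {#j#})" for j
  have free: "i \<notin># U \<Longrightarrow> sum_labels \<sigma> U = U" for U
    by (induction U) (auto simp: \<sigma>_def)
  from W obtain U where U: "W = add_mset i U"
    by (metis count_eq_zero_iff multi_member_split zero_neq_one)
  with W have "i \<notin># U"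
    by (simp add: count_eq_zero_iff)
  then have "sum_labels \<sigma> W = W + V"
    by (simp add: U free) (simp add: \<sigma>_def)
  moreover have "map (apsnd (sum_labels \<sigma>)) zs = zs" if "i \<notin># wt zs" for zs :: "'e slots"
    using that by (induction zs) (auto simp: free)
  ultimately show "labelled k f (ys @ [(e, W + V)]) = shift_var i V (labelled k f (ys @ [(e, W)]))"
    using labelled_natural[of k f \<sigma> "ys @ [(e, W)]"] i by (simp add: shift_var_def \<sigma>_def)
qed (rule add)

text \<open>A representative of the differential to which the exact Cartan identities apply, thanks
  to the additivity gained by \<open>sect\<close>.\<close>

definition diff_rep :: "nat \<Rightarrow> ('e list \<Rightarrow> 'm mpoly) \<Rightarrow> 'e list \<Rightarrow> 'm mpoly" where
  "diff_rep k f us = C.loday_diff (labelled k (\<lambda>vs. sect k (f vs))) (basic us)"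

context
  fixes k f assumes f: "good_rep k f"
begin

private abbreviation "f' \<equiv> \<lambda>vs. sect k (f vs)"
private abbreviation "F \<equiv> labelled k f'"

private lemma f': "good_rep k f'"
  by (rule good_rep_cong[OF f]) (simp_all add: mpolys_sect good_rep_mpolys[OF f] eqv_sect)

private lemma multiadditive_F: "C.multiadditive F"
proof (rule multiadditive_labelled)
  fix es fs :: "'e list" and e e' :: 'e assume len: "length es + Suc (length fs) = k"
  have "beqv k (f (es @ (e + e') # fs)) (f (es @ e # fs) + f (es @ e' # fs))"
    using good_rep_add[OF f, of "es @ e # fs" "length es" e e'] len by simp
  then have "sect k (f (es @ (e + e') # fs)) = sect k (f (es @ e # fs) + f (es @ e' # fs))"
    \<comment> \<open>There is a slot, so \<open>k\<close> is positive and \<open>sect\<close>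
      depends only on the class.\<close>
    using len by (intro sect_eqI) simp_all
  then show "sect k (f (es @ (e + e') # fs)) = sect k (f (es @ e # fs)) + sect k (f (es @ e' # fs))"
    by (simp add: additive.add[OF additive_sect])
qed

private lemma act_F:
  assumes "length es + Suc (length fs) = k"
  shows "beqv k (f' (es @ actE P e # fs)) (M.om (length es) (adj_symbol D P) (f' (es @ e # fs)))"
  using good_rep_act[OF f', of "es @ e # fs" "length es" P e] assms by simp

private lemma sesquilinear_F: "C.sesquilinear 0 F"
proof (rule sesquilinear_labelled)
  fix es fs :: "'e list" and e :: 'e assume len: "length es + Suc (length fs) = k"
  show "beqv k (f' (es @ E.A.dmod e # fs)) (- mvar (length es) (f' (es @ e # fs)))"
    using act_F[OF len, of "[:0, 1:]" e] unfolding M.om_adj_var mod_D_def .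
qed

private lemma alternating_F: "C.alternating 0 F"
  by (rule alternating_labelled) (rule good_rep_permute[OF f'])

private lemma last_linear_F: "last_linear i 0 F"
proof (rule last_linear_labelled[OF multiadditive_F good_rep_mpolys[OF f']])
  fix es :: "'e list" and e a assume len: "Suc (length es) = k"
  show "beqv k (f' (es @ [E.A.mul a e])) (M.om (length es) [:a:] (f' (es @ [e])))"
    using act_F[of es "[]" "[:a:]" e] len unfolding E.A.adj_symbol_const mod_mul_def by simp
qed

lemma diff_rep_mpolys:
  assumes "length us = Suc k" shows "diff_rep k f us \<in> mpolys (Suc k)"
proof -
  have "C.loday_diff F (basic us) \<in> mpolys_on ({} \<union> set_mset (wt (basic us)))"
    by (rule mpolys_on_loday_diff) (simp add: labelled_mpolys_on good_rep_mpolys[OF f'])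
  moreover have "set_mset (wt (basic us)) = {..<Suc k}"
    by (simp add: assms atLeast0LessThan del: upt_Suc)
  ultimately show ?thesis
    by (simp only: diff_rep_def mpolys_eq Un_empty_left)
qed

text \<open>Naturality obtains the value on arbitrary labels from the one on the variables by
  substitution. This makes a second application of the recursion meaningful.\<close>

lemma labelled_diff_rep:
  assumes "length xs = Suc k"
  shows "labelled (Suc k) (diff_rep k f) xs = C.loday_diff F xs"
proof -
  let ?us = "map fst xs"
  define \<sigma> where "\<sigma> i = (if i < Suc k then snd (xs ! i) else {#})" for i
  have us: "length ?us = Suc k"
    using assms by simp
  have "map (apsnd (sum_labels \<sigma>)) (basic ?us) = xs"
    by (rule nth_equalityI) (use assms in \<open>simp_all add: \<sigma>_def\<close>)
  then have "C.loday_diff F xs = relabel \<sigma> (diff_rep k f ?us)"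
    using loday_diff_labelled_natural[of k f' \<sigma> "basic ?us"] by (simp add: diff_rep_def)
  also have "\<dots> = eval_at (map snd xs) (diff_rep k f ?us)"
    by (rule gsubst_cong[OF commuting_lvar commuting_nth_lvar additive_mconst diff_rep_mpolys[OF us, unfolded mpolys_eq]])
      (use assms in \<open>simp add: \<sigma>_def nth_op_def fun_eq_iff\<close>)
  finally show ?thesis
    using assms by (simp add: labelled_def)
qed

text \<open>Passing to additive representatives changes the formula only up to congruence;
  alternation then turns it into the recursion.\<close>

lemma diff_formula_diff_rep:
  assumes "length us = Suc k"
  shows "beqv (Suc k) (dformula k f us) (diff_rep k f us)"
proof -
  have "C.eqv (0 + wt (basic us)) (C.ce_formula (labelled k f) (basic us)) (C.ce_formula F (basic us))"
  proof (rule C.ce_formula_cong)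
    show "C.eqv (0 + wt ys) (labelled k f ys) (F ys)" for ys
      using eqv_labelled_cong[of k f f' ys] by (simp add: C.eqv_sym[OF eqv_sect])
  qed
  also have "C.eqv (0 + wt (basic us)) \<dots> (C.loday_diff F (basic us))"
    by (rule C.ce_formula_eqv[OF alternating_F])
  finally show ?thesis
    unfolding diff_formula_eq[OF assms] by (simp add: diff_rep_def assms del: upt_Suc)
qed

text \<open>\<open>eqv_act_general\<close> leaves additivity, \<partial> and multiplication by A.
  The last of these is the one for which the slot has to be brought to the end.\<close>

lemma good_rep_diff_rep: "good_rep (Suc k) (diff_rep k f)"
  unfolding good_rep_def
proof (intro conjI allI impI)
  fix us :: "'e list" assume us: "length us = Suc k"
  show "diff_rep k f us \<in> mpolys (Suc k)"
    by (rule diff_rep_mpolys[OF us])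
  have add: "diff_rep k f (us[i := v + w]) = diff_rep k f (us[i := v]) + diff_rep k f (us[i := w])" if "i < Suc k" for i v w
    using additive.add[OF C.multiadditiveD'[OF C.multiadditive_loday_diff[OF multiadditive_F]]] that us
    by (simp add: diff_rep_def basic_update)
  then show "beqv (Suc k) (diff_rep k f (us[i := v + w])) (diff_rep k f (us[i := v]) + diff_rep k f (us[i := w]))"
    if "i < Suc k" for i v w
    using that by simp
  show "beqv (Suc k) (diff_rep k f (us[i := actE P v])) (M.om i (adj_symbol D P) (diff_rep k f (us[i := v])))"
    if i: "i < Suc k" for i P v
  proof (rule eqv_act_general[OF i])
    let ?b = "basic us"
    let ?xs = "take i ?b" and ?zs = "drop (Suc i) ?b"
    have h: "diff_rep k f (us[i := v]) = C.loday_diff F (?xs @ (v, {#i#}) # ?zs)" for v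
      using i us by (simp add: diff_rep_def basic_update)
    have wt: "{#i#} + wt (?xs @ ?zs) = basic_wt (Suc k)"
      using wt_basic_remove[of i us] i us by (simp del: upt_Suc wt_append)
    then have wt': "wt (?xs @ (v, {#i#}) # ?zs) = basic_wt (Suc k)" for v
      by (simp add: add_ac del: upt_Suc)
    show "beqv (Suc k) (diff_rep k f (us[i := v + w])) (diff_rep k f (us[i := v]) + diff_rep k f (us[i := w]))" for v w
      using add[OF i] by simp
    show "beqv (Suc k) (diff_rep k f (us[i := E.A.dmod v])) (- mvar i (diff_rep k f (us[i := v])))" for v
      using C.sesquilinearD[OF C.sesquilinear_loday_diff[OF multiadditive_F sesquilinear_F], of ?xs v "{#i#}" ?zs]
      unfolding h wt' by simp
    \<comment> \<open>Slot i moves together with its label, so the last slot is now labelled by the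
      variable \<open>i\<close>. The sign is the same on both sides of the claim and drops out
      through \<open>signed_double\<close>.\<close>
    have move: "beqv (Suc k) (C.loday_diff F ((?xs @ ?zs) @ [(v, {#i#})])) (signed (length ?zs) (diff_rep k f (us[i := v])))" for v
      using C.alternating_move[OF C.alternating_loday_diff[OF multiadditive_F alternating_F sesquilinear_F], of ?xs ?zs "(v, {#i#})" "[]"] wt
      unfolding h by (simp add: add_ac del: upt_Suc)
    \<comment> \<open>In the total label every variable occurs once, hence \<open>i\<close> is
      absent from the other slots.\<close>
    have "count ({#i#} + wt (?xs @ ?zs)) i = 1"
      unfolding wt by (rule count_basic_wt[OF i])
    then have "i \<notin># 0 + wt (?xs @ ?zs)"
      by (simp add: count_eq_zero_iff del: wt_append)
    from loday_diff_last_mul[OF last_linear_F this]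
    have last: "beqv (Suc k) (C.loday_diff F ((?xs @ ?zs) @ [(E.A.mul a v, {#i#})]))
        (M.om i [:a:] (C.loday_diff F ((?xs @ ?zs) @ [(v, {#i#})])))" for a v
      using wt by (simp add: add.commute del: upt_Suc)
    show "beqv (Suc k) (diff_rep k f (us[i := E.A.mul a v])) (M.om i [:a:] (diff_rep k f (us[i := v])))" for a v
    proof -
      have "beqv (Suc k) (signed (length ?zs) (diff_rep k f (us[i := E.A.mul a v])))
          (M.om i [:a:] (signed (length ?zs) (diff_rep k f (us[i := v]))))"
        by (rule C.eqv_trans[OF C.eqv_sym[OF move] C.eqv_trans[OF last eqv_om[OF count_basic_wt[OF i] move]]])
      from C.eqv_signed[OF this, of "length ?zs"] show ?thesis
        by (simp only: signed_hom[OF M.additive_om] signed_double)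
    qed
  qed
  show "beqv (Suc k) (diff_rep k f us)
      (psigned \<pi> (rename (Suc k) \<pi> (diff_rep k f (permute_list \<pi> us))))"
    if \<pi>: "\<pi> permutes {..<Suc k}" for \<pi>
  proof -
    have \<pi>': "\<pi> permutes {..<length (basic us)}"
      using \<pi> us by simp
    have "map snd (permute_list \<pi> (basic us)) = map (\<lambda>i. {#\<pi> i#}) [0..<Suc k]"
      using us permutes_in_image[OF \<pi>] by (auto simp: permute_list_def simp del: upt_Suc)
    then have "map lvar (map snd (permute_list \<pi> (basic us))) = (map mvar (map \<pi> [0..<Suc k]) :: ('m mpoly \<Rightarrow> 'm mpoly) list)"
      by (simp add: lvar_eq_mvar del: upt_Suc)
    moreover have "map fst (permute_list \<pi> (basic us)) = permute_list \<pi> us"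
      using \<pi>' by (simp flip: permute_list_map)
    moreover have len: "length (permute_list \<pi> (basic us)) = Suc k"
      using us by simp
    ultimately have "C.loday_diff F (permute_list \<pi> (basic us)) =
        rename (Suc k) \<pi> (diff_rep k f (permute_list \<pi> us))"
      unfolding labelled_diff_rep[OF len, symmetric] labelled_def by (simp only: if_True simp_thms)
    moreover have "C.eqv (0 + wt (basic us)) (C.loday_diff F (basic us)) (psigned \<pi> (C.loday_diff F (permute_list \<pi> (basic us))))"
      by (rule C.alternating_permute[OF C.alternating_loday_diff[OF multiadditive_F alternating_F sesquilinear_F] \<pi>'])
    ultimately show ?thesis
      by (simp only: diff_rep_def add_0 wt_basic us)
  qed
qed

text \<open>As \<open>diff_rep k f\<close> alternates, the formula for it is congruent to the
  recursion. At the relevant length its labelled form is \<open>C.loday_diff F\<close>, and the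
  Cartan calculus yields exactly 0.\<close>

lemma diff_rep_diff_rep:
  assumes "length us = Suc (Suc k)"
  shows "beqv (Suc (Suc k)) (dformula (Suc k) (diff_rep k f) us) 0"
proof -
  have "C.alternating 0 (labelled (Suc k) (diff_rep k f))"
    by (rule alternating_labelled) (rule good_rep_permute[OF good_rep_diff_rep])
  then have "C.eqv (0 + wt (basic us)) (C.ce_formula (labelled (Suc k) (diff_rep k f)) (basic us))
      (C.loday_diff (labelled (Suc k) (diff_rep k f)) (basic us))"
    by (rule C.ce_formula_eqv)
  also have "C.loday_diff (labelled (Suc k) (diff_rep k f)) (basic us) = C.loday_diff (C.loday_diff F) (basic us)"
    by (rule C.loday_diff_cong_length) (simp add: labelled_diff_rep assms)
  also have "\<dots> = 0"
    by (rule C.loday_diff_loday_diff[OF multiadditive_F])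
  finally show ?thesis
    unfolding diff_formula_eq[OF assms] by (simp add: assms del: upt_Suc)
qed

end

section \<open>The differential on classes\<close>

abbreviation "dif \<equiv> differential scA br actM lact"

lemma cochain_reps:
  assumes \<phi>: "\<phi> \<in> cochains scA D actE actM k"
  obtains f where "f \<in> reps k \<phi>"
proof -
  have "\<exists>p. p \<in> \<phi> us" if "length us = k" for us
  proof -
    have "\<phi> us \<in> mpolys k // qrel (mod_D actM) k"
      using \<phi> that unfolding cochains_def mem_Collect_eq by (elim conjE) (erule PiE_mem, simp)
    then obtain p where "p \<in> mpolys k" "\<phi> us = qcl k p"
      by (auto simp: quotient_def qclass_def)
    then show ?thesis
      using qclass_iff[of p k p] by auto
  qed
  then have "(\<lambda>us. SOME p. p \<in> \<phi> us) \<in> reps k \<phi>"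
    by (simp add: reps_def some_in_eq ex_in_conv)
  then show ?thesis
    by (rule that)
qed

lemma differential_rep:
  assumes "\<phi> \<in> cochains scA D actE actM k" "f \<in> reps k \<phi>" "length us = Suc k"
  shows "dif k \<phi> us = qcl (Suc k) (dformula k f us)"
  using cochain_good_rep[OF assms(1,2)] by (intro differential_qclass assms(3)) (simp add: good_rep_mpolys)

lemma differential_eq_diff_rep:
  assumes "\<phi> \<in> cochains scA D actE actM k" "f \<in> reps k \<phi>"
  shows "dif k \<phi> = (\<lambda>us\<in>{us. length us = Suc k}. qcl (Suc k) (diff_rep k f us))"
proof
  fix us
  note f = cochain_good_rep(1)[OF assms]
  show "dif k \<phi> us = (\<lambda>us\<in>{us. length us = Suc k}. qcl (Suc k) (diff_rep k f us)) us"
  proof (cases "length us = Suc k")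
    case True
    have "dformula k f us \<in> mpolys (Suc k)"
      using True good_rep_mpolys[OF f] by (rule diff_formula_mpolys)
    from qclass_eqI[OF this diff_rep_mpolys[OF f True] diff_formula_diff_rep[OF f True]] True
    show ?thesis
      by (simp add: differential_rep[OF assms])
  qed (simp add: differential_def)
qed

lemma differential_cochain:
  assumes "\<phi> \<in> cochains scA D actE actM k"
  shows "dif k \<phi> \<in> cochains scA D actE actM (Suc k)"
proof -
  obtain f where f: "f \<in> reps k \<phi>"
    by (rule cochain_reps[OF assms])
  show ?thesis
    unfolding differential_eq_diff_rep[OF assms f]
    by (rule good_rep_cochain[OF good_rep_diff_rep[OF cochain_good_rep(1)[OF assms f]]])
qed

lemma differential_differential:
  assumes "\<phi> \<in> cochains scA D actE actM k"
  shows "dif (Suc k) (dif k \<phi>) = cochain_zero actM (Suc (Suc k))"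
proof
  fix us
  obtain f where f: "f \<in> reps k \<phi>"
    by (rule cochain_reps[OF assms])
  note good = cochain_good_rep(1)[OF assms f]
  have dif: "dif k \<phi> vs = qcl (Suc k) (diff_rep k f vs)" if "length vs = Suc k" for vs
    using that by (simp add: differential_eq_diff_rep[OF assms f])
  show "dif (Suc k) (dif k \<phi>) us = cochain_zero actM (Suc (Suc k)) us"
  proof (cases "length us = Suc (Suc k)")
    case True
    have "dif (Suc k) (dif k \<phi>) us = qcl (Suc (Suc k)) (dformula (Suc k) (diff_rep k f) us)"
      by (rule differential_qclass[OF _ True]) (simp add: diff_rep_mpolys[OF good] dif)
    also have "\<dots> = qcl (Suc (Suc k)) 0"
      by (rule qclass_eqI[OF diff_formula_mpolys[OF True diff_rep_mpolys[OF good]] _ diff_rep_diff_rep[OF good True]])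
        (simp_all add: mpolys_eq mpolys_on_zero)
    finally show ?thesis
      using True by (simp add: cochain_zero_def)
  qed (simp add: differential_def cochain_zero_def)
qed

lemma labelled_add: "labelled k (\<lambda>us. f us + g us) = (\<lambda>xs. labelled k f xs + labelled k g xs)"
proof
  show "labelled k (\<lambda>us. f us + g us) xs = labelled k f xs + labelled k g xs" for xs
    by (simp add: labelled_def additive.add[OF additive_gsubst[OF commuting_nth_lvar[of "map snd xs"] additive_mconst], simplified])
qed

lemma labelled_scal: "labelled k (\<lambda>us. scal c (f us)) = (\<lambda>xs. scal c (labelled k f xs))"
proof
  fix xs :: "'e slots"
  have "additive (mod_scale scA actM c)"
    by (simp add: M.mod_scale_eq_mul M.additive_mul)
  then have "scal c (eval_at (map snd xs) p) =
      eval_at (map snd xs) (scal c p)" for p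
    by (rule map_gsubst[OF commuting_nth_lvar]) (simp add: nth_op_def scal_lvar)
  then show "labelled k (\<lambda>us. scal c (f us)) xs = scal c (labelled k f xs)"
    by (simp only: labelled_def) (simp add: additive.zero[OF additive_scal])
qed

text \<open>Sums of representatives represent sums of cochains, and the formula is exactly additive
  in the representative.\<close>

lemma differential_add: assumes \<phi>: "\<phi> \<in> cochains scA D actE actM k" and \<psi>: "\<psi> \<in> cochains scA D actE actM k"
  shows "dif k (cochain_add actM k \<phi> \<psi>) = cochain_add actM (Suc k) (dif k \<phi>) (dif k \<psi>)"
proof
  fix us
  obtain f g where f: "f \<in> reps k \<phi>" and g: "g \<in> reps k \<psi>"
    using cochain_reps[OF \<phi>] cochain_reps[OF \<psi>] by metis
  note good = cochain_good_rep[OF \<phi> f] cochain_good_rep[OF \<psi> g]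
  note mem = good_rep_mpolys[OF good(1)] good_rep_mpolys[OF good(3)]
  show "dif k (cochain_add actM k \<phi> \<psi>) us = cochain_add actM (Suc k) (dif k \<phi>) (dif k \<psi>) us"
  proof (cases "length us = Suc k")
    case True
    have "dif k (cochain_add actM k \<phi> \<psi>) us = qcl (Suc k) (dformula k (\<lambda>vs. f vs + g vs) us)"
    proof (rule differential_qclass[OF _ True])
      fix vs :: "'e list" assume "length vs = k"
      then show "f vs + g vs \<in> mpolys k \<and> cochain_add actM k \<phi> \<psi> vs = qcl k (f vs + g vs)"
        using mem[of vs] by (simp add: cochain_add_def good(2,4) qadd_qclass) (simp add: mpolys_eq mpolys_on_add)
    qed
    also have "dformula k (\<lambda>vs. f vs + g vs) us =
        dformula k f us + dformula k g us"
      by (simp only: diff_formula_eq[OF True] labelled_add C.ce_formula_add)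
    also have "qcl (Suc k) (dformula k f us + dformula k g us) =
        cochain_add actM (Suc k) (dif k \<phi>) (dif k \<psi>) us"
      using True by (simp add: cochain_add_def differential_rep[OF \<phi> f] differential_rep[OF \<psi> g]
          qadd_qclass diff_formula_mpolys mem)
    finally show ?thesis .
  qed (simp add: differential_def cochain_add_def)
qed

lemma differential_scale:
  assumes \<phi>: "\<phi> \<in> cochains scA D actE actM k"
  shows "dif k (cochain_scale scA actM k c \<phi>) = cochain_scale scA actM (Suc k) c (dif k \<phi>)"
proof
  fix us
  obtain f where f: "f \<in> reps k \<phi>"
    by (rule cochain_reps[OF \<phi>])
  note good = cochain_good_rep[OF \<phi> f]
  note mem = good_rep_mpolys[OF good(1)]
  show "dif k (cochain_scale scA actM k c \<phi>) us = cochain_scale scA actM (Suc k) c (dif k \<phi>) us"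
  proof (cases "length us = Suc k")
    case True
    have "dif k (cochain_scale scA actM k c \<phi>) us = qcl (Suc k) (dformula k (\<lambda>vs. scal c (f vs)) us)"
      by (rule differential_qclass[OF _ True])
        (simp add: cochain_scale_def good(2) mem qscale_qclass mpolys_scal)
    also have "dformula k (\<lambda>vs. scal c (f vs)) us = scal c (dformula k f us)"
      unfolding diff_formula_eq[OF True] labelled_scal
      by (rule C.ce_formula_hom) (simp_all add: additive_scal scal_lvar scal_actv)
    also have "qcl (Suc k) (scal c (dformula k f us)) = cochain_scale scA actM (Suc k) c (dif k \<phi>) us"
      using True by (simp add: cochain_scale_def differential_rep[OF \<phi> f] qscale_qclass diff_formula_mpolys mem)
    finally show ?thesis .
  qed (simp add: differential_def cochain_scale_def)
qed

end

theorem proposition3p1: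
  fixes scA :: "'f::field_char_0 \<Rightarrow> 'a::comm_ring_1 \<Rightarrow> 'a" and D :: "'a \<Rightarrow> 'a"
    and actE :: "'a poly \<Rightarrow> 'e::ab_group_add \<Rightarrow> 'e"
    and br :: "'e \<Rightarrow> 'e \<Rightarrow> 'e poly" and \<theta> :: "'e \<Rightarrow> 'a \<Rightarrow> 'a poly"
    and actM :: "'a poly \<Rightarrow> 'm::ab_group_add \<Rightarrow> 'm"
    and lact :: "'e \<Rightarrow> 'm \<Rightarrow> 'm poly"
    and k :: nat
  assumes "lie_conformal_algebroid scA D actE br \<theta>"
    and "lie_conformal_algebroid_module scA D actE br \<theta> actM lact"
  shows "(\<forall>\<phi>\<in>cochains scA D actE actM k. \<forall>f\<in>reps k \<phi>. \<forall>us. length us = Suc k \<longrightarrow>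
            differential scA br actM lact k \<phi> us =
              qclass (mod_D actM) (Suc k) (diff_formula scA br actM lact k f us))
       \<and> (\<forall>\<phi>\<in>cochains scA D actE actM k.
            differential scA br actM lact k \<phi> \<in> cochains scA D actE actM (Suc k))
       \<and> (\<forall>\<phi>\<in>cochains scA D actE actM k. \<forall>\<psi>\<in>cochains scA D actE actM k.
            differential scA br actM lact k (cochain_add actM k \<phi> \<psi>) =
              cochain_add actM (Suc k) (differential scA br actM lact k \<phi>)
                (differential scA br actM lact k \<psi>))
       \<and> (\<forall>c. \<forall>\<phi>\<in>cochains scA D actE actM k.
            differential scA br actM lact k (cochain_scale scA actM k c \<phi>) =
              cochain_scale scA actM (Suc k) c (differential scA br actM lact k \<phi>))
       \<and> (\<forall>\<phi>\<in>cochains scA D actE actM k.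
            differential scA br actM lact (Suc k) (differential scA br actM lact k \<phi>) =
              cochain_zero actM (Suc (Suc k)))"
proof -
  interpret lie_conformal_algebroid_module scA D actE br \<theta> actM lact
    by (rule assms(2))
  show ?thesis
    by (intro conjI ballI allI impI differential_rep differential_cochain differential_add
        differential_scale differential_differential)
qed

end
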